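(* There is an algorithm that, given a deterministic Wheeler graph $W=(V,E)$ with $n=|V|$ and an integer $k$, computes the number of distinct $k$-mers contained in $W$ in time $O(n^4\log k)$.
   Context: A labeled graph has a finite vertex set $V$ and an edge set $E\subseteq V\times V\times\Sigma$, where $\Sigma$ is a finite alphabet totally ordered by $\prec$; an edge $(u,v,a)$ goes from $u$ to $v$ and has label $a$. A $k$-mer is a string $\alpha\in\Sigma^k$. The graph contains $\alpha$ if there is a walk $v_0,\dots,v_k$ with $(v_{i-1},v_i,\alpha[i])\in E$ for all $1\le i\le k$. The graph is deterministic if no two distinct outgoing edges of the same vertex have the same label. It is a Wheeler graph if there is a total ordering $<$ of the nodes (a Wheeler order) such that nodes with no incoming edges precede those with positive indegree, and for every pair of edges $(u,v,a),(u',v',a')$: (W1) $a\prec a'\Rightarrow v<v'$; (W2) $(a=a'\wedge u<u')\Rightarrow v\le v'$. The input Wheeler graph is given together with a Wheeler order of its nodes. Model of computation: Word RAM whose word size is large enough to hold the numbers handled, which are proportional to the maximum number of distinct $\ell$-mers in the graph over $1\le \ell\le k$, so that arithmetic operations on these numbers take constant time. *)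

theory Defs
  imports Complex_Main
begin

unbundle bit_operations_syntax

section \<open>Labeled graphs, \<open>k\<close>-mers and Wheeler orders\<close>

text \<open>An edge \<open>(u, v, a)\<close> goes from \<open>u\<close> to \<open>v\<close> and has label \<open>a\<close>.\<close>

definition labeled_graph :: "'a set \<Rightarrow> 'v set \<Rightarrow> ('v \<times> 'v \<times> 'a) set \<Rightarrow> bool" where
  "labeled_graph \<Sigma> V E \<longleftrightarrow> finite \<Sigma> \<and> finite V \<and> E \<subseteq> V \<times> V \<times> \<Sigma>"

definition contains_string :: "'v set \<Rightarrow> ('v \<times> 'v \<times> 'a) set \<Rightarrow> 'a list \<Rightarrow> bool" where
  "contains_string V E \<alpha> \<longleftrightarrow>
     (\<exists>ws. length ws = length \<alpha> + 1 \<and> set ws \<subseteq> V \<and>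
           (\<forall>i < length \<alpha>. (ws ! i, ws ! (i + 1), \<alpha> ! i) \<in> E))"

definition kmers :: "'a set \<Rightarrow> 'v set \<Rightarrow> ('v \<times> 'v \<times> 'a) set \<Rightarrow> nat \<Rightarrow> 'a list set" where
  "kmers \<Sigma> V E k = {\<alpha>. length \<alpha> = k \<and> set \<alpha> \<subseteq> \<Sigma> \<and> contains_string V E \<alpha>}"

definition max_kmers :: "'a set \<Rightarrow> 'v set \<Rightarrow> ('v \<times> 'v \<times> 'a) set \<Rightarrow> nat \<Rightarrow> nat" where
  "max_kmers \<Sigma> V E k = Max ((\<lambda>l. card (kmers \<Sigma> V E l)) ` {1..k})"

definition deterministic :: "('v \<times> 'v \<times> 'a) set \<Rightarrow> bool" where
  "deterministic E \<longleftrightarrow>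
     (\<forall>u v v' a. (u, v, a) \<in> E \<and> (u, v', a) \<in> E \<longrightarrow> v = v')"

text \<open>The relation \<open>r\<close> is the strict order: \<open>(u, v) \<in> r\<close> means \<open>u < v\<close>.\<close>

definition wheeler_order ::
  "'v set \<Rightarrow> ('v \<times> 'v \<times> 'a::linorder) set \<Rightarrow> ('v \<times> 'v) set \<Rightarrow> bool" where
  "wheeler_order V E r \<longleftrightarrow>
     strict_linear_order_on V r \<and>
     (\<forall>v \<in> V. \<forall>v' \<in> V. (\<nexists>u a. (u, v, a) \<in> E) \<and> (\<exists>u a. (u, v', a) \<in> E) \<longrightarrow> (v, v') \<in> r) \<and>
     (\<forall>u v a u' v' a'. (u, v, a) \<in> E \<and> (u', v', a') \<in> E \<longrightarrow>
        (a < a' \<longrightarrow> (v, v') \<in> r) \<and>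
        (a = a' \<and> (u, u') \<in> r \<longrightarrow> v = v' \<or> (v, v') \<in> r))"


section \<open>Word RAM\<close>

text \<open>
  A program is a list of instructions working on finitely many registers (those it mentions)
  and on a random access memory. With word size \<open>w\<close>, registers and memory cells hold
  numbers below \<open>2 ^ w\<close>, arithmetic is modulo \<open>2 ^ w\<close>, and a register used as an address
  reaches the cells below \<open>2 ^ w\<close>. Every instruction costs one time unit. The machine halts
  when the program counter leaves the program.
\<close>

datatype binop = Add | Sub | Mul | Div | Mod | And | Or | Xor | Shl | Shr | Lt | Eq

fun binop_sem :: "nat \<Rightarrow> binop \<Rightarrow> nat \<Rightarrow> nat \<Rightarrow> nat" where
  "binop_sem w Add x y = (x + y) mod 2 ^ w"
| "binop_sem w Sub x y = (x + 2 ^ w - y) mod 2 ^ w"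
| "binop_sem w Mul x y = (x * y) mod 2 ^ w"
| "binop_sem w Div x y = x div y"
| "binop_sem w Mod x y = x mod y"
| "binop_sem w And x y = x AND y"
| "binop_sem w Or x y = x OR y"
| "binop_sem w Xor x y = x XOR y"
| "binop_sem w Shl x y = (x * 2 ^ y) mod 2 ^ w"
| "binop_sem w Shr x y = x div 2 ^ y"
| "binop_sem w Lt x y = (if x < y then 1 else 0) mod 2 ^ w"
| "binop_sem w Eq x y = (if x = y then 1 else 0) mod 2 ^ w"

datatype instr =
    Const nat nat           \<comment> \<open>\<open>Const i c\<close>: register \<open>i\<close> := \<open>c\<close>\<close>
  | Binop binop nat nat nat \<comment> \<open>\<open>Binop f i j l\<close>: register \<open>i\<close> := \<open>f\<close> (register \<open>j\<close>) (register \<open>l\<close>)\<close>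
  | Load nat nat            \<comment> \<open>\<open>Load i j\<close>: register \<open>i\<close> := cell addressed by register \<open>j\<close>\<close>
  | Store nat nat           \<comment> \<open>\<open>Store i j\<close>: cell addressed by register \<open>i\<close> := register \<open>j\<close>\<close>
  | Jump nat                \<comment> \<open>\<open>Jump q\<close>: continue at position \<open>q\<close>\<close>
  | Jump_zero nat nat       \<comment> \<open>\<open>Jump_zero i q\<close>: continue at \<open>q\<close> if register \<open>i\<close> is zero\<close>

record config =
  pc :: nat
  regs :: "nat \<Rightarrow> nat"
  mem :: "nat \<Rightarrow> nat"

fun exec :: "nat \<Rightarrow> instr \<Rightarrow> config \<Rightarrow> config" where
  "exec w (Const i c) s =
     s\<lparr>pc := pc s + 1, regs := (regs s)(i := c mod 2 ^ w)\<rparr>"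
| "exec w (Binop f i j l) s =
     s\<lparr>pc := pc s + 1, regs := (regs s)(i := binop_sem w f (regs s j) (regs s l))\<rparr>"
| "exec w (Load i j) s =
     s\<lparr>pc := pc s + 1, regs := (regs s)(i := mem s (regs s j))\<rparr>"
| "exec w (Store i j) s =
     s\<lparr>pc := pc s + 1, mem := (mem s)(regs s i := regs s j)\<rparr>"
| "exec w (Jump q) s = s\<lparr>pc := q\<rparr>"
| "exec w (Jump_zero i q) s = s\<lparr>pc := (if regs s i = 0 then q else pc s + 1)\<rparr>"

definition halted :: "instr list \<Rightarrow> config \<Rightarrow> bool" where
  "halted P s \<longleftrightarrow> length P \<le> pc s"

definition step :: "nat \<Rightarrow> instr list \<Rightarrow> config \<Rightarrow> config" where
  "step w P s = (if halted P s then s else exec w (P ! pc s) s)"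

definition initial :: "nat list \<Rightarrow> config" where
  "initial xs = \<lparr>pc = 0, regs = (\<lambda>_. 0), mem = (\<lambda>i. if i < length xs then xs ! i else 0)\<rparr>"

text \<open>
  On input \<open>xs\<close>, program \<open>P\<close> halts after at most \<open>t\<close> steps with output \<open>y\<close> in register 0
  (a halted machine no longer changes).
\<close>

definition computes_within :: "nat \<Rightarrow> instr list \<Rightarrow> nat list \<Rightarrow> nat \<Rightarrow> nat \<Rightarrow> bool" where
  "computes_within w P xs t y \<longleftrightarrow>
     (let s = (step w P ^^ t) (initial xs) in halted P s \<and> regs s 0 = y)"


section \<open>Encoding of the input\<close>

text \<open>
  Vertices are \<open>0, \<dots>, n - 1\<close> and labels are machine words compared as numbers.
  The list \<open>vs\<close> holds the vertices in increasing Wheeler order, and \<open>es\<close> lists the edges in an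
  arbitrary order; each edge takes three words.
\<close>

definition lists_in_order :: "'v set \<Rightarrow> ('v \<times> 'v) set \<Rightarrow> 'v list \<Rightarrow> bool" where
  "lists_in_order V r vs \<longleftrightarrow> set vs = V \<and> sorted_wrt (\<lambda>u v. (u, v) \<in> r) vs"

definition encode_input :: "nat \<Rightarrow> nat list \<Rightarrow> (nat \<times> nat \<times> nat) list \<Rightarrow> nat list" where
  "encode_input k vs es =
     [length vs, length es, k] @ vs @ concat (map (\<lambda>(u, v, a). [u, v, a]) es)"

text \<open>
  The word size with constant \<open>c\<close>: words hold \<open>c\<close> times the maximum number of distinct
  \<open>l\<close>-mers, \<open>1 \<le> l \<le> k\<close>; they can address the memory, where \<open>(n + 1) ^ c \<le> 2 ^ w\<close> is the usual
  assumption that \<open>w\<close> is at least a constant multiple of the logarithm of the input size;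
  and the input numbers \<open>k\<close> and the labels are words.
\<close>

definition word_size_ok ::
  "nat \<Rightarrow> nat \<Rightarrow> nat set \<Rightarrow> nat set \<Rightarrow> (nat \<times> nat \<times> nat) set \<Rightarrow> nat \<Rightarrow> bool" where
  "word_size_ok c w \<Sigma> V E k \<longleftrightarrow>
     c * max_kmers \<Sigma> V E k \<le> 2 ^ w \<and> (card V + 1) ^ c \<le> 2 ^ w \<and>
     k < 2 ^ w \<and> (\<forall>a \<in> \<Sigma>. a < 2 ^ w)"

end

theory Submission
  imports Defs
begin

text \<open>
  For positions \<open>u \<le> v\<close> in the Wheeler order let \<open>D l u v\<close> be the set of strings of length \<open>l\<close> that
  can be read from \<open>u\<close> and from \<open>v\<close> but from no position in between. The number of distinct
  \<open>k\<close>-mers is the sum of all \<open>card (D k u u)\<close> minus the sum of all \<open>card (D k u v)\<close> with \<open>u < v\<close>.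
  Reading one letter gives a linear recursion in \<open>l\<close> with a 0-1 matrix indexed by pairs. By
  determinism and the Wheeler order a pair \<open>p < q\<close> has at most one predecessor: the last source of
  \<open>p\<close> together with the first source of \<open>q\<close>. Hence this matrix and all its powers are given by a
  partial function on pairs and by the \<open>n\<close> columns at diagonal pairs, and one squaring takes
  \<open>O(n ^ 4)\<close> operations. The squarings are combined along the binary digits of \<open>k\<close>. All numbers
  may be taken modulo \<open>2 ^ w\<close>, since only the final count has to fit into a word.
\<close>

section \<open>A structured language compiled to the word RAM\<close>

text \<open>Squaring stays sparse because the off-diagonal pairs form a closed part: if
  \<open>(u, v)\<close> leads to \<open>(p, q)\<close> with \<open>p \<noteq> q\<close>, then
  \<open>u \<noteq> v\<close>, since determinism gives one position only one target per letter. An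
  off-diagonal column of a power therefore depends on off-diagonal pairs alone and is obtained by
  composing partial functions. Diagonal columns have no such form, because distinct positions may
  merge into one target. They have n ^ 3 entries in total, and each entry of a product sums over n
  diagonal middle pairs, which is where n ^ 4 arises; the off-diagonal middle pairs add one update
  per pair and column, n ^ 3 in all.

  Intermediate powers and alternating partial sums are not shown to fit into a word; only addresses
  and loop counters are shown not to wrap. Time is tracked in the same judgement as correctness,
  with generous constants, so that nested loops simply multiply their budgets.\<close>

datatype exp = Var nat | Lit nat | Bin binop exp exp | Inp exp | Arr nat exp exp exp

datatype com =
    Assign nat exp
  | AStore nat exp exp exp exp
  | Seq com com (infixr ";;" 60)
  | Ite exp com com
  | While exp com

record hstate =
  vr :: "nat \<Rightarrow> nat"
  ar :: "nat \<Rightarrow> nat \<times> nat \<times> nat \<Rightarrow> nat"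

text \<open>
  Even registers are temporaries, register 1 holds the address of the first cell after the input
  and register 3 the side length \<open>n\<close> of the arrays; variable \<open>x\<close> lives in register \<open>2 * x + 5\<close>.
  Sixteen arrays with three indices below \<open>n\<close> are interleaved.
\<close>

definition caddr :: "nat \<Rightarrow> nat \<Rightarrow> instr list \<Rightarrow> instr list \<Rightarrow> instr list \<Rightarrow> instr list" where
  "caddr d j ca cb cc =
     ca @ [Binop Mul (2*d) (2*d) 3] @ cb @ [Binop Add (2*d) (2*d) (2*d+2), Binop Mul (2*d) (2*d) 3] @
     cc @ [Binop Add (2*d) (2*d) (2*d+2), Const (2*d+2) 16, Binop Mul (2*d) (2*d) (2*d+2),
           Const (2*d+2) j, Binop Add (2*d) (2*d) (2*d+2), Binop Add (2*d) (2*d) 1]"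

text \<open>The even registers from \<open>2 * d\<close> upward serve as an evaluation stack, and
  the value ends up in register \<open>2 * d\<close>. \<open>Binop Or\<close> of a register with
  itself is a move.\<close>

primrec ce :: "nat \<Rightarrow> exp \<Rightarrow> instr list" where
  "ce d (Var x) = [Binop Or (2*d) (2*x+5) (2*x+5)]"
| "ce d (Lit c) = [Const (2*d) c]"
| "ce d (Bin f a b) = ce d a @ ce (d+1) b @ [Binop f (2*d) (2*d) (2*d+2)]"
| "ce d (Inp a) = ce d a @ [Load (2*d) (2*d)]"
| "ce d (Arr j a b c) = caddr d j (ce d a) (ce (d+1) b) (ce (d+1) c) @ [Load (2*d) (2*d)]"

text \<open>Expressions contain no jumps, so this is both the length of the code and its exact
  running time. The 10 for an array access is nine instructions of address arithmetic and the
  \<open>Load\<close>.\<close>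

primrec te :: "exp \<Rightarrow> nat" where
  "te (Var x) = 1"
| "te (Lit c) = 1"
| "te (Bin f a b) = te a + te b + 1"
| "te (Inp a) = te a + 1"
| "te (Arr j a b c) = te a + te b + te c + 10"

lemma length_ce [simp]: "length (ce d e) = te e"
  by (induction e arbitrary: d) (auto simp: caddr_def)

primrec csize :: "com \<Rightarrow> nat" where
  "csize (Assign x e) = te e + 1"
| "csize (AStore j a b c e) = te a + te b + te c + te e + 10"
| "csize (c1 ;; c2) = csize c1 + csize c2"
| "csize (Ite e c1 c2) = te e + csize c1 + csize c2 + 2"
| "csize (While e c) = te e + csize c + 2"

text \<open>Jump targets are absolute: \<open>off\<close> is the address at which the code will be
  placed, and \<open>csize\<close> supplies the distances over code that is still to come.\<close>

primrec compile :: "nat \<Rightarrow> com \<Rightarrow> instr list" where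
  "compile off (Assign x e) = ce 0 e @ [Binop Or (2*x+5) 0 0]"
| "compile off (AStore j a b c e) =
     caddr 0 j (ce 0 a) (ce 1 b) (ce 1 c) @ ce 1 e @ [Store 0 2]"
| "compile off (c1 ;; c2) = compile off c1 @ compile (off + csize c1) c2"
| "compile off (Ite e c1 c2) =
     ce 0 e @ [Jump_zero 0 (off + te e + csize c1 + 2)] @ compile (off + te e + 1) c1 @
     [Jump (off + te e + csize c1 + csize c2 + 2)] @ compile (off + te e + csize c1 + 2) c2"
| "compile off (While e c) =
     ce 0 e @ [Jump_zero 0 (off + te e + csize c + 2)] @ compile (off + te e + 1) c @ [Jump off]"

lemma length_comp [simp]: "length (compile off c) = csize c"
  by (induction c arbitrary: off) (auto simp: caddr_def)

text \<open>Syntactic bounds on the effects of a command, from which the frame conditions of the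
  timed rules are read off.\<close>

primrec var_writes :: "com \<Rightarrow> nat set" where
  "var_writes (Assign x e) = {x}"
| "var_writes (AStore j a b c e) = {}"
| "var_writes (c1 ;; c2) = var_writes c1 \<union> var_writes c2"
| "var_writes (Ite e c1 c2) = var_writes c1 \<union> var_writes c2"
| "var_writes (While e c) = var_writes c"

primrec arr_writes :: "com \<Rightarrow> nat set" where
  "arr_writes (Assign x e) = {}"
| "arr_writes (AStore j a b c e) = {j}"
| "arr_writes (c1 ;; c2) = arr_writes c1 \<union> arr_writes c2"
| "arr_writes (Ite e c1 c2) = arr_writes c1 \<union> arr_writes c2"
| "arr_writes (While e c) = arr_writes c"

definition code_at :: "instr list \<Rightarrow> nat \<Rightarrow> instr list \<Rightarrow> bool" where
  "code_at P off cs \<longleftrightarrow> (\<forall>i < length cs. off + i < length P \<and> P ! (off + i) = cs ! i)"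

lemma code_at_Nil [simp]: "code_at P off []"
  by (simp add: code_at_def)

lemma code_at_Cons [simp]:
  "code_at P off (c # cs) \<longleftrightarrow> off < length P \<and> P ! off = c \<and> code_at P (Suc off) cs"
  unfolding code_at_def by (auto simp: nth_Cons less_Suc_eq_0_disj split: nat.splits)

lemma code_at_append [simp]:
  "code_at P off (c1 @ c2) \<longleftrightarrow> code_at P off c1 \<and> code_at P (off + length c1) c2"
  by (induction c1 arbitrary: off) auto

lemma code_at_self: "code_at (pre @ cs @ post) (length pre) cs"
  by (simp add: code_at_def nth_append)

section \<open>Semantics and exact running time of the language\<close>

locale word_ram =
  fixes w n :: nat and xs :: "nat list"
  assumes n_pos: "1 \<le> n"
    and fits: "length xs + 16 * n ^ 3 \<le> 2 ^ w"
begin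

abbreviation "W \<equiv> (2::nat) ^ w"

primrec eval :: "exp \<Rightarrow> hstate \<Rightarrow> nat" where
  "eval (Var x) s = vr s x"
| "eval (Lit c) s = c mod W"
| "eval (Bin f a b) s = binop_sem w f (eval a s) (eval b s)"
| "eval (Inp a) s = xs ! eval a s"
| "eval (Arr j a b c) s = ar s j (eval a s, eval b s, eval c s)"

primrec eok :: "exp \<Rightarrow> hstate \<Rightarrow> bool" where
  "eok (Var x) s = True"
| "eok (Lit c) s = True"
| "eok (Bin f a b) s = (eok a s \<and> eok b s)"
| "eok (Inp a) s = (eok a s \<and> eval a s < length xs)"
| "eok (Arr j a b c) s = (j < 16 \<and> eok a s \<and> eok b s \<and> eok c s \<and>
     eval a s < n \<and> eval b s < n \<and> eval c s < n)"

text \<open>A loop runs up to the first iterate at which its guard vanishes. Without such an iterate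
  \<open>LEAST\<close> is unspecified; \<open>ok\<close> therefore demands that the chosen iterate
  really ends the loop, and \<open>sem\<close> and \<open>tm\<close> are meaningful only where
  \<open>ok\<close> holds.\<close>

primrec sem :: "com \<Rightarrow> hstate \<Rightarrow> hstate" where
  "sem (Assign x e) s = s\<lparr>vr := (vr s)(x := eval e s)\<rparr>"
| "sem (AStore j a b c e) s =
     s\<lparr>ar := (ar s)(j := (ar s j)((eval a s, eval b s, eval c s) := eval e s))\<rparr>"
| "sem (c1 ;; c2) s = sem c2 (sem c1 s)"
| "sem (Ite e c1 c2) s = (if eval e s \<noteq> 0 then sem c1 s else sem c2 s)"
| "sem (While e c) s = (sem c ^^ (LEAST m. eval e ((sem c ^^ m) s) = 0)) s"

primrec ok :: "com \<Rightarrow> hstate \<Rightarrow> bool" where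
  "ok (Assign x e) s = eok e s"
| "ok (AStore j a b c e) s = (eok (Arr j a b c) s \<and> eok e s)"
| "ok (c1 ;; c2) s = (ok c1 s \<and> ok c2 (sem c1 s))"
| "ok (Ite e c1 c2) s = (eok e s \<and> (if eval e s \<noteq> 0 then ok c1 s else ok c2 s))"
| "ok (While e c) s = (let m = LEAST m. eval e ((sem c ^^ m) s) = 0 in
     eval e ((sem c ^^ m) s) = 0 \<and> (\<forall>i\<le>m. eok e ((sem c ^^ i) s)) \<and>
     (\<forall>i<m. ok c ((sem c ^^ i) s)))"

text \<open>The count matches the layout of \<open>compile\<close>: a completed iteration pays for
  the guard, \<open>Jump_zero\<close> and the jump back, the last test only for the first two, and
  only the first branch of a conditional ends with a jump.\<close>

primrec tm :: "com \<Rightarrow> hstate \<Rightarrow> nat" where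
  "tm (Assign x e) s = te e + 1"
| "tm (AStore j a b c e) s = te a + te b + te c + te e + 10"
| "tm (c1 ;; c2) s = tm c1 s + tm c2 (sem c1 s)"
| "tm (Ite e c1 c2) s = te e + 1 + (if eval e s \<noteq> 0 then tm c1 s + 1 else tm c2 s)"
| "tm (While e c) s = (let m = LEAST m. eval e ((sem c ^^ m) s) = 0 in
     (\<Sum>i<m. te e + 2 + tm c ((sem c ^^ i) s)) + te e + 1)"

lemma sem_var_frame: "x \<notin> var_writes c \<Longrightarrow> vr (sem c s) x = vr s x"
proof (induction c arbitrary: s)
  case (While e c)
  have "vr ((sem c ^^ m) s) x = vr s x" for m
    using While by (induction m) auto
  then show ?case by simp
qed auto

lemma sem_arr_frame: "j \<notin> arr_writes c \<Longrightarrow> ar (sem c s) j = ar s j"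
proof (induction c arbitrary: s)
  case (While e c)
  have "ar ((sem c ^^ m) s) j = ar s j" for m
    using While by (induction m) auto
  then show ?case by simp
qed auto

text \<open>With interleaved arrays the offset of an array is the literal \<open>j\<close>;
  consecutive blocks would require the value n ^ 3 in a register.\<close>

definition cell :: "nat \<Rightarrow> nat \<Rightarrow> nat \<Rightarrow> nat \<Rightarrow> nat" where
  "cell j a b c = length xs + (16 * ((a * n + b) * n + c) + j)"

lemma index_less: "a < n \<Longrightarrow> b < n \<Longrightarrow> c < n \<Longrightarrow> (a * n + b) * n + c < n ^ 3"
proof -
  assume *: "a < n" "b < n" "c < n"
  have bound: "x * n + y < z * n" if "x < z" "y < n" for x y z :: nat
  proof -
    have "x * n + y < Suc x * n" using that by simp
    also have "\<dots> \<le> z * n" using that by (intro mult_le_mono1) simp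
    finally show ?thesis .
  qed
  show ?thesis
    unfolding power3_eq_cube using * by (intro bound)
qed

text \<open>The reserve of \<open>16 * n ^ 3\<close> cells in \<open>fits\<close> is exactly the
  range of the mixed-radix index, so array addresses do not wrap around.\<close>

lemma cell_less: "j < 16 \<Longrightarrow> a < n \<Longrightarrow> b < n \<Longrightarrow> c < n \<Longrightarrow> cell j a b c < W"
proof -
  assume "j < 16" "a < n" "b < n" "c < n"
  moreover have "x < y \<Longrightarrow> 16 * x + j < 16 * y" for x y using \<open>j < 16\<close> by linarith
  ultimately have "16 * ((a * n + b) * n + c) + j < 16 * n ^ 3" using index_less by blast
  then show ?thesis using fits unfolding cell_def by (meson add_strict_left_mono less_le_trans)
qed

lemma mult_add_inj:
  fixes x y i j m :: nat
  assumes "i < m" "j < m"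
  shows "x * m + i = y * m + j \<longleftrightarrow> x = y \<and> i = j"
proof
  assume eq: "x * m + i = y * m + j"
  have "(x * m + i) div m = x" "(y * m + j) div m = y" "(x * m + i) mod m = i" "(y * m + j) mod m = j"
    using assms by (auto simp: add.commute)
  then show "x = y \<and> i = j" using eq by metis
qed auto

lemma cell_inj:
  assumes "j < 16" "a < n" "b < n" "c < n" "j' < 16" "a' < n" "b' < n" "c' < n"
  shows "cell j a b c = cell j' a' b' c' \<longleftrightarrow> j = j' \<and> a = a' \<and> b = b' \<and> c = c'"
proof -
  have "cell j a b c = cell j' a' b' c' \<longleftrightarrow>
      ((a * n + b) * n + c) * 16 + j = ((a' * n + b') * n + c') * 16 + j'"
    by (simp add: cell_def mult.commute)
  then show ?thesis
    using assms by (simp only: mult_add_inj) blast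
qed

text \<open>Only odd registers, the input and the array cells are constrained. Even registers are
  free, so evaluating an expression cannot disturb the relation.\<close>

definition conc :: "hstate \<Rightarrow> (nat \<Rightarrow> nat) \<Rightarrow> (nat \<Rightarrow> nat) \<Rightarrow> bool" where
  "conc s r m \<longleftrightarrow> (\<forall>x. r (2*x+5) = vr s x) \<and> r 1 = length xs \<and> r 3 = n \<and>
     (\<forall>i < length xs. m i = xs ! i) \<and>
     (\<forall>j<16. \<forall>a<n. \<forall>b<n. \<forall>c<n. m (cell j a b c) = ar s j (a, b, c))"

section \<open>Machine executions and correctness of the compiler\<close>

definition steps :: "instr list \<Rightarrow> nat \<Rightarrow> nat \<Rightarrow> (nat \<Rightarrow> nat) \<Rightarrow> (nat \<Rightarrow> nat) \<Rightarrow>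
    nat \<Rightarrow> (nat \<Rightarrow> nat) \<Rightarrow> (nat \<Rightarrow> nat) \<Rightarrow> bool" where
  "steps P t p r m p' r' m' \<longleftrightarrow>
     (step w P ^^ t) \<lparr>pc = p, regs = r, mem = m\<rparr> = \<lparr>pc = p', regs = r', mem = m'\<rparr>"

lemma steps_trans:
  "steps P t p r m p' r' m' \<Longrightarrow> steps P t' p' r' m' p'' r'' m'' \<Longrightarrow> steps P (t + t') p r m p'' r'' m''"
  by (simp add: steps_def add.commute[of t] funpow_add)

lemma steps_1:
  "p < length P \<Longrightarrow> exec w (P ! p) \<lparr>pc = p, regs = r, mem = m\<rparr> = \<lparr>pc = p', regs = r', mem = m'\<rparr> \<Longrightarrow>
   steps P 1 p r m p' r' m'"
  by (simp add: steps_def step_def halted_def)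

definition preserved :: "nat \<Rightarrow> (nat \<Rightarrow> nat) \<Rightarrow> (nat \<Rightarrow> nat) \<Rightarrow> bool" where
  "preserved d r r' \<longleftrightarrow> (\<forall>i. odd i \<or> i < 2 * d \<longrightarrow> r' i = r i)"

lemma preserved_trans: "preserved d r r' \<Longrightarrow> preserved d r' r'' \<Longrightarrow> preserved d r r''"
  by (simp add: preserved_def)

lemma preserved_conc: "preserved d r r' \<Longrightarrow> conc s r m \<Longrightarrow> conc s r' m"
  by (simp add: preserved_def conc_def)

definition computes :: "nat \<Rightarrow> instr list \<Rightarrow> hstate \<Rightarrow> nat \<Rightarrow> bool" where
  "computes d cs s v \<longleftrightarrow> (\<forall>P off r m. code_at P off cs \<longrightarrow> conc s r m \<longrightarrow>
     (\<exists>r'. steps P (length cs) off r m (off + length cs) r' m \<and> preserved d r r' \<and> r' (2*d) = v))"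

lemma computesI:
  assumes "\<And>P off r m. code_at P off cs \<Longrightarrow> conc s r m \<Longrightarrow>
    \<exists>r'. steps P (length cs) off r m (off + length cs) r' m \<and> preserved d r r' \<and> r' (2*d) = v"
  shows "computes d cs s v"
  unfolding computes_def by (intro allI impI assms)

lemma computesD:
  assumes "computes d cs s v" "code_at P off cs" "conc s r m"
  obtains r' where "steps P (length cs) off r m (off + length cs) r' m" "preserved d r r'" "r' (2*d) = v"
  using assms(1)[unfolded computes_def, rule_format, OF assms(2,3)] that by blast

lemma computes_snoc:
  assumes "computes d cs s v"
    and "\<And>r m p. conc s r m \<Longrightarrow> r (2*d) = v \<Longrightarrow>
      \<exists>r'. exec w i \<lparr>pc = p, regs = r, mem = m\<rparr> = \<lparr>pc = Suc p, regs = r', mem = m\<rparr> \<and>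
        preserved d r r' \<and> r' (2*d) = v'"
  shows "computes d (cs @ [i]) s v'"
proof (rule computesI)
  fix P off r m
  assume at: "code_at P off (cs @ [i])" and c: "conc s r m"
  obtain r1 where r1: "steps P (length cs) off r m (off + length cs) r1 m" "preserved d r r1" "r1 (2*d) = v"
    using computesD[OF assms(1) _ c] at by auto
  obtain r2 where r2: "exec w i \<lparr>pc = off + length cs, regs = r1, mem = m\<rparr>
      = \<lparr>pc = Suc (off + length cs), regs = r2, mem = m\<rparr>" "preserved d r1 r2" "r2 (2*d) = v'"
    using assms(2)[OF preserved_conc[OF r1(2) c] r1(3)] by blast
  have "steps P (length cs + 1) off r m (Suc (off + length cs)) r2 m"
    using at by (intro steps_trans[OF r1(1)] steps_1) (auto simp: r2)
  then show "\<exists>r'. steps P (length (cs @ [i])) off r m (off + length (cs @ [i])) r' m \<and>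
      preserved d r r' \<and> r' (2*d) = v'"
    using preserved_trans[OF r1(2) r2(2)] r2(3) by auto
qed

text \<open>The second operand is evaluated at level \<open>d + 1\<close>, which by
  \<open>preserved\<close> leaves the first value in register \<open>2 * d\<close> intact.\<close>

lemma computes_binop:
  assumes "computes d cs s v" "computes (d+1) cs' s v'"
  shows "computes d (cs @ cs' @ [Binop f (2*d) (2*d) (2*d+2)]) s (binop_sem w f v v')"
proof (rule computesI)
  fix P off r m
  assume at: "code_at P off (cs @ cs' @ [Binop f (2*d) (2*d) (2*d+2)])" and c: "conc s r m"
  obtain r1 where r1: "steps P (length cs) off r m (off + length cs) r1 m" "preserved d r r1" "r1 (2*d) = v"
    using computesD[OF assms(1) _ c] at by auto
  have c1: "conc s r1 m" by (rule preserved_conc[OF r1(2) c])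
  obtain r2 where r2: "steps P (length cs') (off + length cs) r1 m (off + length cs + length cs') r2 m"
      "preserved (d+1) r1 r2" "r2 (2*(d+1)) = v'"
    using computesD[OF assms(2) _ c1, of P "off + length cs"] at by auto
  define r3 where "r3 = r2(2*d := binop_sem w f v v')"
  have v: "r2 (2*d) = v" using r1(3) r2(2) by (simp add: preserved_def)
  have "steps P (length cs + (length cs' + 1)) off r m (Suc (off + length cs + length cs')) r3 m"
    using at r2(3) v
    by (intro steps_trans[OF r1(1)] steps_trans[OF r2(1)] steps_1) (auto simp: r3_def add.assoc)
  moreover have "preserved d r r3"
    using r1(2) r2(2) by (auto simp: preserved_def r3_def)
  ultimately show "\<exists>r'. steps P (length (cs @ cs' @ [Binop f (2*d) (2*d) (2*d+2)])) off r m
      (off + length (cs @ cs' @ [Binop f (2*d) (2*d) (2*d+2)])) r' m \<and>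
      preserved d r r' \<and> r' (2*d) = binop_sem w f v v'"
    by (auto simp: r3_def add.assoc)
qed

lemma computes_const: "computes d [Const (2*d) c] s (c mod W)"
  by (rule computesI, rule_tac x = "r(2*d := c mod W)" in exI)
    (auto intro!: steps_1[unfolded One_nat_def] simp: preserved_def)

lemma computes_binop_reg:
  assumes "computes d cs s v" "odd i" "\<forall>r m. conc s r m \<longrightarrow> r i = v'"
  shows "computes d (cs @ [Binop f (2*d) (2*d) i]) s (binop_sem w f v v')"
proof (rule computes_snoc[OF assms(1)])
  fix r m p
  assume "conc s r m" "r (2*d) = v"
  then show "\<exists>r'. exec w (Binop f (2*d) (2*d) i) \<lparr>pc = p, regs = r, mem = m\<rparr> =
      \<lparr>pc = Suc p, regs = r', mem = m\<rparr> \<and> preserved d r r' \<and> r' (2*d) = binop_sem w f v v'"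
    using assms(2,3) by (intro exI[of _ "r(2*d := binop_sem w f v v')"]) (auto simp: preserved_def)
qed

text \<open>Each intermediate value may be reduced modulo \<open>W\<close>. Congruence collects the
  reductions into a single one, and that one vanishes because the final address is below
  \<open>W\<close>.\<close>

lemma computes_caddr:
  assumes "computes d ca s a" "computes (d+1) cb s b" "computes (d+1) cc s c"
    and lt: "j < 16" "a < n" "b < n" "c < n"
  shows "computes d (caddr d j ca cb cc) s (cell j a b c)"
proof -
  have regs: "\<forall>r m. conc s r m \<longrightarrow> r 3 = n" "\<forall>r m. conc s r m \<longrightarrow> r 1 = length xs"
    by (simp_all add: conc_def)
  have odd3: "odd (3::nat)" by simp
  have "computes d (ca @ [Binop Mul (2*d) (2*d) 3]) s (a * n mod W)" (is "computes d ?c1 s ?v1")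
    using computes_binop_reg[OF assms(1), of 3 n Mul] regs by simp
  from computes_binop[OF this assms(2), of Add]
  have "computes d (?c1 @ cb @ [Binop Add (2*d) (2*d) (2*d+2)]) s ((?v1 + b) mod W)"
    (is "computes d ?c2 s ?v2") by simp
  from computes_binop_reg[OF this odd3 regs(1), of Mul]
  have "computes d (?c2 @ [Binop Mul (2*d) (2*d) 3]) s (?v2 * n mod W)"
    (is "computes d ?c3 s ?v3") by (simp only: binop_sem.simps)
  from computes_binop[OF this assms(3), of Add]
  have "computes d (?c3 @ cc @ [Binop Add (2*d) (2*d) (2*d+2)]) s ((?v3 + c) mod W)"
    (is "computes d ?c4 s ?v4") by (simp only: binop_sem.simps)
  from computes_binop[OF this computes_const[of "d+1" 16], of Mul]
  have "computes d (?c4 @ [Const (2*d+2) 16] @ [Binop Mul (2*d) (2*d) (2*d+2)]) s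
      (?v4 * (16 mod W) mod W)"
    (is "computes d ?c5 s ?v5") by (simp only: binop_sem.simps distrib_left mult_1_right)
  from computes_binop[OF this computes_const[of "d+1" j], of Add]
  have "computes d (?c5 @ [Const (2*d+2) j] @ [Binop Add (2*d) (2*d) (2*d+2)]) s
      ((?v5 + j mod W) mod W)"
    (is "computes d ?c6 s ?v6") by (simp only: binop_sem.simps distrib_left mult_1_right)
  from computes_binop_reg[OF this odd_one regs(2), of Add]
  have compile: "computes d (?c6 @ [Binop Add (2*d) (2*d) 1]) s ((?v6 + length xs) mod W)"
    by (simp only: binop_sem.simps)
  have "(?v6 + length xs) mod W = (((a * n + b) * n + c) * 16 + j + length xs) mod W"
    by (simp only: mod_simps)
  also have "\<dots> = cell j a b c mod W"
    by (simp only: cell_def add.commute mult.commute)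
  also have "\<dots> = cell j a b c"
    using cell_less[OF lt] by simp
  finally show ?thesis
    using compile by (simp only: caddr_def append_assoc append_Cons append_Nil)
qed

lemma computes_ce: "eok e s \<Longrightarrow> computes d (ce d e) s (eval e s)"
proof (induction e arbitrary: d)
  case (Var x)
  show ?case
    by (rule computesI, rule_tac x = "r(2*d := vr s x)" in exI)
      (auto intro!: steps_1[unfolded One_nat_def] simp: preserved_def conc_def)
next
  case (Lit c)
  then show ?case by (simp add: computes_const)
next
  case (Bin f a b)
  then show ?case using computes_binop[of d "ce d a" s "eval a s"] by simp
next
  case (Inp a)
  then have "computes d (ce d a) s (eval a s)" by simp
  from computes_snoc[OF this, of "Load (2*d) (2*d)" "xs ! eval a s"] Inp.prems show ?case
    by (simp add: preserved_def conc_def)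
next
  case (Arr j a b c)
  then have "computes d (caddr d j (ce d a) (ce (d+1) b) (ce (d+1) c)) s
      (cell j (eval a s) (eval b s) (eval c s))"
    by (intro computes_caddr) auto
  from computes_snoc[OF this, of "Load (2*d) (2*d)" "eval (Arr j a b c) s"] Arr.prems show ?case
    by (simp add: preserved_def conc_def)
qed

lemma ceD:
  assumes "eok e s" "code_at P off (ce d e)" "conc s r m"
  obtains r' where "steps P (te e) off r m (off + te e) r' m" "conc s r' m" "preserved d r r'"
    "r' (2*d) = eval e s"
proof -
  from computesD[OF computes_ce[OF assms(1)] assms(2,3)] obtain r' where
    "steps P (length (ce d e)) off r m (off + length (ce d e)) r' m" "preserved d r r'"
    "r' (2*d) = eval e s" .
  then show thesis using that preserved_conc[OF _ assms(3)] by simp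
qed

definition simulates :: "nat \<Rightarrow> com \<Rightarrow> hstate \<Rightarrow> nat \<Rightarrow> hstate \<Rightarrow> bool" where
  "simulates off c s t s' \<longleftrightarrow> (\<forall>P r m. code_at P off (compile off c) \<longrightarrow> conc s r m \<longrightarrow>
     (\<exists>r' m'. steps P t off r m (off + csize c) r' m' \<and> conc s' r' m'))"

lemma simulatesI:
  assumes "\<And>P r m. code_at P off (compile off c) \<Longrightarrow> conc s r m \<Longrightarrow>
     \<exists>r' m'. steps P t off r m (off + csize c) r' m' \<and> conc s' r' m'"
  shows "simulates off c s t s'"
  unfolding simulates_def by (intro allI impI assms)

lemma simulatesD:
  assumes "simulates off c s t s'" "code_at P off (compile off c)" "conc s r m"
  obtains r' m' where "steps P t off r m (off + csize c) r' m'" "conc s' r' m'"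
  using assms(1)[unfolded simulates_def, rule_format, OF assms(2,3)] that by blast

text \<open>Induction on the number of iterations with the start state generalised: after one pass
  the jump returns to \<open>off\<close>, and what remains is the same loop started in
  \<open>sem c s\<close>. The number of passes is a parameter, so that \<open>LEAST\<close> enters
  only in \<open>compile_correct\<close>.\<close>

lemma simulates_While:
  assumes IH: "\<And>off s. ok c s \<Longrightarrow> simulates off c s (tm c s) (sem c s)"
    and "eval e ((sem c ^^ m) s) = 0" "\<forall>i<m. eval e ((sem c ^^ i) s) \<noteq> 0"
    and "\<forall>i\<le>m. eok e ((sem c ^^ i) s)" "\<forall>i<m. ok c ((sem c ^^ i) s)"
  shows "simulates off (While e c) s ((\<Sum>i<m. te e + 2 + tm c ((sem c ^^ i) s)) + te e + 1)
    ((sem c ^^ m) s)"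
  using assms(2-)
proof (induction m arbitrary: s)
  case 0
  show ?case
  proof (rule simulatesI)
    fix P r m
    assume at: "code_at P off (compile off (While e c))" and c: "conc s r m"
    have "eok e s" "eval e s = 0" using 0 by auto
    have "code_at P off (ce 0 e)" using at by simp
    then obtain r1 where r1: "steps P (te e) off r m (off + te e) r1 m" "conc s r1 m" "preserved 0 r r1"
        "r1 (2*0) = eval e s"
      by (rule ceD[OF \<open>eok e s\<close> _ c])
    have "steps P (te e + 1) off r m (off + csize (While e c)) r1 m"
      using at r1(4) \<open>eval e s = 0\<close> by (intro steps_trans[OF r1(1)] steps_1) auto
    then show "\<exists>r' m'. steps P ((\<Sum>i<0. te e + 2 + tm c ((sem c ^^ i) s)) + te e + 1) off r m
        (off + csize (While e c)) r' m' \<and> conc ((sem c ^^ 0) s) r' m'"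
      using r1 by auto
  qed
next
  case (Suc k)
  have sh: "(sem c ^^ i) (sem c s) = (sem c ^^ Suc i) s" for i
    by (simp add: funpow_swap1)
  have IHk: "simulates off (While e c) (sem c s)
      ((\<Sum>i<k. te e + 2 + tm c ((sem c ^^ i) (sem c s))) + te e + 1) ((sem c ^^ k) (sem c s))"
    using Suc.prems by (intro Suc.IH) (auto simp: sh simp del: funpow.simps)
  have "eok e s" "eval e s \<noteq> 0" "ok c s"
    using Suc.prems by fastforce+
  show ?case
  proof (rule simulatesI)
    fix P r m
    assume at: "code_at P off (compile off (While e c))" and c: "conc s r m"
    have "code_at P off (ce 0 e)" using at by simp
    then obtain r1 where r1: "steps P (te e) off r m (off + te e) r1 m" "conc s r1 m" "preserved 0 r r1"
        "r1 (2*0) = eval e s"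
      by (rule ceD[OF \<open>eok e s\<close> _ c])
    have "code_at P (off + te e + 1) (compile (off + te e + 1) c)" using at by simp
    then obtain r2 m2 where r2: "steps P (tm c s) (off + te e + 1) r1 m (off + te e + 1 + csize c) r2 m2"
        "conc (sem c s) r2 m2"
      by (rule simulatesD[OF IH[OF \<open>ok c s\<close>] _ r1(2)])
    obtain r3 m3 where r3: "steps P ((\<Sum>i<k. te e + 2 + tm c ((sem c ^^ i) (sem c s))) + te e + 1)
        off r2 m2 (off + csize (While e c)) r3 m3" "conc ((sem c ^^ k) (sem c s)) r3 m3"
      using simulatesD[OF IHk at r2(2)] by blast
    have "steps P (te e + (1 + (tm c s + (1 + ((\<Sum>i<k. te e + 2 + tm c ((sem c ^^ i) (sem c s))) + te e + 1)))))
        off r m (off + csize (While e c)) r3 m3"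
    proof (intro steps_trans[OF r1(1)])
      have "steps P 1 (off + te e) r1 m (off + te e + 1) r1 m"
        using at r1(4) \<open>eval e s \<noteq> 0\<close> by (intro steps_1) auto
      moreover have "steps P 1 (off + te e + 1 + csize c) r2 m2 off r2 m2"
        using at by (intro steps_1) auto
      ultimately show "steps P (1 + (tm c s + (1 + ((\<Sum>i<k. te e + 2 + tm c ((sem c ^^ i) (sem c s))) + te e + 1))))
          (off + te e) r1 m (off + csize (While e c)) r3 m3"
        using r2(1) r3(1) by (meson steps_trans)
    qed
    moreover have "te e + (1 + (tm c s + (1 + ((\<Sum>i<k. te e + 2 + tm c ((sem c ^^ i) (sem c s))) + te e + 1))))
       = (\<Sum>i<Suc k. te e + 2 + tm c ((sem c ^^ i) s)) + te e + 1"
      by (simp add: sum.lessThan_Suc_shift sh del: funpow.simps sum.lessThan_Suc)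
    ultimately show "\<exists>r' m'. steps P ((\<Sum>i<Suc k. te e + 2 + tm c ((sem c ^^ i) s)) + te e + 1) off r m
        (off + csize (While e c)) r' m' \<and> conc ((sem c ^^ Suc k) s) r' m'"
      using r3(2) by (metis sh)
  qed
qed

theorem compile_correct: "ok c s \<Longrightarrow> simulates off c s (tm c s) (sem c s)"
proof (induction c arbitrary: off s)
  case (Assign x e)
  show ?case
  proof (rule simulatesI)
    fix P r m
    assume at: "code_at P off (compile off (Assign x e))" and c: "conc s r m"
    have "eok e s" using Assign by simp
    have "code_at P off (ce 0 e)" using at by simp
    then obtain r1 where r1: "steps P (te e) off r m (off + te e) r1 m" "conc s r1 m" "preserved 0 r r1"
        "r1 (2*0) = eval e s"
      by (rule ceD[OF \<open>eok e s\<close> _ c])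
    have "steps P (te e + 1) off r m (off + te e + 1) (r1(2*x+5 := eval e s)) m"
      using at r1(4) by (intro steps_trans[OF r1(1)] steps_1) auto
    then show "\<exists>r' m'. steps P (tm (Assign x e) s) off r m (off + csize (Assign x e)) r' m' \<and>
        conc (sem (Assign x e) s) r' m'"
      using r1(2) by (auto simp: conc_def intro!: exI)
  qed
next
  case (AStore j a b c e)
  show ?case
  proof (rule simulatesI)
    fix P r m
    assume at: "code_at P off (compile off (AStore j a b c e))" and cc: "conc s r m"
    let ?ca = "caddr 0 j (ce 0 a) (ce 1 b) (ce 1 c)"
    let ?v = "cell j (eval a s) (eval b s) (eval c s)"
    have lca: "length ?ca = te a + te b + te c + 9" by (simp add: caddr_def)
    have b: "j < 16" "eval a s < n" "eval b s < n" "eval c s < n" using AStore by auto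
    have "computes 0 ?ca s ?v"
      using AStore computes_ce[of a s 0] computes_ce[of b s 1] computes_ce[of c s 1]
      by (intro computes_caddr) auto
    moreover have "code_at P off ?ca" using at by simp
    ultimately obtain r1 where r1: "steps P (length ?ca) off r m (off + length ?ca) r1 m"
        "preserved 0 r r1" "r1 (2*0) = ?v"
      using cc by (rule computesD)
    have c1: "conc s r1 m" by (rule preserved_conc[OF r1(2) cc])
    have "eok e s" using AStore by simp
    moreover have "code_at P (off + length ?ca) (ce 1 e)" using at by simp
    ultimately obtain r2 where r2: "steps P (te e) (off + length ?ca) r1 m (off + length ?ca + te e) r2 m"
        "conc s r2 m" "preserved 1 r1 r2" "r2 (2*1) = eval e s"
      using c1 by (rule ceD)
    have r20: "r2 0 = ?v" using r1(3) r2(3) by (simp add: preserved_def)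
    have st: "steps P (length ?ca + (te e + 1)) off r m (Suc (off + length ?ca + te e)) r2 (m(?v := eval e s))"
      using at r2(4) r20
      by (intro steps_trans[OF r1(1)] steps_trans[OF r2(1)] steps_1) (auto simp: add.assoc)
    \<comment> \<open>Array cells start at \<open>length xs\<close>, so a store cannot hit the
      input.\<close>
    have low: "i < length xs \<Longrightarrow> i \<noteq> ?v" for i by (simp add: cell_def)
    have "conc (sem (AStore j a b c e) s) r2 (m(?v := eval e s))"
      using r2(2) low by (auto simp: conc_def cell_inj b)
    then show "\<exists>r' m'. steps P (tm (AStore j a b c e) s) off r m (off + csize (AStore j a b c e)) r' m' \<and>
        conc (sem (AStore j a b c e) s) r' m'"
      using st lca by (auto simp: algebra_simps intro!: exI)
  qed
next
  case (Seq c1 c2)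
  show ?case
  proof (rule simulatesI)
    fix P r m
    assume at: "code_at P off (compile off (c1 ;; c2))" and cc: "conc s r m"
    have ok: "ok c1 s" "ok c2 (sem c1 s)" using Seq.prems by auto
    have at': "code_at P off (compile off c1)" "code_at P (off + csize c1) (compile (off + csize c1) c2)"
      using at by auto
    obtain r1 m1 where r1: "steps P (tm c1 s) off r m (off + csize c1) r1 m1" "conc (sem c1 s) r1 m1"
      by (rule simulatesD[OF Seq.IH(1)[OF ok(1)] at'(1) cc])
    obtain r2 m2 where r2: "steps P (tm c2 (sem c1 s)) (off + csize c1) r1 m1 (off + csize c1 + csize c2) r2 m2"
        "conc (sem c2 (sem c1 s)) r2 m2"
      by (rule simulatesD[OF Seq.IH(2)[OF ok(2)] at'(2) r1(2)])
    show "\<exists>r' m'. steps P (tm (c1 ;; c2) s) off r m (off + csize (c1 ;; c2)) r' m' \<and>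
        conc (sem (c1 ;; c2) s) r' m'"
      using steps_trans[OF r1(1) r2(1)] r2(2) by (auto simp: add.assoc)
  qed
next
  case (Ite e c1 c2)
  show ?case
  proof (rule simulatesI)
    fix P r m
    assume at: "code_at P off (compile off (Ite e c1 c2))" and cc: "conc s r m"
    have "eok e s" using Ite.prems by simp
    have "code_at P off (ce 0 e)" using at by simp
    then obtain r1 where r1: "steps P (te e) off r m (off + te e) r1 m" "conc s r1 m" "preserved 0 r r1"
        "r1 (2*0) = eval e s"
      by (rule ceD[OF \<open>eok e s\<close> _ cc])
    show "\<exists>r' m'. steps P (tm (Ite e c1 c2) s) off r m (off + csize (Ite e c1 c2)) r' m' \<and>
        conc (sem (Ite e c1 c2) s) r' m'"
    proof (cases "eval e s = 0")
      case True
      have "simulates (off + te e + csize c1 + 2) c2 s (tm c2 s) (sem c2 s)"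
        using Ite True by simp
      moreover have "code_at P (off + te e + csize c1 + 2) (compile (off + te e + csize c1 + 2) c2)"
        using at by (simp add: algebra_simps)
      ultimately obtain r2 m2 where r2: "steps P (tm c2 s) (off + te e + csize c1 + 2) r1 m
          (off + te e + csize c1 + 2 + csize c2) r2 m2" "conc (sem c2 s) r2 m2"
        using r1(2) by (rule simulatesD)
      have "steps P (te e + (1 + tm c2 s)) off r m (off + te e + csize c1 + 2 + csize c2) r2 m2"
        using at r1(4) True
        by (intro steps_trans[OF r1(1)] steps_trans[OF steps_1 r2(1)]) auto
      then show ?thesis using True r2(2) by (auto simp: algebra_simps)
    next
      case False
      have "simulates (off + te e + 1) c1 s (tm c1 s) (sem c1 s)"
        using Ite False by simp
      moreover have "code_at P (off + te e + 1) (compile (off + te e + 1) c1)"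
        using at by simp
      ultimately obtain r2 m2 where r2: "steps P (tm c1 s) (off + te e + 1) r1 m
          (off + te e + 1 + csize c1) r2 m2" "conc (sem c1 s) r2 m2"
        using r1(2) by (rule simulatesD)
      have "steps P (te e + (1 + (tm c1 s + 1))) off r m (off + te e + csize c1 + csize c2 + 2) r2 m2"
      proof (intro steps_trans[OF r1(1)])
        have "steps P 1 (off + te e) r1 m (off + te e + 1) r1 m"
          using at r1(4) False by (intro steps_1) auto
        moreover have "steps P 1 (off + te e + 1 + csize c1) r2 m2 (off + te e + csize c1 + csize c2 + 2) r2 m2"
          using at by (intro steps_1) auto
        ultimately show "steps P (1 + (tm c1 s + 1)) (off + te e) r1 m
            (off + te e + csize c1 + csize c2 + 2) r2 m2"
          using r2(1) by (meson steps_trans)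
      qed
      then show ?thesis using False r2(2) by (auto simp: algebra_simps)
    qed
  qed
next
  case (While e c)
  define k where "k = (LEAST m. eval e ((sem c ^^ m) s) = 0)"
  have "\<forall>i<k. eval e ((sem c ^^ i) s) \<noteq> 0"
    unfolding k_def using not_less_Least by blast
  with While.prems have "simulates off (While e c) s
      ((\<Sum>i<k. te e + 2 + tm c ((sem c ^^ i) s)) + te e + 1) ((sem c ^^ k) s)"
    by (intro simulates_While While.IH) (auto simp: Let_def k_def)
  then show ?case by (simp add: k_def Let_def)
qed

end

section \<open>Frame conditions and timed Hoare rules\<close>

definition For :: "nat \<Rightarrow> nat \<Rightarrow> com \<Rightarrow> com" where
  "For x y c = (Assign x (Lit 0) ;; While (Bin Lt (Var x) (Var y)) (c ;; Assign x (Bin Add (Var x) (Lit 1))))"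

lemma var_writes_For [simp]: "var_writes (For x y c) = insert x (var_writes c)"
  by (auto simp: For_def)

lemma arr_writes_For [simp]: "arr_writes (For x y c) = arr_writes c"
  by (simp add: For_def)

definition agree :: "nat set \<Rightarrow> nat set \<Rightarrow> hstate \<Rightarrow> hstate \<Rightarrow> bool" where
  "agree X J s s' \<longleftrightarrow> (\<forall>z. z \<notin> X \<longrightarrow> vr s' z = vr s z) \<and> (\<forall>j. j \<notin> J \<longrightarrow> ar s' j = ar s j)"

lemma agree_vr: "agree X J s s' \<Longrightarrow> z \<notin> X \<Longrightarrow> vr s' z = vr s z"
  and agree_ar: "agree X J s s' \<Longrightarrow> j \<notin> J \<Longrightarrow> ar s' j = ar s j"
  by (simp_all add: agree_def)

lemma agree_trans: "agree X J s s' \<Longrightarrow> agree X J s' s'' \<Longrightarrow> agree X J s s''"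
  by (simp add: agree_def)

lemma agree_mono: "agree X J s s' \<Longrightarrow> X \<subseteq> X' \<Longrightarrow> J \<subseteq> J' \<Longrightarrow> agree X' J' s s'"
  unfolding agree_def subset_iff by metis

lemma agree_upd: "x \<in> X \<Longrightarrow> agree X J s (s\<lparr>vr := (vr s)(x := v)\<rparr>)"
  by (simp add: agree_def)

context word_ram
begin

lemma agree_sem: "agree (var_writes c) (arr_writes c) s (sem c s)"
  by (simp add: agree_def sem_var_frame sem_arr_frame)

text \<open>A fixed start state instead of a precondition lets postconditions refer to initial
  values directly.\<close>

definition triple :: "com \<Rightarrow> hstate \<Rightarrow> nat \<Rightarrow> (hstate \<Rightarrow> bool) \<Rightarrow> bool" where
  "triple c s T Q \<longleftrightarrow> ok c s \<and> tm c s \<le> T \<and> Q (sem c s)"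

text \<open>Weakening may use the frame, so postconditions need not repeat what a command leaves
  unchanged.\<close>

lemma triple_mono:
  assumes "triple c s T Q" "T \<le> T'"
    and "\<And>t. agree (var_writes c) (arr_writes c) s t \<Longrightarrow> Q t \<Longrightarrow> Q' t"
  shows "triple c s T' Q'"
  using assms(1,2) assms(3)[OF agree_sem] by (simp add: triple_def)

lemma triple_Seq:
  assumes "triple c1 s T R"
    and "\<And>t. agree (var_writes c1) (arr_writes c1) s t \<Longrightarrow> R t \<Longrightarrow> triple c2 t T' Q"
  shows "triple (c1 ;; c2) s (T + T') Q"
  using assms(1) assms(2)[OF agree_sem] by (auto simp: triple_def)

text \<open>The guard is nonzero along \<open>I 0, ..., I (K - 1)\<close> and zero at
  \<open>I K\<close>, so \<open>K\<close> is the least exit index chosen by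
  \<open>sem\<close>.\<close>

lemma triple_While:
  assumes body: "\<And>i t. i < K \<Longrightarrow> I i t \<Longrightarrow> eok e t \<and> eval e t \<noteq> 0 \<and> triple c t T (I (Suc i))"
    and exit: "\<And>t. I K t \<Longrightarrow> eok e t \<and> eval e t = 0"
    and init: "I 0 s"
  shows "triple (While e c) s (K * (te e + 2 + T) + te e + 1) (I K)"
proof -
  let ?it = "\<lambda>i. (sem c ^^ i) s"
  have inv: "i \<le> K \<Longrightarrow> I i (?it i)" for i
  proof (induction i)
    case (Suc i)
    then show ?case using body[of i "?it i"] by (simp add: triple_def)
  qed (simp add: init)
  have least: "(LEAST m. eval e (?it m) = 0) = K"
  proof (rule Least_equality)
    show "eval e (?it K) = 0" using exit inv by blast
    show "K \<le> m" if "eval e (?it m) = 0" for m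
      using body[of m "?it m"] inv[of m] that by (cases "m < K") auto
  qed
  have "(\<Sum>i<K. te e + 2 + tm c (?it i)) \<le> (\<Sum>i<K. te e + 2 + T)"
    using body inv by (intro sum_mono) (auto simp: triple_def)
  then have "(\<Sum>i<K. te e + 2 + tm c (?it i)) \<le> K * (te e + 2 + T)" by simp
  moreover have "eok e (?it i)" if "i \<le> K" for i
    using body[of i "?it i"] inv[OF that] exit[of "?it i"] that by (cases "i = K") auto
  moreover have "ok c (?it i)" if "i < K" for i
    using body[of i "?it i"] inv[of i] that by (auto simp: triple_def)
  ultimately show ?thesis
    using inv[of K] exit[OF inv[of K]] by (simp add: triple_def least Let_def)
qed

text \<open>Loop counters run up to \<open>n\<close>; with these bounds neither they nor the
  literals 1, 2 and 3 of the program are changed by reduction modulo \<open>W\<close>.\<close>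

lemma W_gt: "16 \<le> W" "n < W"
proof -
  have "n \<le> n ^ 3" "1 \<le> n ^ 3" using n_pos by (simp_all add: power3_eq_cube)
  then show "16 \<le> W" "n < W" using fits n_pos by linarith+
qed

lemma w_pos [simp]: "0 < w"
  using W_gt(1) by (cases "w = 0") auto

text \<open>The invariant \<open>I\<close> is indexed by the set of loop indices already treated.\<close>

lemma triple_For:
  assumes x: "x \<notin> var_writes c" "y \<notin> var_writes c" "x \<noteq> y" "vr s y = K"
    and K: "K \<le> L" "1 \<le> L" "K < W"
    and stable: "\<And>S t r. (\<forall>z. z \<noteq> x \<longrightarrow> r z = vr t z) \<Longrightarrow> I S t \<Longrightarrow> I S (t\<lparr>vr := r\<rparr>)"
    and init: "I {} s"
    and body: "\<And>S a t. S = {..<a} \<Longrightarrow> finite S \<Longrightarrow> a < K \<Longrightarrow> a \<notin> S \<Longrightarrow> vr t x = a \<Longrightarrow>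
      agree (insert x (var_writes c)) (arr_writes c) s t \<Longrightarrow> I S t \<Longrightarrow> triple c t T (I (insert a S))"
  shows "triple (For x y c) s (L * (T + 40)) (I {..<K})"
proof -
  let ?X = "insert x (var_writes c)" and ?J = "arr_writes c"
  define J where "J i t \<longleftrightarrow> vr t x = i \<and> agree ?X ?J s t \<and> I {..<i} t" for i t
  let ?e = "Bin Lt (Var x) (Var y)" and ?c = "c ;; Assign x (Bin Add (Var x) (Lit 1))"
  have "triple (While ?e ?c) (s\<lparr>vr := (vr s)(x := 0)\<rparr>) (K * (te ?e + 2 + (T + 4)) + te ?e + 1) (J K)"
  proof (rule triple_While)
    fix i t
    assume i: "i < K" and J: "J i t"
    have y: "vr t y = K" using J x agree_vr[of ?X ?J s t y] by (simp add: J_def)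
    have tc: "triple c t T (I {..<Suc i})"
      using body[of "{..<i}" i t] i J by (simp add: J_def lessThan_Suc)
    have sx: "vr (sem c t) x = i" using J x sem_var_frame by (simp add: J_def)
    have ag: "agree ?X ?J s (sem c t)"
      using J agree_trans[OF _ agree_mono[OF agree_sem]] by (fastforce simp: J_def)
    have Suc: "Suc i mod W = Suc i" using i K(3) by simp
    have "J (Suc i) (sem c t\<lparr>vr := (vr (sem c t))(x := Suc i)\<rparr>)"
      using tc ag stable[of "(vr (sem c t))(x := Suc i)" "sem c t"]
      by (auto simp: J_def triple_def agree_def)
    then show "eok ?e t \<and> eval ?e t \<noteq> 0 \<and> triple ?c t (T + 4) (J (Suc i))"
      using tc i J y by (simp add: triple_def J_def sx Suc)
  next
    fix t
    assume J: "J K t"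
    have "vr t y = K" using J x agree_vr[of ?X ?J s t y] by (simp add: J_def)
    then show "eok ?e t \<and> eval ?e t = 0"
      using J by (simp add: J_def)
  next
    show "J 0 (s\<lparr>vr := (vr s)(x := 0)\<rparr>)"
      using stable[of "(vr s)(x := 0)" s] init by (auto simp: J_def intro!: agree_upd)
  qed
  then have 1: "triple (For x y c) s (2 + (K * (te ?e + 2 + (T + 4)) + te ?e + 1)) (J K)"
    unfolding For_def by (intro triple_Seq[where R = "\<lambda>t. t = s\<lparr>vr := (vr s)(x := 0)\<rparr>"])
      (auto simp: triple_def)
  \<comment> \<open>The true overhead is nine steps per iteration and six outside the loop. As
    \<open>L\<close> is at least 1, the six can be charged to the iterations even when
    \<open>K = 0\<close>; the 40 contains slack.\<close>
  have "2 + (K * (te ?e + 2 + (T + 4)) + te ?e + 1) = K * (T + 9) + 6" by simp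
  also have "\<dots> \<le> L * (T + 9) + L * 6" using K by (intro add_mono mult_le_mono1) auto
  also have "\<dots> = L * (T + 15)" by (simp add: algebra_simps)
  also have "\<dots> \<le> L * (T + 40)" by simp
  finally have "2 + (K * (te ?e + 2 + (T + 4)) + te ?e + 1) \<le> L * (T + 40)" .
  from triple_mono[OF 1 this, of "I {..<K}"] show ?thesis by (simp add: J_def)
qed

text \<open>Indexing by sets lets one invariant serve both levels: the outer loop has completed full
  rows, the inner one full rows and a part of the current row.\<close>

lemma triple_For2:
  assumes x: "x \<notin> var_writes c" "y \<notin> var_writes c" "z \<notin> var_writes c" "x \<noteq> y" "x \<noteq> z" "y \<noteq> z"
    and K: "vr s z = n"
    and stable: "\<And>S t r. (\<forall>v. v \<noteq> x \<and> v \<noteq> y \<longrightarrow> r v = vr t v) \<Longrightarrow> I S t \<Longrightarrow> I S (t\<lparr>vr := r\<rparr>)"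
    and init: "I {} s"
    and body: "\<And>S a b t. finite S \<Longrightarrow> a < n \<Longrightarrow> b < n \<Longrightarrow> (a, b) \<notin> S \<Longrightarrow> vr t x = a \<Longrightarrow> vr t y = b \<Longrightarrow>
      agree (insert x (insert y (var_writes c))) (arr_writes c) s t \<Longrightarrow> I S t \<Longrightarrow>
      triple c t T (I (insert (a, b) S))"
  shows "triple (For x z (For y z c)) s (n ^ 2 * (T + 80)) (I ({..<n} \<times> {..<n}))"
proof -
  let ?X = "insert x (insert y (var_writes c))" and ?J = "arr_writes c"
  have 1: "triple (For x z (For y z c)) s (n * (n * (T + 40) + 40)) (\<lambda>t. I ({..<n} \<times> {..<n}) t)"
  proof (rule triple_For[where I = "\<lambda>S. I (S \<times> {..<n})" and K = n])
    fix S a t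
    assume "S = {..<a}" and S: "finite S" "a < n" "a \<notin> S" "vr t x = a"
      "agree (insert x (var_writes (For y z c))) (arr_writes (For y z c)) s t" "I (S \<times> {..<n}) t"
    have z: "vr t z = n" using agree_vr[OF S(5), of z] x K by simp
    have "triple (For y z c) t (n * (T + 40)) (\<lambda>u. I (S \<times> {..<n} \<union> {a} \<times> {..<n}) u)"
    proof (rule triple_For[where I = "\<lambda>D. I (S \<times> {..<n} \<union> {a} \<times> D)" and K = n])
      fix D b u
      assume "D = {..<b}" and D: "finite D" "b < n" "b \<notin> D" "vr u y = b" "agree (insert y (var_writes c)) (arr_writes c) t u"
        "I (S \<times> {..<n} \<union> {a} \<times> D) u"
      have "vr u x = a" using agree_vr[OF D(5), of x] x S(4) by simp
      moreover have "agree ?X ?J s u"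
        using S(5) by (intro agree_trans[OF _ agree_mono[OF D(5)]]) auto
      ultimately have "triple c u T (I (insert (a, b) (S \<times> {..<n} \<union> {a} \<times> D)))"
        using S D by (intro body) auto
      also have "insert (a, b) (S \<times> {..<n} \<union> {a} \<times> D) = S \<times> {..<n} \<union> {a} \<times> insert b D" by auto
      finally show "triple c u T (I (S \<times> {..<n} \<union> {a} \<times> insert b D))" .
    qed (use x z S W_gt n_pos stable in auto)
    moreover have "S \<times> {..<n} \<union> {a} \<times> {..<n} = insert a S \<times> {..<n}" by auto
    ultimately show "triple (For y z c) t (n * (T + 40)) (I (insert a S \<times> {..<n}))" by simp
  qed (use x K W_gt n_pos stable init in auto)
  have "n * (n * (T + 40) + 40) \<le> n ^ 2 * (T + 80)"
    using n_pos by (simp add: algebra_simps power2_eq_square)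
  from triple_mono[OF 1 this] show ?thesis by blast
qed

text \<open>The innermost bound is a separate variable, so that the same code handles the n columns
  of a matrix and the single column of a vector.\<close>

lemma triple_For3:
  assumes x: "x1 \<notin> var_writes c" "x2 \<notin> var_writes c" "x3 \<notin> var_writes c" "z \<notin> var_writes c" "z' \<notin> var_writes c"
      "distinct [x1, x2, x3, z]" "distinct [x1, x2, x3, z']"
    and K: "vr s z = n" "vr s z' = K" "K \<le> n"
    and stable: "\<And>S t r. (\<forall>v. v \<noteq> x1 \<and> v \<noteq> x2 \<and> v \<noteq> x3 \<longrightarrow> r v = vr t v) \<Longrightarrow> I S t \<Longrightarrow> I S (t\<lparr>vr := r\<rparr>)"
    and init: "I {} s"
    and body: "\<And>S a b d t. finite S \<Longrightarrow> a < n \<Longrightarrow> b < n \<Longrightarrow> d < K \<Longrightarrow> (a, b, d) \<notin> S \<Longrightarrow>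
      vr t x1 = a \<Longrightarrow> vr t x2 = b \<Longrightarrow> vr t x3 = d \<Longrightarrow>
      agree (insert x1 (insert x2 (insert x3 (var_writes c)))) (arr_writes c) s t \<Longrightarrow> I S t \<Longrightarrow>
      triple c t T (I (insert (a, b, d) S))"
  shows "triple (For x1 z (For x2 z (For x3 z' c))) s (n ^ 3 * (T + 120)) (I ({..<n} \<times> {..<n} \<times> {..<K}))"
proof -
  let ?X = "insert x1 (insert x2 (insert x3 (var_writes c)))" and ?J = "arr_writes c"
  define G where "G S = {(a, b, d). (a, b) \<in> S \<and> d < K}" for S :: "(nat \<times> nat) set"
  have fin: "finite (G S)" if "finite S" for S
  proof -
    have "G S \<subseteq> (\<lambda>((a, b), d). (a, b, d)) ` (S \<times> {..<K})" by (force simp: G_def)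
    then show ?thesis by (rule finite_subset) (use that in auto)
  qed
  have G_empty: "G {} = {}" by (simp add: G_def)
  have 1: "triple (For x1 z (For x2 z (For x3 z' c))) s (n ^ 2 * (n * (T + 40) + 80)) (\<lambda>t. I (G ({..<n} \<times> {..<n})) t)"
  proof (rule triple_For2[where I = "\<lambda>S. I (G S)"])
    fix S a b t
    assume S: "finite S" "a < n" "b < n" "(a, b) \<notin> S" "vr t x1 = a" "vr t x2 = b"
      "agree (insert x1 (insert x2 (var_writes (For x3 z' c)))) (arr_writes (For x3 z' c)) s t" "I (G S) t"
    have z: "vr t z' = K" using agree_vr[OF S(7), of z'] x K by simp
    have "triple (For x3 z' c) t (n * (T + 40)) (\<lambda>u. I (G S \<union> {a} \<times> {b} \<times> {..<K}) u)"
    proof (rule triple_For[where I = "\<lambda>D. I (G S \<union> {a} \<times> {b} \<times> D)" and K = K])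
      fix D d u
      assume "D = {..<d}" and D: "finite D" "d < K" "d \<notin> D" "vr u x3 = d" "agree (insert x3 (var_writes c)) (arr_writes c) t u"
        "I (G S \<union> {a} \<times> {b} \<times> D) u"
      have "vr u x1 = a" "vr u x2 = b" using agree_vr[OF D(5), of x1] agree_vr[OF D(5), of x2] x S(5,6) by auto
      moreover have "agree ?X ?J s u"
        using S(7) by (intro agree_trans[OF _ agree_mono[OF D(5)]]) (auto simp: insert_commute)
      ultimately have "triple c u T (I (insert (a, b, d) (G S \<union> {a} \<times> {b} \<times> D)))"
        using S D fin by (intro body) (auto simp: G_def)
      also have "insert (a, b, d) (G S \<union> {a} \<times> {b} \<times> D) = G S \<union> {a} \<times> {b} \<times> insert d D" by auto
      finally show "triple c u T (I (G S \<union> {a} \<times> {b} \<times> insert d D))" .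
    qed (use x z K S W_gt n_pos stable in auto)
    moreover have "G S \<union> {a} \<times> {b} \<times> {..<K} = G (insert (a, b) S)" by (auto simp: G_def)
    ultimately show "triple (For x3 z' c) t (n * (T + 40)) (I (G (insert (a, b) S)))" by simp
  qed (use x K W_gt n_pos stable init in \<open>auto simp: G_empty\<close>)
  have "n ^ 2 * (n * (T + 40) + 80) \<le> n ^ 3 * (T + 120)"
    using n_pos by (simp add: algebra_simps power2_eq_square power3_eq_cube)
  moreover have "G ({..<n} \<times> {..<n}) = {..<n} \<times> {..<n} \<times> {..<K}" by (auto simp: G_def)
  ultimately show ?thesis using triple_mono[OF 1] by auto
qed

end

text \<open>The prologue puts n into register 3 and the input length 3 + n + 3 * m into register 1.
  If n is zero it jumps past the end with 0 still in register 0, so the compiled code may assume a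
  nonempty graph. The last instruction moves variable \<open>v\<close> to the output
  register.\<close>

definition program :: "com \<Rightarrow> nat \<Rightarrow> instr list" where
  "program c v =
     [Load 3 0, Jump_zero 3 (csize c + 9), Const 2 1, Load 4 2, Const 2 3, Binop Mul 4 4 2,
      Binop Add 4 4 2, Binop Add 1 4 3] @ compile 8 c @ [Binop Or 0 (2*v+5) (2*v+5)]"

abbreviation "start \<equiv> \<lparr>vr = \<lambda>_. 0, ar = \<lambda>_ _. 0\<rparr>"

lemma program_correct_empty:
  assumes "xs \<noteq> []" "xs ! 0 = 0"
  shows "computes_within w (program c v) xs 2 0"
proof -
  let ?P = "program c v" and ?s = "initial xs"
  have len: "length ?P = csize c + 9" and P: "?P ! 0 = Load 3 0" "?P ! Suc 0 = Jump_zero 3 (csize c + 9)"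
    by (simp_all add: program_def)
  have 1: "step w ?P ?s = ?s\<lparr>pc := 1, regs := \<lambda>_. 0\<rparr>"
    using assms P by (auto simp: step_def halted_def len initial_def)
  have 2: "step w ?P (?s\<lparr>pc := 1, regs := \<lambda>_. 0\<rparr>) = ?s\<lparr>pc := csize c + 9, regs := \<lambda>_. 0\<rparr>"
    using P by (simp add: step_def halted_def len)
  have "(step w ?P ^^ 2) ?s = ?s\<lparr>pc := csize c + 9, regs := \<lambda>_. 0\<rparr>"
    by (simp only: numeral_2_eq_2 funpow.simps comp_apply id_apply 1 2)
  then show ?thesis
    by (simp add: computes_within_def Let_def halted_def len)
qed

text \<open>The additive 9 is the eight prologue instructions and the final move.\<close>

lemma (in word_ram) program_correct:
  assumes len: "length xs = 3 + n + 3 * m" and xs: "xs ! 0 = n" "xs ! 1 = m"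
    and triple: "triple c start T (\<lambda>s. vr s v = y)"
  shows "\<exists>t \<le> T + 9. computes_within w (program c v) xs t y"
proof -
  let ?P = "program c v"
  let ?mem = "\<lambda>i. if i < length xs then xs ! i else 0"
  have lenP: "length ?P = csize c + 9" by (simp add: program_def)
  have lt: "n < W" "m < W" "length xs < W" "3 < W" "1 < W"
  proof -
    have "1 \<le> n ^ 3" using n_pos by simp
    then have "length xs < W" using fits by linarith
    then show "length xs < W" "m < W" using len by linarith+
    show "n < W" "3 < W" "1 < W" using W_gt by linarith+
  qed
  define r where "r = (\<lambda>_::nat. 0::nat)(3 := n, 2 := 3, 4 := 3 * m + 3, 1 := length xs)"
  have c: "conc start r ?mem"
    using len by (auto simp: conc_def r_def cell_def)
  let ?pre = "[Load 3 0, Jump_zero 3 (csize c + 9), Const 2 1, Load 4 2, Const 2 3, Binop Mul 4 4 2,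
      Binop Add 4 4 2, Binop Add 1 4 3]"
  have "length ?pre = 8" by simp
  from code_at_self[of ?pre "compile 8 c", unfolded this] have at: "code_at ?P 8 (compile 8 c)"
    unfolding program_def .
  have s1: "steps ?P 1 p r m p' r' m' \<longleftrightarrow>
      exec w (?P ! p) \<lparr>pc = p, regs = r, mem = m\<rparr> = \<lparr>pc = p', regs = r', mem = m'\<rparr>" if "p < 8" for p r m p' r' m'
    using that lenP by (simp add: steps_def step_def halted_def)
  define r1 where "r1 = (\<lambda>_::nat. 0::nat)(3 := n)"
  have a1: "steps ?P 1 0 (\<lambda>_. 0) ?mem 1 r1 ?mem"
    by (subst s1) (use len xs in \<open>auto simp: program_def r1_def\<close>)
  have a2: "steps ?P 1 1 r1 ?mem 2 r1 ?mem"
    by (subst s1) (use n_pos in \<open>auto simp: program_def r1_def\<close>)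
  have a3: "steps ?P 1 2 r1 ?mem 3 (r1(2 := 1)) ?mem"
    by (subst s1) (auto simp: program_def)
  have a4: "steps ?P 1 3 (r1(2 := 1)) ?mem 4 (r1(2 := 1, 4 := m)) ?mem"
    by (subst s1) (use len xs in \<open>auto simp: program_def\<close>)
  have a5: "steps ?P 1 4 (r1(2 := 1, 4 := m)) ?mem 5 (r1(2 := 3, 4 := m)) ?mem"
    by (subst s1) (use lt in \<open>auto simp: program_def fun_upd_twist\<close>)
  have a6: "steps ?P 1 5 (r1(2 := 3, 4 := m)) ?mem 6 (r1(2 := 3, 4 := 3 * m)) ?mem"
    by (subst s1) (use lt len in \<open>auto simp: program_def\<close>)
  have a7: "steps ?P 1 6 (r1(2 := 3, 4 := 3 * m)) ?mem 7 (r1(2 := 3, 4 := 3 * m + 3)) ?mem"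
    by (subst s1) (use lt len in \<open>auto simp: program_def\<close>)
  have a8: "steps ?P 1 7 (r1(2 := 3, 4 := 3 * m + 3)) ?mem 8 r ?mem"
    by (subst s1) (use lt len in \<open>auto simp: program_def r_def r1_def\<close>)
  have pro: "steps ?P 8 0 (\<lambda>_. 0) ?mem 8 r ?mem"
    using steps_trans[OF a1 steps_trans[OF a2 steps_trans[OF a3 steps_trans[OF a4 steps_trans[OF a5
      steps_trans[OF a6 steps_trans[OF a7 a8]]]]]]] by (simp add: eval_nat_numeral)
  have "ok c start" using triple by (simp add: triple_def)
  from compile_correct[OF this] obtain r2 m2 where
    r2: "steps ?P (tm c start) 8 r ?mem (8 + csize c) r2 m2" "conc (sem c start) r2 m2"
    using at c by (rule simulatesD)
  have "r2 (2*v+5) = y" using r2(2) triple by (simp add: conc_def triple_def)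
  then have fin: "steps ?P 1 (8 + csize c) r2 m2 (length ?P) (r2(0 := y)) m2"
    by (intro steps_1) (simp_all add: lenP, simp add: program_def nth_append)
  have "steps ?P (8 + (tm c start + 1)) 0 (\<lambda>_. 0) ?mem (length ?P) (r2(0 := y)) m2"
    by (rule steps_trans[OF pro steps_trans[OF r2(1) fin]])
  then have "computes_within w ?P xs (8 + (tm c start + 1)) y"
    by (simp add: computes_within_def steps_def initial_def halted_def)
  then show ?thesis using triple by (intro exI[of _ "8 + (tm c start + 1)"]) (simp add: triple_def)
qed

section \<open>Counting strings by consecutive occurrences\<close>

text \<open>Vertices are replaced by their ranks in the Wheeler order. The order becomes
  \<open><\<close> on numbers, and W1 and W2 become monotonicity of targets in labels and in
  sources.\<close>

locale wheeler_positions =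
  fixes n :: nat and \<Sigma> :: "'a::linorder set" and E :: "(nat \<times> nat \<times> 'a) set"
  assumes fin: "finite \<Sigma>"
    and edges: "(u, v, a) \<in> E \<Longrightarrow> u < n \<and> v < n \<and> a \<in> \<Sigma>"
    and det: "(u, v, a) \<in> E \<Longrightarrow> (u, v', a) \<in> E \<Longrightarrow> v = v'"
    and no_source_first: "v < n \<Longrightarrow> \<nexists>u a. (u, v, a) \<in> E \<Longrightarrow> (u', v', a') \<in> E \<Longrightarrow> v < v'"
    and label_mono: "(u, v, a) \<in> E \<Longrightarrow> (u', v', a') \<in> E \<Longrightarrow> a < a' \<Longrightarrow> v < v'"
    and source_mono: "(u, v, a) \<in> E \<Longrightarrow> (u', v', a) \<in> E \<Longrightarrow> u < u' \<Longrightarrow> v \<le> v'"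
begin

primrec readable :: "'a list \<Rightarrow> nat \<Rightarrow> bool" where
  "readable [] u \<longleftrightarrow> u < n"
| "readable (a # \<alpha>) u \<longleftrightarrow> (\<exists>v. (u, v, a) \<in> E \<and> readable \<alpha> v)"

lemma readable_alphabet: "readable \<alpha> u \<Longrightarrow> set \<alpha> \<subseteq> \<Sigma>"
  by (induction \<alpha> arbitrary: u) (auto dest: edges)

text \<open>
  The strings read from \<open>u\<close> and \<open>v\<close> but from no position in between. Summing over consecutive
  occurrences turns the count of distinct strings into the count at the single positions minus
  the count at the consecutive pairs.
\<close>

definition D :: "nat \<Rightarrow> nat \<Rightarrow> nat \<Rightarrow> 'a list set" where
  "D l u v = {\<alpha>. length \<alpha> = l \<and> readable \<alpha> u \<and> readable \<alpha> v \<and>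
     (\<forall>x. u < x \<and> x < v \<longrightarrow> \<not> readable \<alpha> x)}"

definition strings_below :: "nat \<Rightarrow> nat \<Rightarrow> 'a list set" where
  "strings_below l m = {\<alpha>. length \<alpha> = l \<and> (\<exists>u<m. readable \<alpha> u)}"

lemma finite_strings: "finite {\<alpha>. set \<alpha> \<subseteq> \<Sigma> \<and> length \<alpha> = l}"
  using fin by (rule finite_lists_length_eq)

lemma finite_D [simp]: "finite (D l u v)"
  by (rule finite_subset[OF _ finite_strings[of l]]) (auto simp: D_def dest: readable_alphabet)

lemma finite_strings_below [simp]: "finite (strings_below l m)"
  by (rule finite_subset[OF _ finite_strings[of l]]) (auto simp: strings_below_def dest: readable_alphabet)

text \<open>When position \<open>m\<close> is added, the strings read there that occurred before are
  classified by their last earlier occurrence \<open>u\<close>; these disjoint classes are the sets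
  \<open>D l u m\<close>.\<close>

lemma card_strings_below:
  "int (card (strings_below l m)) = (\<Sum>v<m. int (card (D l v v)) - (\<Sum>u<v. int (card (D l u v))))"
proof (induction m)
  case 0
  then show ?case by (simp add: strings_below_def)
next
  case (Suc m)
  have Un: "strings_below l (Suc m) = strings_below l m \<union> D l m m"
    by (auto simp: strings_below_def D_def less_Suc_eq)
  have Int: "strings_below l m \<inter> D l m m = (\<Union>u<m. D l u m)"
  proof (intro equalityI subsetI)
    fix \<alpha>
    assume a: "\<alpha> \<in> strings_below l m \<inter> D l m m"
    let ?U = "{u. u < m \<and> readable \<alpha> u}"
    have fin: "finite ?U" and ne: "?U \<noteq> {}" using a by (auto simp: strings_below_def)
    obtain M where M: "M \<in> ?U" "\<And>x. x \<in> ?U \<Longrightarrow> x \<le> M"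
      using Max_in[OF fin ne] Max_ge[OF fin] by blast
    have "\<not> readable \<alpha> x" if "M < x" "x < m" for x
      using M(2)[of x] that by auto
    then have "\<alpha> \<in> D l M m" using a M(1) by (simp add: D_def)
    then show "\<alpha> \<in> (\<Union>u<m. D l u m)" using M(1) by blast
  qed (auto simp: strings_below_def D_def)
  have disj: "D l u m \<inter> D l u' m = {}" if "u < m" "u' < m" "u \<noteq> u'" for u u'
    using that by (cases "u < u'") (auto simp: D_def)
  have "card (\<Union>u<m. D l u m) = (\<Sum>u<m. card (D l u m))"
    using disj by (intro card_UN_disjoint) auto
  moreover have "card (strings_below l m) + card (D l m m) =
      card (strings_below l (Suc m)) + card (strings_below l m \<inter> D l m m)"
    unfolding Un by (rule card_Un_Int) auto
  ultimately have "int (card (strings_below l (Suc m))) =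
      int (card (strings_below l m)) + int (card (D l m m)) - int (\<Sum>u<m. card (D l u m))"
    unfolding Int by linarith
  then show ?case using Suc.IH by simp
qed

section \<open>The linear recursion on pairs of positions\<close>

lemma label_unique: "(u, v, a) \<in> E \<Longrightarrow> (u', v, a') \<in> E \<Longrightarrow> a = a'"
  using label_mono[of u v a u' v a'] label_mono[of u' v a' u v a] by (meson less_irrefl neqE)

text \<open>By monotonicity, positions strictly between \<open>u\<close> and \<open>v\<close> reach
  targets between \<open>p\<close> and \<open>q\<close>. Inner targets are already excluded by
  \<open>D\<close>, so only edges into \<open>p\<close> and \<open>q\<close> themselves have to be
  forbidden.\<close>

definition link :: "nat \<times> nat \<Rightarrow> nat \<times> nat \<Rightarrow> bool" where
  "link = (\<lambda>(u, v) (p, q). u \<le> v \<and> (\<exists>a. (u, p, a) \<in> E \<and> (v, q, a) \<in> E \<and>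
     (\<forall>x. u < x \<and> x < v \<longrightarrow> (x, p, a) \<notin> E \<and> (x, q, a) \<notin> E)))"

lemma link_le: "link (u, v) (p, q) \<Longrightarrow> u \<le> v \<and> p \<le> q \<and> u < n \<and> v < n \<and> p < n \<and> q < n"
  unfolding link_def by (auto dest: edges det source_mono simp: le_less)

text \<open>Determined by \<open>label_unique\<close> once \<open>v\<close> has an incoming edge.
  Otherwise the value is unspecified, which is why \<open>pred1\<close> and the array specification
  test \<open>sources\<close> for emptiness.\<close>

definition label :: "nat \<Rightarrow> 'a" where
  "label v = (THE a. \<exists>u. (u, v, a) \<in> E)"

lemma label_eq: "(u, v, a) \<in> E \<Longrightarrow> label v = a"
  unfolding label_def by (rule the_equality) (auto dest: label_unique)

text \<open>A vertex without incoming edges would precede \<open>p\<close>, so \<open>y\<close> has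
  one. Its label can be neither below nor above \<open>a\<close>. A source at or before
  \<open>u\<close> would push \<open>y\<close> down to \<open>p\<close> or below, one at or after
  \<open>v\<close> up to \<open>q\<close> or above.\<close>

lemma between_targets:
  assumes E: "(u, p, a) \<in> E" "(v, q, a) \<in> E" and y: "p < y" "y < q"
  obtains x where "u < x" "x < v" "(x, y, a) \<in> E"
proof -
  have "y < n" using y edges[OF E(2)] by simp
  then obtain x b where x: "(x, y, b) \<in> E"
    using no_source_first[of y, OF _ _ E(1)] y by force
  have "\<not> b < a" "\<not> a < b"
    using label_mono[OF x E(1)] label_mono[OF E(2) x] y by auto
  then have x: "(x, y, a) \<in> E" using x by simp
  have "u < x"
  proof (rule ccontr)
    assume "\<not> u < x"
    then show False using source_mono[OF x E(1)] det[OF x, of p] E(1) y by (cases "x = u") auto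
  qed
  moreover have "x < v"
  proof (rule ccontr)
    assume "\<not> x < v"
    then show False using source_mono[OF E(2) x] det[OF x, of q] E(2) y by (cases "x = v") auto
  qed
  ultimately show thesis using that x by blast
qed

text \<open>If the tail were readable at an inner target, \<open>between_targets\<close> would
  supply an inner source for the whole string. Conversely an inner source leads into the closed
  interval from \<open>p\<close> to \<open>q\<close>, whose ends are excluded by \<open>link\<close>
  and whose interior by \<open>D l p q\<close>.\<close>

lemma D_Suc:
  assumes "u \<le> v"
  shows "D (Suc l) u v = (\<Union>(p, q) \<in> {t. link (u, v) t}. (#) (label p) ` D l p q)"
proof (intro equalityI subsetI)
  fix \<beta>
  assume "\<beta> \<in> D (Suc l) u v"
  then obtain a \<alpha> p q where \<beta>: "\<beta> = a # \<alpha>" "length \<alpha> = l" and p: "(u, p, a) \<in> E" "readable \<alpha> p"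
    and q: "(v, q, a) \<in> E" "readable \<alpha> q"
    and no: "\<forall>x. u < x \<and> x < v \<longrightarrow> \<not> readable (a # \<alpha>) x"
    by (cases \<beta>) (auto simp: D_def)
  have "link (u, v) (p, q)"
    using assms p q no by (auto simp: link_def)
  moreover have "\<not> readable \<alpha> y" if "p < y" "y < q" for y
    using between_targets[OF p(1) q(1) that] no by (metis readable.simps(2))
  ultimately show "\<beta> \<in> (\<Union>(p, q) \<in> {t. link (u, v) t}. (#) (label p) ` D l p q)"
    using \<beta> p q label_eq[OF p(1)] by (auto simp: D_def intro!: bexI[of _ "(p, q)"])
next
  fix \<beta>
  assume "\<beta> \<in> (\<Union>(p, q) \<in> {t. link (u, v) t}. (#) (label p) ` D l p q)"
  then obtain p q \<alpha> where l: "link (u, v) (p, q)" and \<alpha>: "\<alpha> \<in> D l p q" "\<beta> = label p # \<alpha>" by auto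
  from l obtain a where a: "(u, p, a) \<in> E" "(v, q, a) \<in> E"
      "\<forall>x. u < x \<and> x < v \<longrightarrow> (x, p, a) \<notin> E \<and> (x, q, a) \<notin> E"
    by (auto simp: link_def)
  have \<beta>: "\<beta> = a # \<alpha>" using \<alpha> label_eq[OF a(1)] by simp
  have "\<not> readable \<beta> x" if x: "u < x" "x < v" for x
  proof
    assume "readable \<beta> x"
    then obtain y where y: "(x, y, a) \<in> E" "readable \<alpha> y" by (auto simp: \<beta>)
    have "p \<le> y" "y \<le> q" using source_mono[OF a(1) y(1)] source_mono[OF y(1) a(2)] x by auto
    moreover have "y \<noteq> p" "y \<noteq> q" using a(3) x y by auto
    ultimately show False using \<alpha> y by (auto simp: D_def)
  qed
  then show "\<beta> \<in> D (Suc l) u v"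
    using \<alpha> a by (auto simp: D_def \<beta>)
qed

definition PS :: "(nat \<times> nat) set" where
  "PS = {..<n} \<times> {..<n}"

lemma finite_PS [simp]: "finite PS"
  by (simp add: PS_def)

text \<open>The value 0 for \<open>u > v\<close> agrees with \<open>link\<close>, which relates
  ordered pairs only; thus the recursion holds on all of \<open>PS\<close>.\<close>

definition occ :: "nat \<Rightarrow> nat \<times> nat \<Rightarrow> nat" where
  "occ l = (\<lambda>(u, v). if u \<le> v then card (D l u v) else 0)"

lemma link_PS: "link s t \<Longrightarrow> s \<in> PS \<and> t \<in> PS"
  using link_le by (cases s; cases t) (auto simp: PS_def)

text \<open>The union in \<open>D_Suc\<close> is disjoint: for given \<open>(u, v)\<close>
  determinism makes the first letter determine \<open>(p, q)\<close>.\<close>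

lemma occ_Suc: "occ (Suc l) s = (\<Sum>t\<in>PS. of_bool (link s t) * occ l t)"
proof -
  obtain u v where s: "s = (u, v)" by (cases s)
  show ?thesis
  proof (cases "u \<le> v")
    case True
    have disj: "(#) (label p) ` D l p q \<inter> (#) (label p') ` D l p' q' = {}"
      if "link s (p, q)" "link s (p', q')" "(p, q) \<noteq> (p', q')" for p q p' q'
    proof -
      from that obtain a a' where
        a: "(u, p, a) \<in> E" "(v, q, a) \<in> E" "(u, p', a') \<in> E" "(v, q', a') \<in> E"
        by (auto simp: link_def s)
      have "a \<noteq> a'" using that(3) det[OF a(1)] det[OF a(2)] a(3,4) by auto
      then show ?thesis using label_eq[OF a(1)] label_eq[OF a(3)] by auto
    qed
    have fin: "finite {t. link s t}"
      by (rule finite_subset[OF _ finite_PS]) (auto dest: link_PS)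
    have "occ (Suc l) s = card (\<Union>t \<in> {t. link s t}. (#) (label (fst t)) ` D l (fst t) (snd t))"
      using True by (simp add: s occ_def D_Suc case_prod_beta)
    also have "\<dots> = (\<Sum>t | link s t. card ((#) (label (fst t)) ` D l (fst t) (snd t)))"
      using disj fin by (intro card_UN_disjoint) auto
    also have "\<dots> = (\<Sum>t | link s t. occ l t)"
    proof (rule sum.cong)
      fix t
      assume "t \<in> {t. link s t}"
      then have "fst t \<le> snd t" using link_le[of u v "fst t" "snd t"] by (simp add: s)
      then show "card ((#) (label (fst t)) ` D l (fst t) (snd t)) = occ l t"
        by (simp add: card_image occ_def case_prod_beta)
    qed simp
    also have "\<dots> = (\<Sum>t\<in>PS. if link s t then occ l t else 0)"
      by (subst sum.If_cases) (auto dest: link_PS intro!: sum.cong)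
    also have "\<dots> = (\<Sum>t\<in>PS. of_bool (link s t) * occ l t)"
      by (intro sum.cong) auto
    finally show ?thesis .
  next
    case False
    then show ?thesis using s link_le by (auto simp: occ_def)
  qed
qed

text \<open>The empty string occurs at every position, so two positions have no occurrence in
  between only if they are equal or adjacent.\<close>

lemma occ_0:
  assumes "s \<in> PS"
  shows "occ 0 s = of_bool (fst s \<le> snd s \<and> snd s \<le> Suc (fst s))"
proof -
  obtain u v where s: "s = (u, v)" by (cases s)
  have "D 0 u v = (if v \<le> Suc u then {[]} else {})"
  proof -
    have "(\<forall>x. u < x \<and> x < v \<longrightarrow> \<not> x < n) \<longleftrightarrow> v \<le> Suc u"
    proof
      assume *: "\<forall>x. u < x \<and> x < v \<longrightarrow> \<not> x < n"
      show "v \<le> Suc u"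
      proof (rule ccontr)
        assume "\<not> v \<le> Suc u"
        then show False using *[rule_format, of "Suc u"] assms s by (auto simp: PS_def)
      qed
    qed auto
    then show ?thesis using assms s by (auto simp: D_def PS_def)
  qed
  then show ?thesis by (simp add: s occ_def)
qed

definition count :: "nat \<Rightarrow> int" where
  "count k = (\<Sum>v<n. int (occ k (v, v)) - (\<Sum>u<v. int (occ k (u, v))))"

lemma count_eq: "count k = int (card (strings_below k n))"
  unfolding card_strings_below count_def by (simp add: occ_def)

text \<open>
  A matrix on pairs whose columns at pairs \<open>(p, q)\<close> with \<open>p \<noteq> q\<close> have at most one nonzero entry,
  a one in row \<open>F (p, q)\<close>. It is determined by \<open>F\<close> and its \<open>n\<close> diagonal columns, so that products
  cost \<open>O(n ^ 4)\<close>.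
\<close>

definition structured :: "(nat \<times> nat \<Rightarrow> nat \<times> nat \<Rightarrow> nat) \<Rightarrow> (nat \<times> nat \<Rightarrow> (nat \<times> nat) option) \<Rightarrow> bool" where
  "structured X F \<longleftrightarrow> (\<forall>p<n. F (p, p) = None) \<and>
     (\<forall>t\<in>PS. fst t \<noteq> snd t \<longrightarrow> (\<forall>s\<in>PS. X s t = of_bool (F t = Some s))) \<and>
     (\<forall>t\<in>PS. \<forall>s. F t = Some s \<longrightarrow> s \<in> PS \<and> fst s \<noteq> snd s)"

text \<open>These are the two sums that the program evaluates, the diagonal one in
  \<open>accumulate\<close> and the other one in \<open>scatter\<close>.\<close>

lemma sum_structured:
  assumes "structured X F" "s \<in> PS"
  shows "(\<Sum>t\<in>PS. X s t * y t) =
    (\<Sum>l<n. X s (l, l) * y (l, l)) + (\<Sum>t\<in>PS. of_bool (F t = Some s) * y t)"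
proof -
  let ?d = "(\<lambda>l. (l, l)) ` {..<n}"
  have sub: "?d \<subseteq> PS" by (auto simp: PS_def)
  have "(\<Sum>t\<in>PS. X s t * y t) = (\<Sum>t\<in>?d. X s t * y t) + (\<Sum>t\<in>PS - ?d. X s t * y t)"
    using sum.subset_diff[OF sub finite_PS] by (simp add: add.commute)
  also have "(\<Sum>t\<in>?d. X s t * y t) = (\<Sum>l<n. X s (l, l) * y (l, l))"
    by (subst sum.reindex) (auto simp: inj_on_def)
  also have "(\<Sum>t\<in>PS - ?d. X s t * y t) = (\<Sum>t\<in>PS - ?d. of_bool (F t = Some s) * y t)"
  proof (rule sum.cong)
    fix t
    assume t: "t \<in> PS - ?d"
    then have "fst t \<noteq> snd t" by (cases t) (auto simp: PS_def)
    then show "X s t * y t = of_bool (F t = Some s) * y t"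
      using assms t by (auto simp: structured_def)
  qed simp
  \<comment> \<open>Diagonal pairs may be added back because \<open>F\<close> is undefined
    there.\<close>
  also have "\<dots> = (\<Sum>t\<in>PS. of_bool (F t = Some s) * y t)"
    by (rule sum.mono_neutral_left) (use assms in \<open>auto simp: structured_def\<close>)
  finally show ?thesis .
qed

definition mm :: "(nat \<times> nat \<Rightarrow> nat \<times> nat \<Rightarrow> nat) \<Rightarrow> (nat \<times> nat \<Rightarrow> nat \<times> nat \<Rightarrow> nat) \<Rightarrow> nat \<times> nat \<Rightarrow> nat \<times> nat \<Rightarrow> nat" where
  "mm X Y s t = (\<Sum>m\<in>PS. X s m * Y m t)"

text \<open>An off-diagonal column of \<open>Y\<close> is zero or a unit vector, so the same column
  of the product is zero or the column of \<open>X\<close> at \<open>G t\<close>. The latter is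
  off-diagonal because the values of \<open>G\<close> are, which preserves the format.\<close>

lemma structured_mm:
  assumes X: "structured X F" and Y: "structured Y G"
  shows "structured (mm X Y) (\<lambda>t. Option.bind (G t) F)"
  unfolding structured_def
proof (intro conjI ballI allI impI)
  show "Option.bind (G (p, p)) F = None" if "p < n" for p
    using Y that by (simp add: structured_def)
next
  fix t s
  assume t: "t \<in> PS" "fst t \<noteq> snd t" and s: "s \<in> PS"
  have "mm X Y s t = (\<Sum>m\<in>PS. if G t = Some m then X s m else 0)"
    unfolding mm_def using Y t by (intro sum.cong) (auto simp: structured_def)
  also have "\<dots> = of_bool (Option.bind (G t) F = Some s)"
  proof (cases "G t")
    case (Some m)
    then have m: "m \<in> PS" "fst m \<noteq> snd m" using Y t unfolding structured_def by blast+
    then have "(\<Sum>m\<in>PS. if G t = Some m then X s m else 0) = X s m"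
      using Some by (simp add: eq_commute)
    then show ?thesis using X m s Some by (auto simp: structured_def)
  qed simp
  finally show "mm X Y s t = of_bool (Option.bind (G t) F = Some s)" .
next
  fix t s
  assume t: "t \<in> PS" and b: "Option.bind (G t) F = Some s"
  then obtain m where m: "G t = Some m" "F m = Some s" by (auto simp: bind_eq_Some_conv)
  then have "m \<in> PS" using Y t unfolding structured_def by blast
  then show "s \<in> PS" "fst s \<noteq> snd s" using X m(2) unfolding structured_def by blast+
qed

section \<open>The matrix of links and its powers\<close>

definition sources :: "nat \<Rightarrow> nat set" where
  "sources v = {u. \<exists>a. (u, v, a) \<in> E}"

lemma finite_sources [simp]: "finite (sources v)"
  by (rule finite_subset[of _ "{..<n}"]) (auto simp: sources_def dest: edges)

lemma sources_label: "u \<in> sources v \<longleftrightarrow> (u, v, label v) \<in> E"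
  unfolding sources_def using label_eq by blast

text \<open>All edges into \<open>p\<close> carry the same label, so only the set of sources
  matters. One pass over the sources can therefore fill a diagonal column.\<close>

lemma link_diag:
  "link (u, v) (p, p) \<longleftrightarrow> u \<le> v \<and> u \<in> sources p \<and> v \<in> sources p \<and> (\<forall>x. u < x \<and> x < v \<longrightarrow> x \<notin> sources p)"
proof
  assume "link (u, v) (p, p)"
  then obtain a where a: "u \<le> v" "(u, p, a) \<in> E" "(v, p, a) \<in> E" "\<forall>x. u < x \<and> x < v \<longrightarrow> (x, p, a) \<notin> E"
    by (auto simp: link_def)
  moreover have "label p = a" using label_eq[OF a(2)] .
  ultimately show "u \<le> v \<and> u \<in> sources p \<and> v \<in> sources p \<and> (\<forall>x. u < x \<and> x < v \<longrightarrow> x \<notin> sources p)"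
    by (simp add: sources_label)
qed (auto simp: link_def sources_label)

definition pred1 :: "nat \<times> nat \<Rightarrow> (nat \<times> nat) option" where
  "pred1 = (\<lambda>(p, q). if p < q \<and> sources p \<noteq> {} \<and> sources q \<noteq> {} \<and> label p = label q
     then Some (Max (sources p), Min (sources q)) else None)"

text \<open>For \<open>p < q\<close> with a common label, monotonicity and determinism place every
  source of \<open>p\<close> before every source of \<open>q\<close>. As no source of either may lie
  between \<open>u\<close> and \<open>v\<close>, only the last of the former and the first of the
  latter remain.\<close>

lemma link_pred1:
  assumes "p \<noteq> q"
  shows "link (u, v) (p, q) \<longleftrightarrow> pred1 (p, q) = Some (u, v)"
proof
  assume l: "link (u, v) (p, q)"
  then obtain a where a: "(u, p, a) \<in> E" "(v, q, a) \<in> E"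
      "\<forall>x. u < x \<and> x < v \<longrightarrow> (x, p, a) \<notin> E \<and> (x, q, a) \<notin> E"
    by (auto simp: link_def)
  have pq: "p < q" "u \<le> v" using link_le[OF l] assms by auto
  have lab: "label p = a" "label q = a" using label_eq a by auto
  have "Max (sources p) = u"
  proof (rule Max_eqI)
    fix x
    assume "x \<in> sources p"
    then have x: "(x, p, a) \<in> E" by (simp add: sources_label lab)
    show "x \<le> u"
    proof (rule ccontr)
      assume "\<not> x \<le> u"
      then have "\<not> x < v" using a(3) x by auto
      then show False using source_mono[OF a(2) x] det[OF a(2), of p] x pq by (cases "x = v") auto
    qed
  qed (use a in \<open>auto simp: sources_label lab\<close>)
  moreover have "Min (sources q) = v"
  proof (rule Min_eqI)
    fix x
    assume "x \<in> sources q"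
    then have x: "(x, q, a) \<in> E" by (simp add: sources_label lab)
    show "v \<le> x"
    proof (rule ccontr)
      assume "\<not> v \<le> x"
      then have "\<not> u < x" using a(3) x by auto
      then show False using source_mono[OF x a(1)] det[OF a(1), of q] x pq by (cases "x = u") auto
    qed
  qed (use a in \<open>auto simp: sources_label lab\<close>)
  ultimately show "pred1 (p, q) = Some (u, v)"
    using pq lab a by (auto simp: pred1_def sources_def)
next
  assume F: "pred1 (p, q) = Some (u, v)"
  then have pq: "p < q" "sources p \<noteq> {}" "sources q \<noteq> {}" "label p = label q"
      and uv: "u = Max (sources p)" "v = Min (sources q)"
    by (auto simp: pred1_def split: if_splits)
  have "u \<in> sources p" "v \<in> sources q" using pq uv by auto
  then have e: "(u, p, label p) \<in> E" "(v, q, label p) \<in> E" using pq(4) by (simp_all add: sources_label)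
  have "u < v"
  proof (rule ccontr)
    assume "\<not> u < v"
    then show False using source_mono[OF e(2,1)] det[OF e(1), of q] e(2) pq by (cases "u = v") auto
  qed
  moreover have "x \<notin> sources p \<and> x \<notin> sources q" if "u < x" "x < v" for x
    using that unfolding uv by (meson Max_ge Min_le finite_sources leD)
  ultimately show "link (u, v) (p, q)"
    using e pq(4) unfolding link_def sources_label by auto
qed

lemma structured_link: "structured (\<lambda>s t. of_bool (link s t)) pred1"
  unfolding structured_def
proof (intro conjI ballI allI impI)
  fix t s :: "nat \<times> nat"
  assume "fst t \<noteq> snd t"
  then show "of_bool (link s t) = (of_bool (pred1 t = Some s) :: nat)"
    using link_pred1[of "fst t" "snd t" "fst s" "snd s"] by simp
next
  fix t s
  assume F: "pred1 t = Some s"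
  then have ne: "fst t \<noteq> snd t" by (auto simp: pred1_def case_prod_beta split: if_splits)
  then have l: "link s t" using F link_pred1[of "fst t" "snd t" "fst s" "snd s"] by simp
  then show "s \<in> PS" using link_PS by blast
  show "fst s \<noteq> snd s"
  proof
    assume "fst s = snd s"
    with l have "fst t = snd t" unfolding link_def by (auto simp: case_prod_beta dest: det)
    with ne show False ..
  qed
qed (simp add: pred1_def)

text \<open>\<open>pw i\<close> is the matrix of \<open>link\<close> raised to the power
  \<open>2 ^ i\<close>.\<close>

primrec pw :: "nat \<Rightarrow> nat \<times> nat \<Rightarrow> nat \<times> nat \<Rightarrow> nat" where
  "pw 0 = (\<lambda>s t. of_bool (link s t))"
| "pw (Suc i) = mm (pw i) (pw i)"

text \<open>The length \<open>l\<close> is generalised because the two factors of a square act at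
  lengths \<open>l\<close> and \<open>l + 2 ^ i\<close>.\<close>

lemma pw_occ: "s \<in> PS \<Longrightarrow> (\<Sum>t\<in>PS. pw i s t * occ l t) = occ (l + 2 ^ i) s"
proof (induction i arbitrary: l s)
  case 0
  then show ?case by (simp add: occ_Suc)
next
  case (Suc i)
  have "(\<Sum>t\<in>PS. pw (Suc i) s t * occ l t) = (\<Sum>t\<in>PS. \<Sum>m\<in>PS. pw i s m * (pw i m t * occ l t))"
    by (simp add: mm_def sum_distrib_right mult.assoc)
  also have "\<dots> = (\<Sum>m\<in>PS. pw i s m * (\<Sum>t\<in>PS. pw i m t * occ l t))"
    by (subst sum.swap) (simp add: sum_distrib_left)
  also have "\<dots> = (\<Sum>m\<in>PS. pw i s m * occ (l + 2 ^ i) m)"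
    using Suc.IH by (intro sum.cong) auto
  also have "\<dots> = occ (l + 2 ^ i + 2 ^ i) s"
    using Suc by simp
  finally show ?case by (simp add: add.assoc mult_2)
qed

end

section \<open>The program\<close>

abbreviation (input) exp_add (infixl "[+]" 65) where "a [+] b \<equiv> Bin Add a b"
abbreviation (input) exp_sub (infixl "[-]" 65) where "a [-] b \<equiv> Bin Sub a b"
abbreviation (input) exp_mul (infixl "[*]" 70) where "a [*] b \<equiv> Bin Mul a b"

abbreviation (input) "xN \<equiv> 2 :: nat"
abbreviation (input) "xM \<equiv> 3 :: nat"
abbreviation (input) "xK \<equiv> 4 :: nat"
abbreviation (input) "xI \<equiv> 5 :: nat"
abbreviation (input) "xJ \<equiv> 6 :: nat"
abbreviation (input) "xC \<equiv> 7 :: nat"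
abbreviation (input) "xL \<equiv> 8 :: nat"
abbreviation (input) "xA \<equiv> 9 :: nat"
abbreviation (input) "xF \<equiv> 10 :: nat"
abbreviation (input) "xG \<equiv> 11 :: nat"
abbreviation (input) "xP \<equiv> 12 :: nat"
abbreviation (input) "xOne \<equiv> 13 :: nat"
abbreviation (input) "xOut \<equiv> 14 :: nat"
abbreviation (input) "xE \<equiv> 15 :: nat"

text \<open>
  Array \<open>aB\<close> holds the diagonal columns of the current matrix power \<open>M\<close>, arrays \<open>aFU\<close> and \<open>aFV\<close> its
  predecessor function (the first component is shifted by one, zero means undefined), and \<open>aY\<close>
  the vector of counts. \<open>aZ\<close>, \<open>aGU\<close>, \<open>aGV\<close> are the buffers of their updates.
\<close>

abbreviation (input) "aPos \<equiv> 2 :: nat"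
abbreviation (input) "aLab \<equiv> 3 :: nat"
abbreviation (input) "aAdj \<equiv> 4 :: nat"
abbreviation (input) "aB \<equiv> 5 :: nat"
abbreviation (input) "aZ \<equiv> 6 :: nat"
abbreviation (input) "aY \<equiv> 7 :: nat"
abbreviation (input) "aFU \<equiv> 8 :: nat"
abbreviation (input) "aFV \<equiv> 9 :: nat"
abbreviation (input) "aGU \<equiv> 10 :: nat"
abbreviation (input) "aGV \<equiv> 11 :: nat"
abbreviation (input) "aFirst \<equiv> 12 :: nat"
abbreviation (input) "aLast \<equiv> 13 :: nat"

abbreviation "skip \<equiv> Assign 0 (Var 0)"

text \<open>Diagonal part of a product with the power held in \<open>aB\<close>; \<open>S\<close> is
  the right factor and \<open>C\<close> the variable with its number of columns. As \<open>S\<close>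
  is still being read, results go to the buffer \<open>aZ\<close>.\<close>

definition accumulate :: "nat \<Rightarrow> nat \<Rightarrow> com" where
  "accumulate S C = For xI xN (For xJ xN (For xC C (
     Assign xA (Lit 0) ;;
     For xL xN (Assign xA (Var xA [+] Arr aB (Var xI) (Var xJ) (Var xL) [*] Arr S (Var xL) (Var xL) (Var xC))) ;;
     AStore aZ (Var xI) (Var xJ) (Var xC) (Var xA))))"

text \<open>Off-diagonal part. Row \<open>t\<close> of \<open>S\<close> is pushed to row
  \<open>F t\<close>, so preimages under \<open>F\<close> never have to be searched.\<close>

definition scatter :: "nat \<Rightarrow> nat \<Rightarrow> com" where
  "scatter S C = For xI xN (For xJ xN (
     Assign xF (Arr aFU (Var xI) (Var xJ) (Lit 0)) ;;
     Ite (Var xF)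
       (Assign xG (Arr aFV (Var xI) (Var xJ) (Lit 0)) ;;
        Assign xF (Var xF [-] Lit 1) ;;
        For xC C (AStore aZ (Var xF) (Var xG) (Var xC)
          (Arr aZ (Var xF) (Var xG) (Var xC) [+] Arr S (Var xI) (Var xJ) (Var xC))))
       skip))"

definition copy_back :: "nat \<Rightarrow> nat \<Rightarrow> com" where
  "copy_back S C = For xI xN (For xJ xN (For xC C (
     AStore S (Var xI) (Var xJ) (Var xC) (Arr aZ (Var xI) (Var xJ) (Var xC)))))"

definition apply_to :: "nat \<Rightarrow> nat \<Rightarrow> com" where
  "apply_to S C = (accumulate S C ;; scatter S C ;; copy_back S C)"

text \<open>The buffers are needed because \<open>F\<close> is looked up at other pairs during the
  pass. Where \<open>F\<close> itself is undefined only \<open>aGU\<close> is cleared; a stale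
  second component is harmless, as \<open>encodes\<close> ignores it when the first is zero.\<close>

definition square_pred :: com where
  "square_pred =
     (For xI xN (For xJ xN (
       Assign xF (Arr aFU (Var xI) (Var xJ) (Lit 0)) ;;
       Ite (Var xF)
         (Assign xG (Arr aFV (Var xI) (Var xJ) (Lit 0)) ;;
          Assign xF (Var xF [-] Lit 1) ;;
          AStore aGU (Var xI) (Var xJ) (Lit 0) (Arr aFU (Var xF) (Var xG) (Lit 0)) ;;
          AStore aGV (Var xI) (Var xJ) (Lit 0) (Arr aFV (Var xF) (Var xG) (Lit 0)))
         (AStore aGU (Var xI) (Var xJ) (Lit 0) (Lit 0)))) ;;
      For xI xN (For xJ xN (
        AStore aFU (Var xI) (Var xJ) (Lit 0) (Arr aGU (Var xI) (Var xJ) (Lit 0)) ;;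
        AStore aFV (Var xI) (Var xJ) (Lit 0) (Arr aGV (Var xI) (Var xJ) (Lit 0)))))"

lemma var_writes_parts [simp]:
  "var_writes (accumulate S C) = {xI, xJ, xC, xA, xL}"
  "var_writes (scatter S C) = {0, xI, xJ, xC, xF, xG}"
  "var_writes (copy_back S C) = {xI, xJ, xC}"
  "var_writes (apply_to S C) = {0, xI, xJ, xC, xA, xL, xF, xG}"
  "var_writes square_pred = {xI, xJ, xF, xG}"
  by (auto simp: accumulate_def scatter_def copy_back_def apply_to_def square_pred_def)

lemma arr_writes_parts [simp]:
  "arr_writes (accumulate S C) = {aZ}"
  "arr_writes (scatter S C) = {aZ}"
  "arr_writes (copy_back S C) = {S}"
  "arr_writes (apply_to S C) = {aZ, S}"
  "arr_writes square_pred = {aGU, aGV, aFU, aFV}"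
  by (auto simp: accumulate_def scatter_def copy_back_def apply_to_def square_pred_def)

section \<open>Correctness of the sparse product\<close>

context word_ram
begin

lemma small_mod [simp]: "2 mod W = 2" "3 mod W = 3" "Suc 0 mod W = Suc 0"
  using W_gt(1) by (auto intro!: mod_less simp del: one_less_power)

lemma bool_mod [simp]: "(if P then Suc 0 else 0) mod W = of_bool P"
  by (cases P) (simp_all only: if_True if_False small_mod mod_0 of_bool_eq One_nat_def)

lemma sub_mod:
  assumes "y \<le> x" "x < W"
  shows "(x + W - y) mod W = x - y"
proof -
  have "(x + W - y) mod W = (x - y + W) mod W" using assms by simp
  also have "\<dots> = x - y" using assms by (simp only: mod_add_self2) (rule mod_less, linarith)
  finally show ?thesis .
qed

lemma n_gt_0 [simp]: "0 < n"
  using n_pos by simp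

lemma triple_skip [simp]: "triple skip s T Q \<longleftrightarrow> 2 \<le> T \<and> Q s"
  by (auto simp: triple_def)

lemma triple_Ite:
  assumes "eok e s" "eval e s \<noteq> 0 \<Longrightarrow> triple c1 s T Q" "eval e s = 0 \<Longrightarrow> triple c2 s T Q"
  shows "triple (Ite e c1 c2) s (te e + 2 + T) Q"
  using assms by (cases "eval e s = 0") (simp_all add: triple_def)

lemma triple_weaken: "triple c s T Q \<Longrightarrow> T \<le> T' \<Longrightarrow> triple c s T' Q"
  by (simp add: triple_def)

lemma n_powers: "n \<le> n ^ 4" "n ^ 2 \<le> n ^ 4" "n ^ 3 \<le> n ^ 4" "1 \<le> n ^ 4"
  using n_pos power_increasing[of 1 4 n] power_increasing[of 2 4 n] power_increasing[of 3 4 n] by auto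

lemma triple_accumulate:
  assumes s: "vr s xN = n" "vr s C = K" "K \<le> n" and C: "C \<notin> {xI, xJ, xC, xL, xA}" and S: "S < 16" "S \<noteq> aZ"
  shows "triple (accumulate S C) s (n ^ 4 * 300) (\<lambda>t. \<forall>a<n. \<forall>b<n. \<forall>d<K.
    ar t aZ (a, b, d) = (\<Sum>l<n. ar s aB (a, b, l) * ar s S (l, l, d)) mod W)"
proof -
  let ?f = "\<lambda>a b d L. (\<Sum>l\<in>L. ar s aB (a, b, l) * ar s S (l, l, d)) mod W"
  \<comment> \<open>Budgets: 2 resets \<open>xA\<close>, the first 40 covers the summation step (30
    steps exactly), 14 is the final store; the second 40 and the 120 are the overheads of
    \<open>triple_For\<close> and \<open>triple_For3\<close>.\<close>
  have 1: "triple (accumulate S C) s (n ^ 3 * (2 + (n * (40 + 40) + 14) + 120))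
    ((\<lambda>D t. \<forall>(a, b, d) \<in> D. ar t aZ (a, b, d) = ?f a b d {..<n}) ({..<n} \<times> {..<n} \<times> {..<K}))"
    unfolding accumulate_def
  proof (rule triple_For3, goal_cases)
    \<comment> \<open>The loop body is the thirteenth premise of \<open>triple_For3\<close>; the
      other goals are side conditions on variables, bounds and invariant.\<close>
    case (13 D a b d t)
    note ag = \<open>agree _ _ s t\<close>
    have t: "vr t xN = n" "ar t aB = ar s aB" "ar t S = ar s S"
      using agree_vr[OF ag, of xN] agree_ar[OF ag, of aB] agree_ar[OF ag, of S] s S by auto
    show ?case
    proof (rule triple_weaken[OF triple_Seq[where R = "\<lambda>u. u = t\<lparr>vr := (vr t)(xA := 0)\<rparr>" and T = 2
          and T' = "n * (40 + 40) + 14", OF _ triple_Seq[where T' = 14]]])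
      fix u
      assume u: "u = t\<lparr>vr := (vr t)(xA := 0)\<rparr>"
      show "triple (For xL xN (Assign xA (Var xA [+] Arr aB (Var xI) (Var xJ) (Var xL) [*] Arr S (Var xL) (Var xL) (Var xC))))
        u (n * (40 + 40)) ((\<lambda>L u'. vr u' xA = ?f a b d L) {..<n})"
      proof (rule triple_For, goal_cases)
        case (10 L l u')
        note ag' = \<open>agree _ _ u u'\<close>
        have "vr u' xI = a" "vr u' xJ = b" "vr u' xC = d" "ar u' aB = ar s aB" "ar u' S = ar s S"
          using agree_vr[OF ag', of xI] agree_vr[OF ag', of xJ] agree_vr[OF ag', of xC]
            agree_ar[OF ag', of aB] agree_ar[OF ag', of S] 13 t by (auto simp: u)
        then show ?case
          using 10 13 s S by (simp add: triple_def mod_simps add.commute)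
      qed (use t W_gt n_pos in \<open>auto simp: u\<close>)
      fix v
      assume ag': "agree (var_writes (For xL xN (Assign xA (Var xA [+] Arr aB (Var xI) (Var xJ) (Var xL) [*] Arr S (Var xL) (Var xL) (Var xC)))))
          (arr_writes (For xL xN (Assign xA (Var xA [+] Arr aB (Var xI) (Var xJ) (Var xL) [*] Arr S (Var xL) (Var xL) (Var xC))))) u v"
        and v: "vr v xA = ?f a b d {..<n}"
      have "vr v xI = a" "vr v xJ = b" "vr v xC = d" "ar v aZ = ar t aZ"
        using agree_vr[OF ag', of xI] agree_vr[OF ag', of xJ] agree_vr[OF ag', of xC]
            agree_ar[OF ag', of aZ] 13 by (auto simp: u)
      then show "triple (AStore aZ (Var xI) (Var xJ) (Var xC) (Var xA)) v 14
         (\<lambda>t. \<forall>(a, b, d) \<in> insert (a, b, d) D. ar t aZ (a, b, d) = ?f a b d {..<n})"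
        using 13 s v by (auto simp: triple_def)
    qed (auto simp: triple_def)
  qed (use s C in auto)
  have "n ^ 3 * (2 + (n * (40 + 40) + 14) + 120) = n ^ 4 * 80 + n ^ 3 * 136"
    by (simp add: algebra_simps power3_eq_cube power4_eq_xxxx)
  also have "\<dots> \<le> n ^ 4 * 300" using n_powers by linarith
  finally show ?thesis using triple_mono[OF 1] by auto
qed

definition encodes :: "nat \<Rightarrow> nat \<Rightarrow> (nat \<times> nat) option \<Rightarrow> bool" where
  "encodes x y r \<longleftrightarrow> (r = None \<and> x = 0) \<or> (\<exists>u<n. r = Some (u, y) \<and> y < n \<and> x = Suc u)"

definition represents :: "hstate \<Rightarrow> (nat \<times> nat \<Rightarrow> (nat \<times> nat) option) \<Rightarrow> bool" where
  "represents s F \<longleftrightarrow> (\<forall>p<n. \<forall>q<n. encodes (ar s aFU (p, q, 0)) (ar s aFV (p, q, 0)) (F (p, q)))"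

lemma represents_cases:
  assumes "represents s F" "p < n" "q < n"
  obtains "F (p, q) = None" "ar s aFU (p, q, 0) = 0"
  | u v where "F (p, q) = Some (u, v)" "u < n" "v < n" "ar s aFU (p, q, 0) = Suc u" "ar s aFV (p, q, 0) = v"
proof -
  have "encodes (ar s aFU (p, q, 0)) (ar s aFV (p, q, 0)) (F (p, q))"
    using assms by (simp add: represents_def)
  then show thesis
    unfolding encodes_def by (elim disjE exE conjE) (use that in simp_all)
qed

text \<open>The invariant adds the contributions of the pairs treated so far and reduces modulo
  \<open>W\<close>. For the empty set it says that \<open>aZ\<close> equals its own residue, which
  is the purpose of \<open>lt\<close>.\<close>

lemma triple_scatter:
  assumes s: "vr s xN = n" "vr s C = K" "K \<le> n" and C: "C \<notin> {0, xI, xJ, xC, xF, xG}" and S: "S < 16" "S \<noteq> aZ"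
    and F: "represents s F" and lt: "\<forall>a<n. \<forall>b<n. \<forall>d<K. ar s aZ (a, b, d) < W"
  shows "triple (scatter S C) s (n ^ 4 * 300) (\<lambda>t. \<forall>a<n. \<forall>b<n. \<forall>d<K.
    ar t aZ (a, b, d) = (ar s aZ (a, b, d) +
      (\<Sum>p\<in>{..<n} \<times> {..<n}. of_bool (F p = Some (a, b)) * ar s S (fst p, snd p, d))) mod W)"
proof -
  let ?f = "\<lambda>a b d P. (ar s aZ (a, b, d) + (\<Sum>p\<in>P. of_bool (F p = Some (a, b)) * ar s S (fst p, snd p, d))) mod W"
  have 1: "triple (scatter S C) s (n ^ 2 * (14 + (3 + (14 + (4 + n * (40 + 40)))) + 80))
    ((\<lambda>P t. \<forall>a<n. \<forall>b<n. \<forall>d<K. ar t aZ (a, b, d) = ?f a b d P) ({..<n} \<times> {..<n}))"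
    unfolding scatter_def
  proof (rule triple_For2, goal_cases)
    case (10 P p q t)
    note ag = \<open>agree _ _ s t\<close>
    have t: "vr t xN = n" "vr t C = K" "ar t aFU = ar s aFU" "ar t aFV = ar s aFV" "ar t S = ar s S"
      using agree_vr[OF ag, of xN] agree_vr[OF ag, of C] agree_ar[OF ag, of aFU] agree_ar[OF ag, of aFV]
        agree_ar[OF ag, of S] s S C by auto
    have inv: "ar t aZ (a, b, d) = ?f a b d P" if "a < n" "b < n" "d < K" for a b d
      using 10 that by blast
    let ?t1 = "t\<lparr>vr := (vr t)(xF := ar s aFU (p, q, 0))\<rparr>"
    show ?case
    proof (rule triple_weaken[OF triple_Seq[where R = "\<lambda>u. u = ?t1", OF _ triple_Ite]])
      show "triple (Assign xF (Arr aFU (Var xI) (Var xJ) (Lit 0))) t 14 (\<lambda>u. u = ?t1)"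
        using 10 n_pos t by (simp add: triple_def)
    next
      fix t1
      assume t1: "t1 = ?t1" and z: "eval (Var xF) t1 = 0"
      have "F (p, q) = None" using F \<open>p < n\<close> \<open>q < n\<close> by (rule represents_cases) (use z t1 in auto)
      then show "triple skip t1 (14 + (4 + n * (40 + 40)))
          (\<lambda>t. \<forall>a<n. \<forall>b<n. \<forall>d<K. ar t aZ (a, b, d) = ?f a b d (insert (p, q) P))"
        using 10 t1 by simp
    next
      fix t1
      assume t1: "t1 = ?t1" and nz: "eval (Var xF) t1 \<noteq> 0"
      obtain u v where uv: "F (p, q) = Some (u, v)" "u < n" "v < n" "ar s aFU (p, q, 0) = Suc u"
        "ar s aFV (p, q, 0) = v"
        using F \<open>p < n\<close> \<open>q < n\<close> by (rule represents_cases) (use nz t1 in auto)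
      let ?t2 = "t\<lparr>vr := (vr t)(xF := Suc u, xG := v)\<rparr>"
      let ?t3 = "t\<lparr>vr := (vr t)(xF := u, xG := v)\<rparr>"
      let ?add = "AStore aZ (Var xF) (Var xG) (Var xC) (Arr aZ (Var xF) (Var xG) (Var xC) [+] Arr S (Var xI) (Var xJ) (Var xC))"
      let ?Q = "\<lambda>t. \<forall>a<n. \<forall>b<n. \<forall>d<K. ar t aZ (a, b, d) = ?f a b d (insert (p, q) P)"
      show "triple (Assign xG (Arr aFV (Var xI) (Var xJ) (Lit 0)) ;; Assign xF (Var xF [-] Lit 1) ;; For xC C ?add) t1
         (14 + (4 + n * (40 + 40))) ?Q"
      proof (rule triple_Seq[where R = "\<lambda>u. u = ?t2", OF _ triple_Seq[where R = "\<lambda>u. u = ?t3"]])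
        show "triple (Assign xG (Arr aFV (Var xI) (Var xJ) (Lit 0))) t1 14 (\<lambda>u. u = ?t2)"
          using 10 n_pos t t1 uv by (simp add: triple_def)
        have "(Suc u + W - Suc 0) mod W = u"
          using sub_mod[of 1 "Suc u"] W_gt uv by simp
        then show "triple (Assign xF (Var xF [-] Lit 1)) t2 4 (\<lambda>u. u = ?t3)" if "t2 = ?t2" for t2
          using that by (simp add: triple_def fun_upd_twist)
        fix t3
        assume t3: "t3 = ?t3"
        \<comment> \<open>While one row is pushed, only row \<open>(u, v)\<close> changes, and there
          only the columns already passed.\<close>
        have "triple (For xC C ?add) t3 (n * (40 + 40))
          ((\<lambda>D t'. \<forall>a<n. \<forall>b<n. \<forall>d<K. ar t' aZ (a, b, d) =
            (if a = u \<and> b = v \<and> d \<in> D then (ar t aZ (a, b, d) + ar s S (p, q, d)) mod W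
             else ar t aZ (a, b, d))) {..<K})"
        proof (rule triple_For, goal_cases)
          case (10 D d t')
          note ag' = \<open>agree _ _ t3 t'\<close>
          have "vr t' xI = p" "vr t' xJ = q" "vr t' xF = u" "vr t' xG = v" "ar t' S = ar s S"
            using agree_vr[OF ag', of xI] agree_vr[OF ag', of xJ] agree_vr[OF ag', of xF]
              agree_vr[OF ag', of xG] agree_ar[OF ag', of S] 10 t \<open>vr t xI = p\<close> \<open>vr t xJ = q\<close> S by (auto simp: t3)
          then show ?case
            using 10 s S uv \<open>p < n\<close> \<open>q < n\<close> by (auto simp: triple_def)
        qed (use C t s W_gt n_pos in \<open>auto simp: t3\<close>)
        then show "triple (For xC C ?add) t3 (n * (40 + 40)) ?Q"
        proof (rule triple_mono)
          fix t'
          assume t': "\<forall>a<n. \<forall>b<n. \<forall>d<K. ar t' aZ (a, b, d) =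
            (if a = u \<and> b = v \<and> d \<in> {..<K} then (ar t aZ (a, b, d) + ar s S (p, q, d)) mod W
             else ar t aZ (a, b, d))"
          show "?Q t'"
          proof (intro allI impI)
            fix a b d
            assume abd: "a < n" "b < n" "d < K"
            show "ar t' aZ (a, b, d) = ?f a b d (insert (p, q) P)"
            proof (cases "a = u \<and> b = v")
              case True
              then have "ar t' aZ (a, b, d) = (?f a b d P + ar s S (p, q, d)) mod W"
                using t' abd inv[OF abd] by simp
              also have "\<dots> = ?f a b d (insert (p, q) P)"
                using True uv 10 by (simp add: mod_simps add_ac)
              finally show ?thesis .
            next
              case False
              then have "ar t' aZ (a, b, d) = ?f a b d P"
                using t' abd inv[OF abd] by auto
              also have "\<dots> = ?f a b d (insert (p, q) P)"
                using False uv 10 by auto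
              finally show ?thesis .
            qed
          qed
        qed simp
      qed
    qed simp_all
  qed (use s C lt in auto)
  have "n ^ 2 * (14 + (3 + (14 + (4 + n * (40 + 40)))) + 80) = n ^ 3 * 80 + n ^ 2 * 115"
    by (simp add: algebra_simps power3_eq_cube power2_eq_square)
  also have "\<dots> \<le> n ^ 4 * 300" using n_powers by linarith
  finally show ?thesis by (rule triple_weaken[OF 1])
qed

lemma triple_copy_back:
  assumes s: "vr s xN = n" "vr s C = K" "K \<le> n" and C: "C \<notin> {xI, xJ, xC}" and S: "S < 16" "S \<noteq> aZ"
  shows "triple (copy_back S C) s (n ^ 4 * 300) (\<lambda>t. \<forall>a<n. \<forall>b<n. \<forall>d<K.
    ar t S (a, b, d) = ar s aZ (a, b, d))"
proof -
  have 1: "triple (copy_back S C) s (n ^ 3 * (40 + 120))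
    ((\<lambda>D t. \<forall>(a, b, d) \<in> D. ar t S (a, b, d) = ar s aZ (a, b, d)) ({..<n} \<times> {..<n} \<times> {..<K}))"
    unfolding copy_back_def
  proof (rule triple_For3, goal_cases)
    case (13 D a b d t)
    note ag = \<open>agree _ _ s t\<close>
    have "ar t aZ = ar s aZ" using agree_ar[OF ag, of aZ] S by simp
    then show ?case using 13 S s by (simp add: triple_def)
  qed (use s C in auto)
  have "n ^ 3 * (40 + 120) = n ^ 3 * 160" by simp
  also have "\<dots> \<le> n ^ 4 * 300" using n_powers by linarith
  finally have "n ^ 3 * (40 + 120) \<le> n ^ 4 * 300" .
  from triple_mono[OF 1 this] show ?thesis by auto
qed

lemma triple_apply_to:
  assumes s: "vr s xN = n" "vr s C = K" "K \<le> n" and C: "C \<notin> {0, xI, xJ, xC, xL, xA, xF, xG}"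
    and S: "S < 16" "S \<noteq> aZ" and F: "represents s F"
  shows "triple (apply_to S C) s (n ^ 4 * 900) (\<lambda>t. \<forall>a<n. \<forall>b<n. \<forall>d<K.
    ar t S (a, b, d) = ((\<Sum>l<n. ar s aB (a, b, l) * ar s S (l, l, d)) +
      (\<Sum>p\<in>{..<n} \<times> {..<n}. of_bool (F p = Some (a, b)) * ar s S (fst p, snd p, d))) mod W)"
proof -
  have "triple (apply_to S C) s (n ^ 4 * 300 + (n ^ 4 * 300 + n ^ 4 * 300)) (\<lambda>t. \<forall>a<n. \<forall>b<n. \<forall>d<K.
    ar t S (a, b, d) = ((\<Sum>l<n. ar s aB (a, b, l) * ar s S (l, l, d)) +
      (\<Sum>p\<in>{..<n} \<times> {..<n}. of_bool (F p = Some (a, b)) * ar s S (fst p, snd p, d))) mod W)"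
    unfolding apply_to_def
  proof (rule triple_Seq[OF triple_accumulate[OF s] triple_Seq[OF triple_scatter triple_mono[OF triple_copy_back]]])
    fix t1
    assume ag1: "agree (var_writes (accumulate S C)) (arr_writes (accumulate S C)) s t1"
      and t1: "\<forall>a<n. \<forall>b<n. \<forall>d<K. ar t1 aZ (a, b, d) = (\<Sum>l<n. ar s aB (a, b, l) * ar s S (l, l, d)) mod W"
    show 1: "vr t1 xN = n" "vr t1 C = K"
      using agree_vr[OF ag1, of xN] agree_vr[OF ag1, of C] s C by auto
    have arr: "ar t1 S = ar s S" "ar t1 aFU = ar s aFU" "ar t1 aFV = ar s aFV"
      using agree_ar[OF ag1, of S] agree_ar[OF ag1, of aFU] agree_ar[OF ag1, of aFV] S by auto
    show "represents t1 F" using F by (simp add: represents_def arr)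
    show "\<forall>a<n. \<forall>b<n. \<forall>d<K. ar t1 aZ (a, b, d) < W" using t1 by simp
    fix t2
    assume ag2: "agree (var_writes (scatter S C)) (arr_writes (scatter S C)) t1 t2"
      and t2: "\<forall>a<n. \<forall>b<n. \<forall>d<K. ar t2 aZ (a, b, d) = (ar t1 aZ (a, b, d) +
        (\<Sum>p\<in>{..<n} \<times> {..<n}. of_bool (F p = Some (a, b)) * ar t1 S (fst p, snd p, d))) mod W"
    show "vr t2 xN = n" "vr t2 C = K"
      using agree_vr[OF ag2, of xN] agree_vr[OF ag2, of C] 1 C by auto
    show "\<forall>a<n. \<forall>b<n. \<forall>d<K. ar t S (a, b, d) = ((\<Sum>l<n. ar s aB (a, b, l) * ar s S (l, l, d)) +
      (\<Sum>p\<in>{..<n} \<times> {..<n}. of_bool (F p = Some (a, b)) * ar s S (fst p, snd p, d))) mod W"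
      if "\<forall>a<n. \<forall>b<n. \<forall>d<K. ar t S (a, b, d) = ar t2 aZ (a, b, d)" for t
      using that t1 t2 arr by (simp add: mod_simps)
  qed (use s C S in auto)
  then show ?thesis by (rule triple_weaken) simp
qed

lemma triple_square_pred:
  assumes s: "vr s xN = n" and F: "represents s F"
  shows "triple square_pred s (n ^ 4 * 500) (\<lambda>t. represents t (\<lambda>p. Option.bind (F p) F))"
proof -
  let ?G = "\<lambda>p. Option.bind (F p) F"
  let ?rep = "\<lambda>f g p q t. encodes (ar t f (p, q, 0)) (ar t g (p, q, 0)) (?G (p, q))"
  have "triple square_pred s (n ^ 2 * (100 + 80) + n ^ 2 * (100 + 80)) (\<lambda>t. represents t ?G)"
    unfolding square_pred_def
  proof (rule triple_Seq[where R = "\<lambda>t. \<forall>(p, q) \<in> {..<n} \<times> {..<n}. ?rep aGU aGV p q t"])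
    show "triple (For xI xN (For xJ xN (
       Assign xF (Arr aFU (Var xI) (Var xJ) (Lit 0)) ;;
       Ite (Var xF)
         (Assign xG (Arr aFV (Var xI) (Var xJ) (Lit 0)) ;;
          Assign xF (Var xF [-] Lit 1) ;;
          AStore aGU (Var xI) (Var xJ) (Lit 0) (Arr aFU (Var xF) (Var xG) (Lit 0)) ;;
          AStore aGV (Var xI) (Var xJ) (Lit 0) (Arr aFV (Var xF) (Var xG) (Lit 0)))
         (AStore aGU (Var xI) (Var xJ) (Lit 0) (Lit 0))))) s (n ^ 2 * (100 + 80))
        ((\<lambda>D t. \<forall>(p, q) \<in> D. ?rep aGU aGV p q t) ({..<n} \<times> {..<n}))"
    proof (rule triple_For2, goal_cases)
      case (10 D p q t)
      note ag = \<open>agree _ _ s t\<close>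
      have t: "ar t aFU = ar s aFU" "ar t aFV = ar s aFV"
        using agree_ar[OF ag, of aFU] agree_ar[OF ag, of aFV] by auto
      show ?case using F \<open>p < n\<close> \<open>q < n\<close>
      proof (cases rule: represents_cases)
        case 1
        then show ?thesis using 10 t by (auto simp: triple_def encodes_def)
      next
        case (2 u v)
        have sub: "(Suc u + W - Suc 0) mod W = u"
          using sub_mod[of 1 "Suc u"] W_gt 2 by simp
        show ?thesis using F \<open>u < n\<close> \<open>v < n\<close>
        proof (cases rule: represents_cases)
          case 1
          then show ?thesis using 10 t 2 sub by (auto simp: triple_def encodes_def)
        next
          case (2 u' v')
          then show ?thesis using 10 t n_pos \<open>F (p, q) = Some (u, v)\<close> sub
            \<open>ar s aFU (p, q, 0) = Suc u\<close> \<open>ar s aFV (p, q, 0) = v\<close> \<open>u < n\<close> \<open>v < n\<close> by (auto simp: triple_def encodes_def)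
        qed
      qed
    qed (use s in auto)
    fix t
    assume "agree (var_writes (For xI xN (For xJ xN (
       Assign xF (Arr aFU (Var xI) (Var xJ) (Lit 0)) ;;
       Ite (Var xF)
         (Assign xG (Arr aFV (Var xI) (Var xJ) (Lit 0)) ;;
          Assign xF (Var xF [-] Lit 1) ;;
          AStore aGU (Var xI) (Var xJ) (Lit 0) (Arr aFU (Var xF) (Var xG) (Lit 0)) ;;
          AStore aGV (Var xI) (Var xJ) (Lit 0) (Arr aFV (Var xF) (Var xG) (Lit 0)))
         (AStore aGU (Var xI) (Var xJ) (Lit 0) (Lit 0)))))) (arr_writes (For xI xN (For xJ xN (
       Assign xF (Arr aFU (Var xI) (Var xJ) (Lit 0)) ;;
       Ite (Var xF)
         (Assign xG (Arr aFV (Var xI) (Var xJ) (Lit 0)) ;;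
          Assign xF (Var xF [-] Lit 1) ;;
          AStore aGU (Var xI) (Var xJ) (Lit 0) (Arr aFU (Var xF) (Var xG) (Lit 0)) ;;
          AStore aGV (Var xI) (Var xJ) (Lit 0) (Arr aFV (Var xF) (Var xG) (Lit 0)))
         (AStore aGU (Var xI) (Var xJ) (Lit 0) (Lit 0)))))) s t"
      and t: "\<forall>(p, q) \<in> {..<n} \<times> {..<n}. ?rep aGU aGV p q t"
    then have N: "vr t xN = n" using s by (simp add: agree_def)
    have "triple (For xI xN (For xJ xN (
        AStore aFU (Var xI) (Var xJ) (Lit 0) (Arr aGU (Var xI) (Var xJ) (Lit 0)) ;;
        AStore aFV (Var xI) (Var xJ) (Lit 0) (Arr aGV (Var xI) (Var xJ) (Lit 0))))) t (n ^ 2 * (100 + 80))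
        ((\<lambda>D u. \<forall>(p, q) \<in> D. ?rep aFU aFV p q u) ({..<n} \<times> {..<n}))"
    proof (rule triple_For2, goal_cases)
      case (10 D p q u)
      note ag = \<open>agree _ _ t u\<close>
      have u: "ar u aGU = ar t aGU" "ar u aGV = ar t aGV"
        using agree_ar[OF ag, of aGU] agree_ar[OF ag, of aGV] by auto
      have "?rep aGU aGV p q t" using t \<open>p < n\<close> \<open>q < n\<close> by auto
      then show ?case using 10 u n_pos by (auto simp: triple_def)
    qed (use N in auto)
    then show "triple (For xI xN (For xJ xN (
        AStore aFU (Var xI) (Var xJ) (Lit 0) (Arr aGU (Var xI) (Var xJ) (Lit 0)) ;;
        AStore aFV (Var xI) (Var xJ) (Lit 0) (Arr aGV (Var xI) (Var xJ) (Lit 0))))) t (n ^ 2 * (100 + 80)) (\<lambda>t. represents t ?G)"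
      by (rule triple_mono) (auto simp: represents_def)
  qed
  moreover have "n ^ 2 * (100 + 80) + n ^ 2 * (100 + 80) \<le> n ^ 4 * 500"
  proof -
    have "n ^ 2 * (100 + 80) + n ^ 2 * (100 + 80) = n ^ 2 * 360" by simp
    also have "\<dots> \<le> n ^ 4 * 500" using n_powers by linarith
    finally show ?thesis .
  qed
  ultimately show ?thesis by (rule triple_weaken)
qed

end

section \<open>The phases of the main program\<close>

definition read_sizes :: com where
  "read_sizes = (Assign xN (Inp (Lit 0)) ;; Assign xM (Inp (Lit 1)) ;; Assign xK (Inp (Lit 2)) ;; Assign xOne (Lit 1))"

text \<open>Inverts the permutation \<open>vs\<close>, since all later arrays are indexed by ranks.
  One-dimensional arrays keep their other indices at 0.\<close>

definition read_order :: com where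
  "read_order = For xI xN (AStore aPos (Inp (Lit 3 [+] Var xI)) (Lit 0) (Lit 0) (Var xI))"

text \<open>The label is stored at the target alone, because by \<open>label_unique\<close> all
  edges into a vertex share it.\<close>

definition read_edges :: com where
  "read_edges = For xE xM (
     Assign xA (Lit 3 [+] Var xN [+] Lit 3 [*] Var xE) ;;
     Assign xF (Arr aPos (Inp (Var xA)) (Lit 0) (Lit 0)) ;;
     Assign xG (Arr aPos (Inp (Var xA [+] Lit 1)) (Lit 0) (Lit 0)) ;;
     AStore aAdj (Var xF) (Var xG) (Lit 0) (Lit 1) ;;
     AStore aLab (Var xG) (Lit 0) (Lit 0) (Inp (Var xA [+] Lit 2)))"

text \<open>\<open>xP\<close> is the last source seen plus one, or zero. Meeting source
  \<open>i\<close> contributes the pair \<open>(i, i)\<close> and, if there is an earlier source,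
  the pair formed by the latest of these and \<open>i\<close>. The first and last source are
  recorded for \<open>find_pred\<close>, also shifted by one.\<close>

definition scan_sources :: com where
  "scan_sources = For xJ xN (
     Assign xP (Lit 0) ;;
     For xI xN (Ite (Arr aAdj (Var xI) (Var xJ) (Lit 0))
       (AStore aB (Var xI) (Var xI) (Var xJ) (Lit 1) ;;
        Ite (Var xP) (AStore aB (Var xP [-] Lit 1) (Var xI) (Var xJ) (Lit 1))
          (AStore aFirst (Var xJ) (Lit 0) (Lit 0) (Var xI [+] Lit 1)) ;;
        Assign xP (Var xI [+] Lit 1))
       skip) ;;
     AStore aLast (Var xJ) (Lit 0) (Lit 0) (Var xP))"

text \<open>\<open>aFirst\<close> doubles as the test for having a source. \<open>aLast\<close>
  already has the shift by one that \<open>aFU\<close> expects, whereas \<open>aFV\<close> is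
  unshifted.\<close>

definition find_pred :: com where
  "find_pred = For xI xN (For xJ xN (
     Ite (Bin Lt (Var xI) (Var xJ)) (
     Ite (Arr aFirst (Var xI) (Lit 0) (Lit 0)) (
     Ite (Arr aFirst (Var xJ) (Lit 0) (Lit 0)) (
     Ite (Bin Eq (Arr aLab (Var xI) (Lit 0) (Lit 0)) (Arr aLab (Var xJ) (Lit 0) (Lit 0)))
       (AStore aFU (Var xI) (Var xJ) (Lit 0) (Arr aLast (Var xI) (Lit 0) (Lit 0)) ;;
        AStore aFV (Var xI) (Var xJ) (Lit 0) (Arr aFirst (Var xJ) (Lit 0) (Lit 0) [-] Lit 1))
     skip) skip) skip) skip))"

definition init_counts :: com where
  "init_counts = For xI xN (For xJ xN (
     Ite (Bin Lt (Var xJ) (Var xI)) skip (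
     Ite (Bin Lt (Var xI [+] Lit 1) (Var xJ)) skip
       (AStore aY (Var xI) (Var xJ) (Lit 0) (Lit 1)))))"

text \<open>The order matters: \<open>aY\<close> needs the power before squaring, and
  \<open>apply_to aB\<close> needs the predecessor function before \<open>square_pred\<close>
  replaces it. The vector of counts is a matrix with one column, hence the bound
  \<open>xOne\<close>.\<close>

definition double :: com where
  "double = (
     Ite (Bin Mod (Var xK) (Lit 2)) (apply_to aY xOne) skip ;;
     apply_to aB xN ;; square_pred ;; Assign xK (Bin Div (Var xK) (Lit 2)))"

definition add_up :: com where
  "add_up = For xI xN (For xJ xN (
     Ite (Bin Eq (Var xI) (Var xJ)) (Assign xOut (Var xOut [+] Arr aY (Var xI) (Var xJ) (Lit 0))) (
     Ite (Bin Lt (Var xI) (Var xJ)) (Assign xOut (Var xOut [-] Arr aY (Var xI) (Var xJ) (Lit 0)))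
     skip)))"

definition main :: com where
  "main = (read_sizes ;; read_order ;; read_edges ;; scan_sources ;; find_pred ;; init_counts ;;
     While (Var xK) double ;; add_up)"

lemma var_writes_main [simp]:
  "var_writes read_sizes = {xN, xM, xK, xOne}"
  "var_writes read_order = {xI}"
  "var_writes read_edges = {xE, xA, xF, xG}"
  "var_writes scan_sources = {0, xJ, xP, xI}"
  "var_writes find_pred = {0, xI, xJ}"
  "var_writes init_counts = {0, xI, xJ}"
  "var_writes double = {0, xI, xJ, xC, xA, xL, xF, xG, xK}"
  by (auto simp: read_sizes_def read_order_def read_edges_def scan_sources_def find_pred_def
      init_counts_def double_def)

lemma arr_writes_main [simp]:
  "arr_writes read_sizes = {}"
  "arr_writes read_order = {aPos}"
  "arr_writes read_edges = {aAdj, aLab}"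
  "arr_writes scan_sources = {aB, aFirst, aLast}"
  "arr_writes find_pred = {aFU, aFV}"
  "arr_writes init_counts = {aY}"
  "arr_writes double = {aZ, aY, aB, aGU, aGV, aFU, aFV}"
  by (auto simp: read_sizes_def read_order_def read_edges_def scan_sources_def find_pred_def
      init_counts_def double_def)

lemma nth_concat_triples:
  "e < length es \<Longrightarrow> concat (map (\<lambda>(u, v, a). [u, v, a]) es) ! (3 * e) = fst (es ! e) \<and>
     concat (map (\<lambda>(u, v, a). [u, v, a]) es) ! (3 * e + 1) = fst (snd (es ! e)) \<and>
     concat (map (\<lambda>(u, v, a). [u, v, a]) es) ! (3 * e + 2) = snd (snd (es ! e))"
proof (induction es arbitrary: e)
  case (Cons x es)
  then show ?case
  proof (cases e)
    case 0
    then show ?thesis by (simp add: case_prod_beta numeral_2_eq_2)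
  next
    case (Suc e')
    have "3 * e = Suc (Suc (Suc (3 * e')))" using Suc by simp
    then show ?thesis using Cons Suc by (simp add: case_prod_beta)
  qed
qed simp

lemma length_concat_triples: "length (concat (map (\<lambda>(u, v, a). [u, v, a]) es)) = 3 * length es"
  by (induction es) auto

lemma encode_input_nth:
  assumes "length vs = n" "length es = m"
  shows "length (encode_input k vs es) = 3 + n + 3 * m"
    "encode_input k vs es ! 0 = n" "encode_input k vs es ! 1 = m" "encode_input k vs es ! 2 = k"
    "i < n \<Longrightarrow> encode_input k vs es ! (3 + i) = vs ! i"
    "e < m \<Longrightarrow> encode_input k vs es ! (3 + n + 3 * e) = fst (es ! e)"
    "e < m \<Longrightarrow> encode_input k vs es ! (3 + n + 3 * e + 1) = fst (snd (es ! e))"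
    "e < m \<Longrightarrow> encode_input k vs es ! (3 + n + 3 * e + 2) = snd (snd (es ! e))"
proof -
  show "length (encode_input k vs es) = 3 + n + 3 * m"
    using assms by (simp add: encode_input_def length_concat_triples)
  show "encode_input k vs es ! 0 = n" "encode_input k vs es ! 1 = m" "encode_input k vs es ! 2 = k"
    using assms by (simp_all add: encode_input_def)
  have split: "encode_input k vs es ! (3 + i) = (vs @ concat (map (\<lambda>(u, v, a). [u, v, a]) es)) ! i" for i
    by (simp add: encode_input_def eval_nat_numeral)
  show "i < n \<Longrightarrow> encode_input k vs es ! (3 + i) = vs ! i"
    using assms by (simp only: split) (simp add: nth_append)
  have edge: "encode_input k vs es ! (3 + n + j) = concat (map (\<lambda>(u, v, a). [u, v, a]) es) ! j" for j
    using assms by (simp only: split add.assoc) (simp add: nth_append)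
  show "e < m \<Longrightarrow> encode_input k vs es ! (3 + n + 3 * e) = fst (es ! e)"
    "e < m \<Longrightarrow> encode_input k vs es ! (3 + n + 3 * e + 1) = fst (snd (es ! e))"
    "e < m \<Longrightarrow> encode_input k vs es ! (3 + n + 3 * e + 2) = snd (snd (es ! e))"
    using assms(2) nth_concat_triples[of e es] edge[of "3 * e"] edge[of "3 * e + 1"] edge[of "3 * e + 2"]
    by (simp_all only: add.assoc)
qed

text \<open>\<open>es\<close> uses vertex names and \<open>E\<close> ranks; \<open>es_E\<close>
  translates between them. The bound on \<open>m\<close> keeps the pass over the edges within
  \<open>n ^ 2\<close> iterations.\<close>

locale encoded = word_ram w n xs + wheeler_positions n \<Sigma> E
  for w n :: nat and xs and \<Sigma> :: "nat set" and E :: "(nat \<times> nat \<times> nat) set" +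
  fixes k m :: nat and vs :: "nat list" and es :: "(nat \<times> nat \<times> nat) list"
  assumes xs: "xs = encode_input k vs es"
    and len: "length vs = n" "length es = m"
    and vs: "distinct vs" "set vs = {..<n}"
    and es_vertices: "(u, v, a) \<in> set es \<Longrightarrow> u < n \<and> v < n"
    and es_E: "i < n \<Longrightarrow> j < n \<Longrightarrow> (vs ! i, vs ! j, a) \<in> set es \<longleftrightarrow> (i, j, a) \<in> E"
    and m_le: "m \<le> n ^ 2"
begin

section \<open>Correctness of the input phases\<close>

lemmas xs_nth = encode_input_nth[OF len, where k = k, folded xs]

lemma length_less: "length xs < W"
proof -
  have "1 \<le> n ^ 3" using n_pos by simp
  then show ?thesis using fits by linarith
qed

lemma idx_mod: "i < length xs \<Longrightarrow> i mod W = i"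
  using length_less by simp

lemma vs_less: "i < n \<Longrightarrow> vs ! i < n"
  using vs(2) len(1) by (metis lessThan_iff nth_mem)

lemma vs_surj: "u < n \<Longrightarrow> \<exists>i<n. vs ! i = u"
  using vs(2) len(1) by (metis in_set_conv_nth lessThan_iff)

lemma triple_read_sizes:
  "triple read_sizes s (n ^ 4 * 50) (\<lambda>t. vr t xN = n \<and> vr t xM = m \<and> vr t xK = k \<and> vr t xOne = 1)"
proof -
  have "11 \<le> n ^ 4 * 50" using n_powers by linarith
  then show ?thesis
    using xs_nth by (auto simp: read_sizes_def triple_def)
qed

lemma triple_read_order:
  assumes "vr s xN = n"
  shows "triple read_order s (n ^ 4 * 100) (\<lambda>t. \<forall>i<n. ar t aPos (vs ! i, 0, 0) = i)"
proof -
  have 1: "triple read_order s (n * (20 + 40)) ((\<lambda>S t. \<forall>i\<in>S. ar t aPos (vs ! i, 0, 0) = i) {..<n})"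
    unfolding read_order_def
  proof (rule triple_For, goal_cases)
    case (10 S i t)
    have "(3 + i) mod W = 3 + i" using idx_mod[of "3 + i"] 10 xs_nth(1) by simp
    moreover have "vs ! j \<noteq> vs ! i" if "j \<in> S" for j
      using that 10 vs(1) len by (auto simp: nth_eq_iff_index_eq)
    ultimately show ?case
      using 10 xs_nth(1) xs_nth(5)[of i] vs_less[of i] by (auto simp: triple_def)
  qed (use assms W_gt n_pos in auto)
  have "n * (20 + 40) = n * 60" by simp
  also have "\<dots> \<le> n ^ 4 * 100" using n_powers by linarith
  finally have "n * (20 + 40) \<le> n ^ 4 * 100" .
  from triple_mono[OF 1 this] show ?thesis by simp
qed

text \<open>A later edge into the same target overwrites \<open>aLab\<close> with the same value,
  and adjacency entries are only ever set to 1; so the invariant can be indexed by the set of edge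
  numbers.\<close>

lemma triple_read_edges:
  assumes s: "vr s xN = n" "vr s xM = m" "\<forall>i<n. ar s aPos (vs ! i, 0, 0) = i"
    and zero: "\<forall>i<n. \<forall>j<n. ar s aAdj (i, j, 0) = 0"
  shows "triple read_edges s (n ^ 4 * 150) (\<lambda>t.
    (\<forall>i<n. \<forall>j<n. ar t aAdj (i, j, 0) = of_bool (i \<in> sources j)) \<and>
    (\<forall>j<n. sources j \<noteq> {} \<longrightarrow> ar t aLab (j, 0, 0) = label j))"
proof -
  let ?I = "\<lambda>S t. (\<forall>i<n. \<forall>j<n. ar t aAdj (i, j, 0) = of_bool (\<exists>e\<in>S. \<exists>a. es ! e = (vs ! i, vs ! j, a))) \<and>
    (\<forall>j<n. \<forall>e\<in>S. fst (snd (es ! e)) = vs ! j \<longrightarrow> ar t aLab (j, 0, 0) = label j)"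
  have "m < W" using xs_nth(1) length_less by linarith
  \<comment> \<open>The loop runs \<open>m\<close> times, but \<open>L\<close> is taken as
    \<open>n ^ 2\<close>, which is at least 1 even without edges.\<close>
  then have 1: "triple read_edges s (n ^ 2 * (100 + 40)) (?I {..<m})"
    unfolding read_edges_def
  proof (intro triple_For[where I = ?I], goal_cases)
    case (10 S e t)
    note ag = \<open>agree _ _ s t\<close>
    have t: "vr t xN = n" "ar t aPos = ar s aPos"
      using agree_vr[OF ag, of xN] agree_ar[OF ag, of aPos] s by auto
    obtain u v a where e: "es ! e = (u, v, a)" by (cases "es ! e")
    then have uv: "(u, v, a) \<in> set es" using \<open>e < m\<close> len(2) by (metis nth_mem)
    then obtain i j where ij: "i < n" "j < n" "u = vs ! i" "v = vs ! j"
      using vs_surj es_vertices by metis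
    have E: "(i, j, a) \<in> E" using uv ij es_E by simp
    have lab: "label j = a" using label_eq[OF E] .
    have inj: "vs ! i' = vs ! j' \<longleftrightarrow> i' = j'" if "i' < n" "j' < n" for i' j'
      using that vs(1) len by (auto simp: nth_eq_iff_index_eq)
    define A where "A = 3 + n + 3 * e"
    have A_lt: "A < length xs" "Suc A < length xs" "Suc (Suc A) < length xs"
      using \<open>e < m\<close> xs_nth(1) by (simp_all add: A_def)
    have "((3 + n) mod W + 3 * e mod W) mod W = A mod W" by (simp add: mod_simps A_def)
    then have idx: "((3 + n) mod W + 3 * e mod W) mod W = A" "Suc A mod W = Suc A"
      "Suc (Suc A) mod W = Suc (Suc A)"
      using A_lt by (simp_all only: idx_mod)
    have nth: "xs ! A = u" "xs ! Suc A = v" "xs ! Suc (Suc A) = a"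
      using xs_nth(6-8)[OF \<open>e < m\<close>] by (simp_all add: A_def e)
    have pos: "ar s aPos (u, 0, 0) = i" "ar s aPos (v, 0, 0) = j" "u < n" "v < n"
      using s(3) ij vs_less by auto
    have I: "?I S t" and e_lt: "e < m" "vr t xE = e" using 10 by auto
    show ?case
    proof (rule triple_mono[where Q = "\<lambda>u. ar u aAdj = (ar t aAdj)((i, j, 0) := 1) \<and>
        ar u aLab = (ar t aLab)((j, 0, 0) := a)" and T = 100])
      show "triple (Assign xA (Lit 3 [+] Var xN [+] Lit 3 [*] Var xE) ;;
         Assign xF (Arr aPos (Inp (Var xA)) (Lit 0) (Lit 0)) ;;
         Assign xG (Arr aPos (Inp (Var xA [+] Lit 1)) (Lit 0) (Lit 0)) ;;
         AStore aAdj (Var xF) (Var xG) (Lit 0) (Lit 1) ;;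
         AStore aLab (Var xG) (Lit 0) (Lit 0) (Inp (Var xA [+] Lit 2))) t 100
         (\<lambda>u. ar u aAdj = (ar t aAdj)((i, j, 0) := 1) \<and> ar u aLab = (ar t aLab)((j, 0, 0) := a))"
        using t e_lt pos idx nth A_lt ij(1,2) by (simp add: triple_def)
      fix u
      assume u: "ar u aAdj = (ar t aAdj)((i, j, 0) := 1) \<and> ar u aLab = (ar t aLab)((j, 0, 0) := a)"
      show "?I (insert e S) u"
      proof (intro conjI allI impI ballI)
        fix i' j'
        assume "i' < n" "j' < n"
        then have "(\<exists>a'. es ! e = (vs ! i', vs ! j', a')) \<longleftrightarrow> i' = i \<and> j' = j"
          using inj ij e by auto
        then show "ar u aAdj (i', j', 0) = of_bool (\<exists>e\<in>insert e S. \<exists>a. es ! e = (vs ! i', vs ! j', a))"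
          using I u \<open>i' < n\<close> \<open>j' < n\<close> by auto
      next
        fix j' e'
        assume *: "j' < n" "e' \<in> insert e S" "fst (snd (es ! e')) = vs ! j'"
        show "ar u aLab (j', 0, 0) = label j'"
        proof (cases "j' = j")
          case True
          then show ?thesis using u lab by simp
        next
          case False
          then have "e' \<noteq> e" using * inj[OF \<open>j' < n\<close> \<open>j < n\<close>] e ij by auto
          then show ?thesis using I u * False by auto
        qed
      qed
    qed simp
  qed (use s zero W_gt n_pos m_le in auto)
  have 2: "?I {..<m} t \<Longrightarrow> (\<forall>i<n. \<forall>j<n. ar t aAdj (i, j, 0) = of_bool (i \<in> sources j)) \<and>
    (\<forall>j<n. sources j \<noteq> {} \<longrightarrow> ar t aLab (j, 0, 0) = label j)" for t
  proof (intro conjI allI impI)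
    fix i j
    assume I: "?I {..<m} t" and ij: "i < n" "j < n"
    have "i \<in> sources j \<longleftrightarrow> (\<exists>e\<in>{..<m}. \<exists>a. es ! e = (vs ! i, vs ! j, a))"
      using es_E[OF ij] len(2) by (fastforce simp: sources_def in_set_conv_nth)
    then show "ar t aAdj (i, j, 0) = of_bool (i \<in> sources j)" using I ij by simp
  next
    fix j
    assume I: "?I {..<m} t" and j: "j < n" "sources j \<noteq> {}"
    then obtain i a where "(i, j, a) \<in> E" by (auto simp: sources_def)
    then have "(vs ! i, vs ! j, a) \<in> set es" using es_E edges by blast
    then obtain e where "e < m" "es ! e = (vs ! i, vs ! j, a)" using len(2) by (auto simp: in_set_conv_nth)
    then have "\<exists>e\<in>{..<m}. fst (snd (es ! e)) = vs ! j" by force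
    then show "ar t aLab (j, 0, 0) = label j" using I j by blast
  qed
  have "n ^ 2 * (100 + 40) = n ^ 2 * 140" by simp
  also have "\<dots> \<le> n ^ 4 * 150" using n_powers by linarith
  finally have "n ^ 2 * (100 + 40) \<le> n ^ 4 * 150" .
  then show ?thesis by (rule triple_mono[OF 1]) (rule 2)
qed

lemma sources_less: "u \<in> sources v \<Longrightarrow> u < n"
  unfolding sources_def using edges by blast

text \<open>The content of \<open>xP\<close> once the sources in \<open>A\<close> have been
  scanned.\<close>

definition last_enc :: "nat set \<Rightarrow> nat" where
  "last_enc A = (if A = {} then 0 else Suc (Max A))"

definition first_enc :: "nat set \<Rightarrow> nat" where
  "first_enc A = (if A = {} then 0 else Suc (Min A))"

lemma enc_insert:
  assumes "A \<subseteq> {..<i}"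
  shows "last_enc (insert i A) = Suc i" "first_enc (insert i A) = (if A = {} then Suc i else first_enc A)"
proof -
  have fin: "finite A" using assms finite_subset by blast
  have "Max (insert i A) = i" using assms fin by (intro Max_eqI) auto
  then show "last_enc (insert i A) = Suc i" by (simp add: last_enc_def)
  have "Min (insert i A) = Min A" if "A \<noteq> {}"
  proof -
    have "Min A < i" using Min_in[OF fin that] assms by blast
    then have "min i (Min A) = Min A" by linarith
    then show ?thesis by (simp only: Min_insert[OF fin that])
  qed
  then show "first_enc (insert i A) = (if A = {} then Suc i else first_enc A)"
    by (simp add: first_enc_def)
qed

text \<open>No source may lie strictly between the two components, so next to \<open>i\<close>
  itself only the preceding source qualifies. These are the two entries that
  \<open>scan_sources\<close> writes on meeting \<open>i\<close>.\<close>

lemma link_source: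
  assumes "i \<in> sources p"
  shows "link (u, i) (p, p) \<longleftrightarrow> u = i \<or> Suc u = last_enc (sources p \<inter> {..<i})"
proof (cases "u < i")
  case True
  let ?A = "sources p \<inter> {..<i}"
  have "(\<forall>x. u < x \<and> x < i \<longrightarrow> x \<notin> sources p) \<longleftrightarrow> (\<forall>x\<in>?A. x \<le> u)"
    by (meson IntD1 IntD2 IntI lessThan_iff not_le)
  then have "link (u, i) (p, p) \<longleftrightarrow> u \<in> ?A \<and> (\<forall>x\<in>?A. x \<le> u)"
    using True assms by (auto simp: link_diag)
  also have "\<dots> \<longleftrightarrow> ?A \<noteq> {} \<and> Max ?A = u"
    using Max_eq_iff[of ?A u] by auto
  finally show ?thesis using True by (auto simp: last_enc_def)
next
  case False
  have "Suc u \<noteq> last_enc (sources p \<inter> {..<i})"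
  proof
    let ?A = "sources p \<inter> {..<i}"
    assume u: "Suc u = last_enc ?A"
    then have "?A \<noteq> {}" "u = Max ?A" by (auto simp: last_enc_def split: if_splits)
    then have "u \<in> ?A" using Max_in[of ?A] by simp
    then show False using False by simp
  qed
  then show ?thesis using False assms by (auto simp: link_diag)
qed

lemma link_not_source: "v \<notin> sources p \<Longrightarrow> \<not> link (u, v) (p, p)"
  by (simp add: link_diag)

lemma triple_scan_sources:
  assumes s: "vr s xN = n" "\<forall>i<n. \<forall>j<n. ar s aAdj (i, j, 0) = of_bool (i \<in> sources j)"
    and zero: "\<forall>u<n. \<forall>v<n. \<forall>p<n. ar s aB (u, v, p) = 0" "\<forall>p<n. ar s aFirst (p, 0, 0) = 0"
  shows "triple scan_sources s (n ^ 4 * 400) (\<lambda>t. \<forall>p<n.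
    (\<forall>u<n. \<forall>v<n. ar t aB (u, v, p) = of_bool (link (u, v) (p, p))) \<and>
    ar t aFirst (p, 0, 0) = first_enc (sources p) \<and> ar t aLast (p, 0, 0) = last_enc (sources p))"
proof -
  let ?I = "\<lambda>S t. \<forall>p<n.
    (\<forall>u<n. \<forall>v<n. ar t aB (u, v, p) = of_bool (p \<in> S \<and> link (u, v) (p, p))) \<and>
    ar t aFirst (p, 0, 0) = (if p \<in> S then first_enc (sources p) else 0) \<and>
    (p \<in> S \<longrightarrow> ar t aLast (p, 0, 0) = last_enc (sources p))"
  let ?body = "Ite (Arr aAdj (Var xI) (Var xJ) (Lit 0))
       (AStore aB (Var xI) (Var xI) (Var xJ) (Lit 1) ;;
        Ite (Var xP) (AStore aB (Var xP [-] Lit 1) (Var xI) (Var xJ) (Lit 1))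
          (AStore aFirst (Var xJ) (Lit 0) (Lit 0) (Var xI [+] Lit 1)) ;;
        Assign xP (Var xI [+] Lit 1))
       skip"
  have 1: "triple scan_sources s (n * ((2 + (n * (100 + 40) + 14)) + 40)) (?I {..<n})"
    unfolding scan_sources_def
  proof (rule triple_For[where I = ?I], goal_cases)
    case (10 S p t)
    note ag = \<open>agree _ _ s t\<close>
    have t: "vr t xN = n" "ar t aAdj = ar s aAdj"
      using agree_vr[OF ag, of xN] agree_ar[OF ag, of aAdj] s by auto
    have I: "?I S t" and p: "p < n" "p \<notin> S" "vr t xJ = p" using 10 by auto
    let ?t1 = "t\<lparr>vr := (vr t)(xP := 0)\<rparr>"
    \<comment> \<open>An entry is written when the scan reaches its second, larger component
      \<open>b\<close>; in column \<open>p\<close> the entries with \<open>b\<close> outside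
      \<open>L\<close> are therefore still zero.\<close>
    let ?J = "\<lambda>L u. vr u xP = last_enc (sources p \<inter> L) \<and>
      (\<forall>q<n. (\<forall>a<n. \<forall>b<n. ar u aB (a, b, q) = of_bool (q \<in> S \<and> link (a, b) (q, q) \<or> q = p \<and> b \<in> L \<and> link (a, b) (p, p))) \<and>
        ar u aFirst (q, 0, 0) = (if q \<in> S then first_enc (sources q) else if q = p then first_enc (sources p \<inter> L) else 0))"
    show ?case
    proof (rule triple_Seq[where R = "\<lambda>u. u = ?t1", OF _ triple_Seq[where R = "?J {..<n}"]])
      fix t1
      assume t1: "t1 = ?t1"
      show "triple (For xI xN ?body) t1 (n * (100 + 40)) (?J {..<n})"
      proof (rule triple_For[where I = ?J], goal_cases)
        case (10 L i u)
        note ag' = \<open>agree _ _ t1 u\<close>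
        have u: "vr u xJ = p" "ar u aAdj = ar s aAdj" "vr u xI = i" "i < n"
          using agree_vr[OF ag', of xJ] agree_ar[OF ag', of aAdj] t t1 p 10 by auto
        have J: "?J L u" and L: "L = {..<i}" using 10 by auto
        show ?case
        proof (cases "i \<in> sources p")
          case False
          then have "sources p \<inter> insert i L = sources p \<inter> L" by auto
          then have "?J (insert i L) u" using J link_not_source[OF False] by auto
          then show ?thesis using u p s False by (simp add: triple_def)
        next
          case True
          let ?A = "sources p \<inter> L"
          have ins: "sources p \<inter> insert i L = insert i ?A" using True by auto
          note enc = enc_insert[of ?A i, folded ins]
          have A: "?A \<subseteq> {..<i}" using L by auto
          have inc: "Suc i mod W = Suc i" using u W_gt by simp
          show ?thesis
          proof (cases "?A = {}")
            case True2: True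
            have "vr u xP = 0" using J True2 by (simp add: last_enc_def)
            have lnk: "link (a, i) (p, p) \<longleftrightarrow> a = i" for a
              using link_source[OF True] True2 L by (simp add: last_enc_def)
            have "triple ?body u 100 (\<lambda>u'. vr u' xP = Suc i \<and> ar u' aB = (ar u aB)((i, i, p) := 1) \<and>
              ar u' aFirst = (ar u aFirst)((p, 0, 0) := Suc i))"
              using u p s True \<open>vr u xP = 0\<close> inc by (simp add: triple_def)
            then show ?thesis
              by (rule triple_mono) (use J lnk enc[OF A] True2 p in \<open>auto\<close>)
          next
            case False
            define M where "M = Max ?A"
            have P: "vr u xP = Suc M" using J False by (simp add: last_enc_def M_def)
            have "M \<in> ?A" using Max_in[of ?A] False by (simp add: M_def)
            then have M: "M < i" using L by auto
            have sub: "(Suc M + W - Suc 0) mod W = M"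
              using sub_mod[of 1 "Suc M"] M u W_gt by simp
            have lnk: "link (a, i) (p, p) \<longleftrightarrow> a = i \<or> a = M" for a
              using link_source[OF True] False L by (simp add: last_enc_def M_def)
            have "triple ?body u 100 (\<lambda>u'. vr u' xP = Suc i \<and> ar u' aB = (ar u aB)((i, i, p) := 1, (M, i, p) := 1) \<and>
              ar u' aFirst = ar u aFirst)"
              using u p s True P inc M sub by (simp add: triple_def)
            then show ?thesis
              by (rule triple_mono) (use J lnk enc[OF A] False p in \<open>auto\<close>)
          qed
        qed
      qed (use t t1 W_gt n_pos I p in \<open>auto simp: last_enc_def first_enc_def\<close>)
      fix t2
      assume ag2: "agree (var_writes (For xI xN ?body)) (arr_writes (For xI xN ?body)) t1 t2"
        and J: "?J {..<n} t2"
      have "sources p \<inter> {..<n} = sources p" using sources_less by auto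
      moreover have "vr t2 xJ = p" "ar t2 aLast = ar t aLast"
        using agree_vr[OF ag2, of xJ] agree_ar[OF ag2, of aLast] t1 p by auto
      ultimately show "triple (AStore aLast (Var xJ) (Lit 0) (Lit 0) (Var xP)) t2 14 (?I (insert p S))"
        using I J p by (auto simp: triple_def)
    qed (simp add: triple_def)
  qed (use s zero W_gt n_pos in auto)
  have "n * ((2 + (n * (100 + 40) + 14)) + 40) = n ^ 2 * 140 + n * 56"
    by (simp add: algebra_simps power2_eq_square)
  also have "\<dots> \<le> n ^ 4 * 400" using n_powers by linarith
  finally show ?thesis by (rule triple_mono[OF 1]) simp
qed

text \<open>Pairs without predecessor are never written: the initial zero already encodes
  \<open>None\<close>.\<close>

lemma triple_find_pred:
  assumes s: "vr s xN = n" "\<forall>p<n. ar s aFirst (p, 0, 0) = first_enc (sources p)"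
      "\<forall>p<n. ar s aLast (p, 0, 0) = last_enc (sources p)"
      "\<forall>p<n. sources p \<noteq> {} \<longrightarrow> ar s aLab (p, 0, 0) = label p"
    and zero: "\<forall>p<n. \<forall>q<n. ar s aFU (p, q, 0) = 0"
  shows "triple find_pred s (n ^ 4 * 300) (\<lambda>t. represents t pred1)"
proof -
  let ?I = "\<lambda>S t. \<forall>p<n. \<forall>q<n. if (p, q) \<in> S then encodes (ar t aFU (p, q, 0)) (ar t aFV (p, q, 0)) (pred1 (p, q))
    else ar t aFU (p, q, 0) = 0"
  have 1: "triple find_pred s (n ^ 2 * (200 + 80)) (?I ({..<n} \<times> {..<n}))"
    unfolding find_pred_def
  proof (rule triple_For2[where I = ?I], goal_cases)
    case (10 S p q t)
    note ag = \<open>agree _ _ s t\<close>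
    have t: "ar t aFirst = ar s aFirst" "ar t aLast = ar s aLast" "ar t aLab = ar s aLab"
      using agree_ar[OF ag, of aFirst] agree_ar[OF ag, of aLast] agree_ar[OF ag, of aLab] by auto
    have I: "?I S t" and pq: "p < n" "q < n" "(p, q) \<notin> S" "vr t xI = p" "vr t xJ = q" using 10 by auto
    show ?case
    proof (cases "p < q \<and> sources p \<noteq> {} \<and> sources q \<noteq> {} \<and> label p = label q")
      case True
      then have nz: "first_enc (sources p) = Suc (Min (sources p))" "first_enc (sources q) = Suc (Min (sources q))"
        "last_enc (sources p) = Suc (Max (sources p))"
        by (auto simp: first_enc_def last_enc_def)
      have lt: "Max (sources p) < n" "Min (sources q) < n"
        using True sources_less[OF Max_in[of "sources p"]] sources_less[OF Min_in[of "sources q"]] by simp_all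
      then have sub: "(Suc (Min (sources q)) + W - Suc 0) mod W = Min (sources q)"
        using sub_mod[of 1 "Suc (Min (sources q))"] W_gt by simp
      have "triple (Ite (Bin Lt (Var xI) (Var xJ)) (
         Ite (Arr aFirst (Var xI) (Lit 0) (Lit 0)) (
         Ite (Arr aFirst (Var xJ) (Lit 0) (Lit 0)) (
         Ite (Bin Eq (Arr aLab (Var xI) (Lit 0) (Lit 0)) (Arr aLab (Var xJ) (Lit 0) (Lit 0)))
           (AStore aFU (Var xI) (Var xJ) (Lit 0) (Arr aLast (Var xI) (Lit 0) (Lit 0)) ;;
            AStore aFV (Var xI) (Var xJ) (Lit 0) (Arr aFirst (Var xJ) (Lit 0) (Lit 0) [-] Lit 1))
         skip) skip) skip) skip) t 200
         (\<lambda>u. ar u aFU = (ar t aFU)((p, q, 0) := Suc (Max (sources p))) \<and>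
            ar u aFV = (ar t aFV)((p, q, 0) := Min (sources q)))"
        using True pq t s nz sub by (simp add: triple_def)
      moreover have "encodes (Suc (Max (sources p))) (Min (sources q)) (pred1 (p, q))"
        unfolding encodes_def pred1_def using True lt by simp
      ultimately show ?thesis
        by (elim triple_mono) (use I pq in auto)
    next
      case False
      have "triple (Ite (Bin Lt (Var xI) (Var xJ)) (
         Ite (Arr aFirst (Var xI) (Lit 0) (Lit 0)) (
         Ite (Arr aFirst (Var xJ) (Lit 0) (Lit 0)) (
         Ite (Bin Eq (Arr aLab (Var xI) (Lit 0) (Lit 0)) (Arr aLab (Var xJ) (Lit 0) (Lit 0)))
           (AStore aFU (Var xI) (Var xJ) (Lit 0) (Arr aLast (Var xI) (Lit 0) (Lit 0)) ;;
            AStore aFV (Var xI) (Var xJ) (Lit 0) (Arr aFirst (Var xJ) (Lit 0) (Lit 0) [-] Lit 1))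
         skip) skip) skip) skip) t 200 (\<lambda>u. ar u = ar t)"
        using False pq t s by (auto simp: triple_def first_enc_def)
      moreover have "encodes 0 y (pred1 (p, q))" for y
        unfolding encodes_def pred1_def using False by auto
      ultimately show ?thesis
        by (elim triple_mono) (use I pq in auto)
    qed
  qed (use s zero in auto)
  have "n ^ 2 * (200 + 80) = n ^ 2 * 280" by simp
  also have "\<dots> \<le> n ^ 4 * 300" using n_powers by linarith
  finally show ?thesis by (rule triple_mono[OF 1]) (simp add: represents_def)
qed

lemma occ_0_less: "a < n \<Longrightarrow> b < n \<Longrightarrow> occ 0 (a, b) = of_bool (a \<le> b \<and> b \<le> Suc a)"
  using occ_0[of "(a, b)"] by (simp add: PS_def)

lemma triple_init_counts:
  assumes s: "vr s xN = n" and zero: "\<forall>u<n. \<forall>v<n. ar s aY (u, v, 0) = 0"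
  shows "triple init_counts s (n ^ 4 * 300) (\<lambda>t. \<forall>u<n. \<forall>v<n. ar t aY (u, v, 0) = occ 0 (u, v))"
proof -
  have 1: "triple init_counts s (n ^ 2 * (100 + 80))
    ((\<lambda>S t. \<forall>u<n. \<forall>v<n. ar t aY (u, v, 0) = (if (u, v) \<in> S then occ 0 (u, v) else 0)) ({..<n} \<times> {..<n}))"
    unfolding init_counts_def
  proof (rule triple_For2, goal_cases)
    case (10 S p q t)
    have "Suc p mod W = Suc p" using 10 W_gt by simp
    then show ?case using 10 by (auto simp: triple_def occ_0_less)
  qed (use s zero in auto)
  have "n ^ 2 * (100 + 80) = n ^ 2 * 180" by simp
  also have "\<dots> \<le> n ^ 4 * 300" using n_powers by linarith
  finally show ?thesis by (rule triple_mono[OF 1]) simp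
qed

section \<open>The loop over the binary digits\<close>

primrec pred_pow :: "nat \<Rightarrow> nat \<times> nat \<Rightarrow> (nat \<times> nat) option" where
  "pred_pow 0 = pred1"
| "pred_pow (Suc i) = (\<lambda>p. Option.bind (pred_pow i p) (pred_pow i))"

lemma structured_pw: "structured (pw i) (pred_pow i)"
  by (induction i) (simp_all add: structured_link structured_mm)

lemma sum_mod_cong:
  assumes "\<And>x. x \<in> A \<Longrightarrow> f x mod W = g x mod W"
  shows "sum f A mod W = sum g A mod W"
proof -
  have "sum f A mod W = (\<Sum>x\<in>A. f x mod W) mod W" by (rule mod_sum_eq[symmetric])
  also have "(\<Sum>x\<in>A. f x mod W) = (\<Sum>x\<in>A. g x mod W)" using assms by (rule sum.cong[OF refl])
  also have "\<dots> mod W = sum g A mod W" by (rule mod_sum_eq)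
  finally show ?thesis .
qed

text \<open>Sums and products respect congruence modulo \<open>W\<close>, so reduced entries suffice
  in the sparse formula of \<open>sum_structured\<close>.\<close>

lemma apply_mod:
  assumes "structured X F" "s \<in> PS"
  shows "((\<Sum>l<n. (X s (l, l) mod W) * (y (l, l) mod W)) +
      (\<Sum>p\<in>PS. of_bool (F p = Some s) * (y p mod W))) mod W = (\<Sum>t\<in>PS. X s t * y t) mod W"
  unfolding sum_structured[OF assms]
  by (intro mod_add_cong sum_mod_cong) (simp_all only: mod_mult_left_eq mod_mult_right_eq)

text \<open>The length is assembled from the lowest digit of \<open>k\<close> upward; the digits not
  yet read remain in \<open>xK\<close>.\<close>

definition loop_inv :: "nat \<Rightarrow> hstate \<Rightarrow> bool" where
  "loop_inv i t \<longleftrightarrow> vr t xN = n \<and> vr t xOne = 1 \<and> vr t xOut = 0 \<and> vr t xK = k div 2 ^ i \<and>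
     represents t (pred_pow i) \<and>
     (\<forall>u<n. \<forall>v<n. \<forall>p<n. ar t aB (u, v, p) = pw i (u, v) (p, p) mod W) \<and>
     (\<forall>u<n. \<forall>v<n. ar t aY (u, v, 0) = occ (k mod 2 ^ i) (u, v) mod W)"

lemma represents_agree:
  "represents s F \<Longrightarrow> ar t aFU = ar s aFU \<Longrightarrow> ar t aFV = ar s aFV \<Longrightarrow> represents t F"
  by (simp add: represents_def)

lemma triple_double:
  assumes inv: "loop_inv i s"
  shows "triple double s (n ^ 4 * 2500) (loop_inv (Suc i))"
proof -
  have s: "vr s xN = n" "vr s xOne = 1" "vr s xOut = 0" "vr s xK = k div 2 ^ i" "represents s (pred_pow i)"
    and B: "\<And>u v p. u < n \<Longrightarrow> v < n \<Longrightarrow> p < n \<Longrightarrow> ar s aB (u, v, p) = pw i (u, v) (p, p) mod W"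
    and Y: "\<And>u v. u < n \<Longrightarrow> v < n \<Longrightarrow> ar s aY (u, v, 0) = occ (k mod 2 ^ i) (u, v) mod W"
    using inv by (auto simp: loop_inv_def)
  have PS: "(\<Sum>p\<in>{..<n} \<times> {..<n}. f p) = (\<Sum>p\<in>PS. f p)" for f :: "nat \<times> nat \<Rightarrow> nat"
    by (simp add: PS_def)
  \<comment> \<open>Digit \<open>i\<close> of \<open>k\<close> is split off; it decides whether the
    length grows by \<open>2 ^ i\<close>.\<close>
  have k_mod: "k mod 2 ^ Suc i = k mod 2 ^ i + 2 ^ i * (k div 2 ^ i mod 2)"
    by (metis mod_mult2_eq power_Suc mult.commute add.commute)
  have k_div: "k div 2 ^ i div 2 = k div 2 ^ Suc i"
    by (metis div_mult2_eq power_Suc mult.commute)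
  let ?Y = "\<lambda>t. \<forall>u<n. \<forall>v<n. ar t aY (u, v, 0) = occ (k mod 2 ^ Suc i) (u, v) mod W"
  let ?B = "\<lambda>t. \<forall>u<n. \<forall>v<n. \<forall>p<n. ar t aB (u, v, p) = pw (Suc i) (u, v) (p, p) mod W"
  have step1: "triple (Ite (Bin Mod (Var xK) (Lit 2)) (apply_to aY xOne) skip) s (5 + n ^ 4 * 900) ?Y"
  proof (rule triple_weaken[OF triple_Ite])
    assume nz: "eval (Bin Mod (Var xK) (Lit 2)) s \<noteq> 0"
    then have odd: "k mod 2 ^ Suc i = k mod 2 ^ i + 2 ^ i"
      using k_mod s by simp
    have "triple (apply_to aY xOne) s (n ^ 4 * 900) (\<lambda>t. \<forall>a<n. \<forall>b<n. \<forall>d<1.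
      ar t aY (a, b, d) = ((\<Sum>l<n. ar s aB (a, b, l) * ar s aY (l, l, d)) +
      (\<Sum>p\<in>{..<n} \<times> {..<n}. of_bool (pred_pow i p = Some (a, b)) * ar s aY (fst p, snd p, d))) mod W)"
      using s n_pos by (intro triple_apply_to) auto
    then show "triple (apply_to aY xOne) s (n ^ 4 * 900) ?Y"
    proof (rule triple_mono)
      fix t
      assume t: "\<forall>a<n. \<forall>b<n. \<forall>d<1.
        ar t aY (a, b, d) = ((\<Sum>l<n. ar s aB (a, b, l) * ar s aY (l, l, d)) +
        (\<Sum>p\<in>{..<n} \<times> {..<n}. of_bool (pred_pow i p = Some (a, b)) * ar s aY (fst p, snd p, d))) mod W"
      show "?Y t"
      proof (intro allI impI)
        fix u v
        assume uv: "u < n" "v < n"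
        then have uv_PS: "(u, v) \<in> PS" by (simp add: PS_def)
        have "ar t aY (u, v, 0) = ((\<Sum>l<n. ar s aB (u, v, l) * ar s aY (l, l, 0)) +
            (\<Sum>p\<in>PS. of_bool (pred_pow i p = Some (u, v)) * ar s aY (fst p, snd p, 0))) mod W"
          using t uv unfolding PS by simp
        also have "(\<Sum>l<n. ar s aB (u, v, l) * ar s aY (l, l, 0)) =
            (\<Sum>l<n. (pw i (u, v) (l, l) mod W) * (occ (k mod 2 ^ i) (l, l) mod W))"
          using uv by (intro sum.cong) (simp_all add: B Y)
        also have "(\<Sum>p\<in>PS. of_bool (pred_pow i p = Some (u, v)) * ar s aY (fst p, snd p, 0)) =
            (\<Sum>p\<in>PS. of_bool (pred_pow i p = Some (u, v)) * (occ (k mod 2 ^ i) p mod W))"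
          by (intro sum.cong) (auto simp: Y PS_def)
        \<comment> \<open>The machine sum is the product of \<open>pw i\<close> with the counts
          modulo \<open>W\<close>, which by \<open>pw_occ\<close> raises the length by
          \<open>2 ^ i\<close>.\<close>
        also have "((\<Sum>l<n. (pw i (u, v) (l, l) mod W) * (occ (k mod 2 ^ i) (l, l) mod W)) + \<dots>) mod W =
            occ (k mod 2 ^ i + 2 ^ i) (u, v) mod W"
          by (subst apply_mod[OF structured_pw uv_PS]) (simp only: pw_occ[OF uv_PS])
        finally show "ar t aY (u, v, 0) = occ (k mod 2 ^ Suc i) (u, v) mod W"
          by (simp only: odd)
      qed
    qed simp
  next
    assume "eval (Bin Mod (Var xK) (Lit 2)) s = 0"
    then have "k mod 2 ^ Suc i = k mod 2 ^ i" using k_mod s by simp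
    then have "?Y s" using Y by simp
    then show "triple skip s (n ^ 4 * 900) ?Y" using n_powers by simp
  qed simp_all
  have step2: "triple (apply_to aB xN) t (n ^ 4 * 900) ?B"
    if t: "vr t xN = n" "represents t (pred_pow i)" "ar t aB = ar s aB" for t
  proof -
    have "triple (apply_to aB xN) t (n ^ 4 * 900) (\<lambda>t'. \<forall>a<n. \<forall>b<n. \<forall>d<n.
      ar t' aB (a, b, d) = ((\<Sum>l<n. ar t aB (a, b, l) * ar t aB (l, l, d)) +
      (\<Sum>p\<in>{..<n} \<times> {..<n}. of_bool (pred_pow i p = Some (a, b)) * ar t aB (fst p, snd p, d))) mod W)"
      using t by (intro triple_apply_to) auto
    then show ?thesis
    proof (rule triple_mono)
      fix t'
      assume t': "\<forall>a<n. \<forall>b<n. \<forall>d<n.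
        ar t' aB (a, b, d) = ((\<Sum>l<n. ar t aB (a, b, l) * ar t aB (l, l, d)) +
        (\<Sum>p\<in>{..<n} \<times> {..<n}. of_bool (pred_pow i p = Some (a, b)) * ar t aB (fst p, snd p, d))) mod W"
      show "?B t'"
      proof (intro allI impI)
        fix u v d
        assume uv: "u < n" "v < n" "d < n"
        then have uv_PS: "(u, v) \<in> PS" by (simp add: PS_def)
        have "ar t' aB (u, v, d) = ((\<Sum>l<n. ar s aB (u, v, l) * ar s aB (l, l, d)) +
            (\<Sum>p\<in>PS. of_bool (pred_pow i p = Some (u, v)) * ar s aB (fst p, snd p, d))) mod W"
          using t' uv unfolding PS t(3) by simp
        also have "(\<Sum>l<n. ar s aB (u, v, l) * ar s aB (l, l, d)) =
            (\<Sum>l<n. (pw i (u, v) (l, l) mod W) * (pw i (l, l) (d, d) mod W))"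
          using uv by (intro sum.cong) (simp_all add: B)
        also have "(\<Sum>p\<in>PS. of_bool (pred_pow i p = Some (u, v)) * ar s aB (fst p, snd p, d)) =
            (\<Sum>p\<in>PS. of_bool (pred_pow i p = Some (u, v)) * (pw i p (d, d) mod W))"
          using uv by (intro sum.cong) (auto simp: B PS_def)
        \<comment> \<open>Squaring column by column: the vector is the diagonal column
          \<open>(d, d)\<close> of \<open>pw i\<close> itself.\<close>
        also have "((\<Sum>l<n. (pw i (u, v) (l, l) mod W) * (pw i (l, l) (d, d) mod W)) + \<dots>) mod W =
            pw (Suc i) (u, v) (d, d) mod W"
          by (subst apply_mod[OF structured_pw uv_PS, where y = "\<lambda>p. pw i p (d, d)"]) (simp add: mm_def)
        finally show "ar t' aB (u, v, d) = pw (Suc i) (u, v) (d, d) mod W" .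
      qed
    qed simp
  qed
  have "triple double s ((5 + n ^ 4 * 900) + (n ^ 4 * 900 + (n ^ 4 * 500 + 4))) (loop_inv (Suc i))"
    unfolding double_def
  proof (rule triple_Seq[OF step1 triple_Seq[OF step2 triple_Seq[OF triple_square_pred]]])
    fix t1
    assume ag1: "agree (var_writes (Ite (Bin Mod (Var xK) (Lit 2)) (apply_to aY xOne) skip))
      (arr_writes (Ite (Bin Mod (Var xK) (Lit 2)) (apply_to aY xOne) skip)) s t1" and Y1: "?Y t1"
    have vr1: "vr t1 xN = n" "vr t1 xOne = 1" "vr t1 xOut = 0" "vr t1 xK = k div 2 ^ i"
      using agree_vr[OF ag1, of xN] agree_vr[OF ag1, of xOne] agree_vr[OF ag1, of xOut] agree_vr[OF ag1, of xK] s
      by auto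
    have ar1: "ar t1 aFU = ar s aFU" "ar t1 aFV = ar s aFV" "ar t1 aB = ar s aB"
      using agree_ar[OF ag1, of aFU] agree_ar[OF ag1, of aFV] agree_ar[OF ag1, of aB] by auto
    show "vr t1 xN = n" "ar t1 aB = ar s aB" by (fact vr1 ar1)+
    show rep1: "represents t1 (pred_pow i)" by (rule represents_agree[OF s(5) ar1(1,2)])
    fix t2
    assume ag2: "agree (var_writes (apply_to aB xN)) (arr_writes (apply_to aB xN)) t1 t2" and B2: "?B t2"
    have vr2: "vr t2 xN = n" "vr t2 xOne = 1" "vr t2 xOut = 0" "vr t2 xK = k div 2 ^ i"
      using agree_vr[OF ag2, of xN] agree_vr[OF ag2, of xOne] agree_vr[OF ag2, of xOut] agree_vr[OF ag2, of xK] vr1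
      by auto
    have ar2: "ar t2 aFU = ar t1 aFU" "ar t2 aFV = ar t1 aFV" "ar t2 aY = ar t1 aY"
      using agree_ar[OF ag2, of aFU] agree_ar[OF ag2, of aFV] agree_ar[OF ag2, of aY] by auto
    show "vr t2 xN = n" by (fact vr2)
    show "represents t2 (pred_pow i)" by (rule represents_agree[OF rep1 ar2(1,2)])
    fix t3
    assume ag3: "agree (var_writes square_pred) (arr_writes square_pred) t2 t3"
      and rep3: "represents t3 (\<lambda>p. Option.bind (pred_pow i p) (pred_pow i))"
    have vr3: "vr t3 xN = n" "vr t3 xOne = 1" "vr t3 xOut = 0" "vr t3 xK = k div 2 ^ i"
      using agree_vr[OF ag3, of xN] agree_vr[OF ag3, of xOne] agree_vr[OF ag3, of xOut] agree_vr[OF ag3, of xK] vr2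
      by auto
    have ar3: "ar t3 aB = ar t2 aB" "ar t3 aY = ar t2 aY"
      using agree_ar[OF ag3, of aB] agree_ar[OF ag3, of aY] by auto
    let ?t4 = "t3\<lparr>vr := (vr t3)(xK := k div 2 ^ Suc i)\<rparr>"
    have "represents ?t4 (pred_pow (Suc i))"
      using rep3 represents_agree[of t3 _ ?t4] by simp
    moreover have "?B ?t4" "?Y ?t4"
      using B2 Y1 ar3 ar2 by simp_all
    ultimately have "loop_inv (Suc i) ?t4"
      unfolding loop_inv_def using vr3 by simp
    then show "triple (Assign xK (Bin Div (Var xK) (Lit 2))) t3 4 (loop_inv (Suc i))"
      using vr3 by (simp add: triple_def k_div del: power_Suc)
  qed
  moreover have "(5 + n ^ 4 * 900) + (n ^ 4 * 900 + (n ^ 4 * 500 + 4)) \<le> n ^ 4 * 2500"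
    using n_powers by linarith
  ultimately show ?thesis by (rule triple_weaken)
qed

lemma triple_main_loop:
  assumes "loop_inv 0 s" "k div 2 ^ K = 0" "\<And>i. i < K \<Longrightarrow> k div 2 ^ i \<noteq> 0"
  shows "triple (While (Var xK) double) s (n ^ 4 * 2503 * K + 2) (loop_inv K)"
proof -
  have "triple (While (Var xK) double) s (K * (te (Var xK) + 2 + n ^ 4 * 2500) + te (Var xK) + 1) (loop_inv K)"
  proof (rule triple_While)
    have K: "vr t xK = k div 2 ^ i" if "loop_inv i t" for i t
      using that by (simp add: loop_inv_def)
    show "eok (Var xK) t \<and> eval (Var xK) t \<noteq> 0 \<and> triple double t (n ^ 4 * 2500) (loop_inv (Suc i))"
      if "i < K" "loop_inv i t" for i t
      using K[OF that(2)] assms(3)[OF that(1)] triple_double[OF that(2)] by simp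
    show "eok (Var xK) t \<and> eval (Var xK) t = 0" if "loop_inv K t" for t
      using K[OF that] assms(2) by simp
  qed (fact assms(1))
  moreover have "K * (te (Var xK) + 2 + n ^ 4 * 2500) \<le> n ^ 4 * 2503 * K"
  proof -
    \<comment> \<open>Reading \<open>xK\<close>, testing it and jumping back cost three steps per
      round, which turns 2500 into 2503.\<close>
    have "te (Var xK) + 2 + n ^ 4 * 2500 \<le> n ^ 4 * 2503" using n_powers by simp
    then have "K * (te (Var xK) + 2 + n ^ 4 * 2500) \<le> K * (n ^ 4 * 2503)" by (rule mult_le_mono2)
    then show ?thesis by (simp only: ac_simps)
  qed
  ultimately show ?thesis by (elim triple_weaken) simp
qed

section \<open>The alternating sum and the whole program\<close>

definition signed :: "nat \<times> nat \<Rightarrow> int" where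
  "signed = (\<lambda>(u, v). if u = v then int (occ k (u, v)) else if u < v then - int (occ k (u, v)) else 0)"

lemma sum_signed: "(\<Sum>p\<in>{..<n} \<times> {..<n}. signed p) = count k"
proof -
  have "(\<Sum>p\<in>{..<n} \<times> {..<n}. signed p) = (\<Sum>v<n. \<Sum>u<n. signed (u, v))"
    by (subst sum.swap) (simp add: sum.cartesian_product)
  also have "\<dots> = count k"
    unfolding count_def
  proof (rule sum.cong)
    fix v
    assume "v \<in> {..<n}"
    then have v: "v < n" by simp
    have "(\<Sum>u<n. signed (u, v)) = (\<Sum>u\<in>insert v {..<v}. signed (u, v))"
      by (rule sum.mono_neutral_right) (use v in \<open>auto simp: signed_def\<close>)
    also have "\<dots> = signed (v, v) + (\<Sum>u<v. signed (u, v))" by simp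
    also have "(\<Sum>u<v. signed (u, v)) = (\<Sum>u<v. - int (occ k (u, v)))"
      by (rule sum.cong) (auto simp: signed_def)
    finally show "(\<Sum>u<n. signed (u, v)) = int (occ k (v, v)) - (\<Sum>u<v. int (occ k (u, v)))"
      by (simp add: signed_def sum_negf)
  qed simp
  finally show ?thesis .
qed

text \<open>Partial sums may be negative, so the invariant lives in the integers and the machine
  value is their residue; \<open>Sub\<close> wraps consistently with integer subtraction.\<close>

lemma triple_add_up:
  assumes s: "vr s xN = n" "vr s xOut = 0" "\<forall>u<n. \<forall>v<n. ar s aY (u, v, 0) = occ k (u, v) mod W"
  shows "triple add_up s (n ^ 4 * 300) (\<lambda>t. int (vr t xOut) = count k mod int W)"
proof -
  let ?I = "\<lambda>S t. int (vr t xOut) = (\<Sum>p\<in>S. signed p) mod int W"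
  have 1: "triple add_up s (n ^ 2 * (100 + 80)) (?I ({..<n} \<times> {..<n}))"
    unfolding add_up_def
  proof (rule triple_For2[where I = ?I], goal_cases)
    case (10 S u v t)
    note ag = \<open>agree _ _ s t\<close>
    have I: "?I S t" and uv: "u < n" "v < n" "vr t xI = u" "vr t xJ = v" and S: "finite S" "(u, v) \<notin> S"
      using 10 by auto
    have Y: "ar t aY (u, v, 0) = occ k (u, v) mod W"
      using agree_ar[OF ag, of aY] s uv by simp
    have plus: "int ((x + y mod W) mod W) = (int x + int y) mod int W" for x y
      by (simp add: zmod_int mod_simps)
    have minus: "int ((x + W - y mod W) mod W) = (int x - int y) mod int W" for x y
    proof -
      have "y mod W < W" by simp
      then have "int (x + W - y mod W) = int x + int W - int y mod int W"
        by (subst of_nat_diff) (simp_all add: zmod_int trans_le_add2 less_imp_le)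
      then have "int ((x + W - y mod W) mod W) = (int x + int W - int y mod int W) mod int W"
        by (simp only: zmod_int)
      also have "\<dots> = (int x - int y) mod int W"
        by (simp add: mod_simps algebra_simps) (metis (no_types) mod_add_self2 add_diff_eq diff_add_eq)
      finally show ?thesis .
    qed
    have sum: "(\<Sum>p\<in>insert (u, v) S. signed p) mod int W = (int (vr t xOut) + signed (u, v)) mod int W"
      using S I by (simp add: mod_simps add.commute)
    have "triple (Ite (Bin Eq (Var xI) (Var xJ)) (Assign xOut (Var xOut [+] Arr aY (Var xI) (Var xJ) (Lit 0))) (
     Ite (Bin Lt (Var xI) (Var xJ)) (Assign xOut (Var xOut [-] Arr aY (Var xI) (Var xJ) (Lit 0)))
     skip)) t 100 (\<lambda>t'. int (vr t' xOut) = (int (vr t xOut) + signed (u, v)) mod int W)"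
      using uv Y plus[of "vr t xOut" "occ k (u, v)"] minus[of "vr t xOut" "occ k (u, v)"] I
      by (auto simp: triple_def signed_def simp del: of_nat_mod)
    then show ?case by (simp only: sum)
  qed (use s in auto)
  have "n ^ 2 * (100 + 80) = n ^ 2 * 180" by simp
  also have "\<dots> \<le> n ^ 4 * 300" using n_powers by linarith
  finally show ?thesis by (rule triple_mono[OF 1]) (simp only: sum_signed)
qed

theorem triple_main:
  assumes "k div 2 ^ K = 0" "\<And>i. i < K \<Longrightarrow> k div 2 ^ i \<noteq> 0" and "card (strings_below k n) < W"
  shows "triple main start (n ^ 4 * 1700 + n ^ 4 * 2503 * K) (\<lambda>t. vr t xOut = card (strings_below k n))"
proof -
  \<comment> \<open>The phases other than the loop add up to \<open>1600 * n ^ 4\<close>; with the 2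
    steps of the exit test this stays below \<open>1700 * n ^ 4\<close>.\<close>
  have "triple main start (n ^ 4 * 50 + (n ^ 4 * 100 + (n ^ 4 * 150 + (n ^ 4 * 400 + (n ^ 4 * 300 +
    (n ^ 4 * 300 + ((n ^ 4 * 2503 * K + 2) + n ^ 4 * 300))))))) (\<lambda>t. vr t xOut = card (strings_below k n))"
    unfolding main_def
  proof (rule triple_Seq[OF triple_read_sizes triple_Seq[OF triple_read_order triple_Seq[OF triple_read_edges
      triple_Seq[OF triple_scan_sources triple_Seq[OF triple_find_pred triple_Seq[OF triple_init_counts
      triple_Seq[OF triple_main_loop]]]]]]])
    fix t1
    assume ag1: "agree (var_writes read_sizes) (arr_writes read_sizes) start t1"
      and vr1: "vr t1 xN = n \<and> vr t1 xM = m \<and> vr t1 xK = k \<and> vr t1 xOne = 1"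
    have ar1: "ar t1 j p = 0" for j p
      using agree_ar[OF ag1, of j] by simp
    have out1: "vr t1 xOut = 0" using agree_vr[OF ag1, of xOut] by simp
    show "vr t1 xN = n" using vr1 by simp
    fix t2
    assume ag2: "agree (var_writes read_order) (arr_writes read_order) t1 t2"
      and pos2: "\<forall>i<n. ar t2 aPos (vs ! i, 0, 0) = i"
    have vr2: "vr t2 xN = n" "vr t2 xM = m" "vr t2 xK = k" "vr t2 xOne = 1" "vr t2 xOut = 0"
      using vr1 out1 agree_vr[OF ag2] by auto
    have ar2: "ar t2 j p = 0" if "j \<noteq> aPos" for j p
      using agree_ar[OF ag2, of j] ar1 that by simp
    show "vr t2 xN = n" "vr t2 xM = m" "\<forall>i<n. ar t2 aPos (vs ! i, 0, 0) = i" by (fact vr2 pos2)+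
    show "\<forall>i<n. \<forall>j<n. ar t2 aAdj (i, j, 0) = 0" using ar2 by simp
    fix t3
    assume ag3: "agree (var_writes read_edges) (arr_writes read_edges) t2 t3"
      and edges3: "(\<forall>i<n. \<forall>j<n. ar t3 aAdj (i, j, 0) = of_bool (i \<in> sources j)) \<and>
        (\<forall>j<n. sources j \<noteq> {} \<longrightarrow> ar t3 aLab (j, 0, 0) = label j)"
    have vr3: "vr t3 xN = n" "vr t3 xK = k" "vr t3 xOne = 1" "vr t3 xOut = 0"
      using vr2 agree_vr[OF ag3] by auto
    have ar3: "ar t3 j p = 0" if "j \<notin> {aPos, aAdj, aLab}" for j p
      using agree_ar[OF ag3, of j] ar2 that by simp
    show "vr t3 xN = n" "\<forall>i<n. \<forall>j<n. ar t3 aAdj (i, j, 0) = of_bool (i \<in> sources j)"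
      using vr3 edges3 by auto
    show "\<forall>u<n. \<forall>v<n. \<forall>p<n. ar t3 aB (u, v, p) = 0" "\<forall>p<n. ar t3 aFirst (p, 0, 0) = 0"
      using ar3 by simp_all
    fix t4
    assume ag4: "agree (var_writes scan_sources) (arr_writes scan_sources) t3 t4"
      and src4: "\<forall>p<n. (\<forall>u<n. \<forall>v<n. ar t4 aB (u, v, p) = of_bool (link (u, v) (p, p))) \<and>
        ar t4 aFirst (p, 0, 0) = first_enc (sources p) \<and> ar t4 aLast (p, 0, 0) = last_enc (sources p)"
    have vr4: "vr t4 xN = n" "vr t4 xK = k" "vr t4 xOne = 1" "vr t4 xOut = 0"
      using vr3 agree_vr[OF ag4] by auto
    show "vr t4 xN = n" "\<forall>p<n. ar t4 aFirst (p, 0, 0) = first_enc (sources p)"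
        "\<forall>p<n. ar t4 aLast (p, 0, 0) = last_enc (sources p)"
      using vr4 src4 by auto
    show "\<forall>p<n. sources p \<noteq> {} \<longrightarrow> ar t4 aLab (p, 0, 0) = label p"
      using agree_ar[OF ag4, of aLab] edges3 by simp
    show "\<forall>p<n. \<forall>q<n. ar t4 aFU (p, q, 0) = 0"
      using agree_ar[OF ag4, of aFU] ar3 by simp
    fix t5
    assume ag5: "agree (var_writes find_pred) (arr_writes find_pred) t4 t5" and rep5: "represents t5 pred1"
    have vr5: "vr t5 xN = n" "vr t5 xK = k" "vr t5 xOne = 1" "vr t5 xOut = 0"
      using vr4 agree_vr[OF ag5] by auto
    show "vr t5 xN = n" by (fact vr5)
    show "\<forall>u<n. \<forall>v<n. ar t5 aY (u, v, 0) = 0"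
      using agree_ar[OF ag5, of aY] agree_ar[OF ag4, of aY] ar3 by simp
    fix t6
    assume ag6: "agree (var_writes init_counts) (arr_writes init_counts) t5 t6"
      and occ6: "\<forall>u<n. \<forall>v<n. ar t6 aY (u, v, 0) = occ 0 (u, v)"
    have "vr t6 xN = n" "vr t6 xK = k" "vr t6 xOne = 1" "vr t6 xOut = 0"
      using vr5 agree_vr[OF ag6] by auto
    moreover have "ar t6 aB = ar t4 aB" "ar t6 aFU = ar t5 aFU" "ar t6 aFV = ar t5 aFV"
      using agree_ar[OF ag6, of aB] agree_ar[OF ag5, of aB] agree_ar[OF ag6, of aFU] agree_ar[OF ag6, of aFV]
      by auto
    moreover from this have "represents t6 pred1" using represents_agree[OF rep5] by simp
    ultimately show "loop_inv 0 t6"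
      using src4 occ6 by (simp add: loop_inv_def occ_0_less)
    fix t7
    assume "loop_inv K t7"
    moreover have "k mod 2 ^ K = k" using assms(1) by (simp add: div_eq_0_iff)
    ultimately have "triple add_up t7 (n ^ 4 * 300) (\<lambda>t. int (vr t xOut) = count k mod int W)"
      by (intro triple_add_up) (simp_all add: loop_inv_def)
    then show "triple add_up t7 (n ^ 4 * 300) (\<lambda>t. vr t xOut = card (strings_below k n))"
    proof (rule triple_mono)
      fix t
      assume "int (vr t xOut) = count k mod int W"
      also have "\<dots> = int (card (strings_below k n) mod W)"
        by (simp only: count_eq zmod_int)
      \<comment> \<open>Here the bound on the true count enters: a number below \<open>W\<close>
        equals its residue.\<close>
      finally show "vr t xOut = card (strings_below k n)" using assms(3) by simp
    qed simp
  qed (use assms in simp_all)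
  then show ?thesis by (rule triple_weaken) (use n_powers in linarith)
qed

end

section \<open>From the program to the theorem\<close>

lemma halvings:
  assumes "1 \<le> (k::nat)"
  obtains K where "k div 2 ^ K = 0" "\<forall>i<K. k div 2 ^ i \<noteq> 0" "real K \<le> 2 * log 2 (real k + 1)"
proof -
  define K where "K = (LEAST K. k div 2 ^ K = 0)"
  have "k div 2 ^ k = 0" by simp
  then have K0: "k div 2 ^ K = 0" unfolding K_def by (rule LeastI)
  have nz: "k div 2 ^ i \<noteq> 0" if "i < K" for i
    using that not_less_Least unfolding K_def by blast
  have "K \<noteq> 0" using K0 assms by (cases "K = 0") auto
  then have "k div 2 ^ (K - 1) \<noteq> 0" using nz by simp
  then have "2 ^ (K - 1) \<le> k" by (simp add: div_eq_0_iff)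
  then have "2 ^ (K - 1) \<le> real k" by (metis of_nat_le_iff of_nat_numeral of_nat_power)
  then have "real (K - 1) \<le> log 2 (real k)"
    using assms by (simp add: le_log_iff powr_realpow)
  also have "\<dots> \<le> log 2 (real k + 1)" using assms by simp
  finally have "real K \<le> log 2 (real k + 1) + 1" using \<open>K \<noteq> 0\<close> by linarith
  \<comment> \<open>\<open>K\<close> is the number of binary digits, at most one more than the
    logarithm; that one is absorbed by doubling since the logarithm of \<open>k + 1\<close> is at
    least 1.\<close>
  moreover have "1 \<le> log 2 (real k + 1)" using assms by (simp add: le_log_iff)
  ultimately have "real K \<le> 2 * log 2 (real k + 1)" by linarith
  then show thesis using that[OF K0] nz by simp
qed

text \<open>Origin of the exponent in the word size: the cells number at most
  \<open>23 * n ^ 3\<close>, which is rounded up to \<open>2 ^ 7 * n ^ 3\<close>, and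
  \<open>2 ^ 7\<close> is at most \<open>(n + 1) ^ 7\<close>.\<close>

lemma input_fits:
  assumes "1 \<le> n" "m \<le> n ^ 2" "(n + 1) ^ 10 \<le> B"
  shows "3 + n + 3 * m + 16 * n ^ 3 \<le> (B::nat)"
proof -
  have "n ^ 2 \<le> n ^ 3" "n \<le> n ^ 3" "1 \<le> n ^ 3"
    using assms(1) power_increasing[of 2 3 n] power_increasing[of 1 3 n] by auto
  then have "3 + n + 3 * m + 16 * n ^ 3 \<le> 2 ^ 7 * n ^ 3" using assms(2) by simp
  also have "\<dots> \<le> (n + 1) ^ 7 * (n + 1) ^ 3"
    using assms(1) by (intro mult_mono power_mono) auto
  also have "\<dots> = (n + 1) ^ 10" by (simp flip: power_add)
  finally show ?thesis using assms(3) by simp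
qed

text \<open>Walks are considered with a prescribed start vertex, so that both notions peel off their
  first letter together.\<close>

lemma contains_string_iff_readable:
  assumes "wheeler_positions n \<Sigma> E'"
    and E': "\<And>i j a. (i, j, a) \<in> E' \<longleftrightarrow> i < n \<and> j < n \<and> (vs ! i, vs ! j, a) \<in> E"
    and vs: "length vs = n" "set vs = V" and E: "\<And>u v a. (u, v, a) \<in> E \<Longrightarrow> u \<in> V \<and> v \<in> V"
  shows "contains_string V E \<alpha> \<longleftrightarrow> (\<exists>i<n. wheeler_positions.readable n E' \<alpha> i)"
proof -
  interpret wheeler_positions n \<Sigma> E' by fact
  let ?walk = "\<lambda>\<alpha> ws. length ws = length \<alpha> + 1 \<and> set ws \<subseteq> V \<and>
    (\<forall>j < length \<alpha>. (ws ! j, ws ! (j + 1), \<alpha> ! j) \<in> E)"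
  have walk_Cons: "?walk (a # \<alpha>) (u # ws) \<longleftrightarrow> u \<in> V \<and> (u, ws ! 0, a) \<in> E \<and> ?walk \<alpha> ws" for a u \<alpha> ws
    by (auto simp: All_less_Suc2 nth_Cons' less_Suc_eq_0_disj)
  have in_V: "v \<in> V \<longleftrightarrow> (\<exists>i<n. v = vs ! i)" for v
    using vs by (metis in_set_conv_nth)
  have main: "i < n \<Longrightarrow> readable \<alpha> i \<longleftrightarrow> (\<exists>ws. ?walk \<alpha> ws \<and> ws ! 0 = vs ! i)" for i
  proof (induction \<alpha> arbitrary: i)
    case Nil
    then show ?case using in_V by (auto intro!: exI[of _ "[vs ! i]"])
  next
    case (Cons a \<alpha>)
    show ?case
    proof
      assume "readable (a # \<alpha>) i"
      then obtain j where j: "(i, j, a) \<in> E'" "readable \<alpha> j" by auto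
      then have "j < n" "(vs ! i, vs ! j, a) \<in> E" using E' by auto
      then obtain ws where "?walk \<alpha> ws" "ws ! 0 = vs ! j" using Cons.IH j by blast
      then have "?walk (a # \<alpha>) (vs ! i # ws)"
        unfolding walk_Cons using \<open>(vs ! i, vs ! j, a) \<in> E\<close> E by auto
      then show "\<exists>ws. ?walk (a # \<alpha>) ws \<and> ws ! 0 = vs ! i" by (metis nth_Cons_0)
    next
      assume "\<exists>ws. ?walk (a # \<alpha>) ws \<and> ws ! 0 = vs ! i"
      then obtain ws where ws: "?walk (a # \<alpha>) ws" "ws ! 0 = vs ! i" by blast
      then obtain u ws' where u: "ws = u # ws'" by (cases ws) auto
      have w: "(vs ! i, ws' ! 0, a) \<in> E" "?walk \<alpha> ws'" using ws unfolding u walk_Cons by auto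
      then obtain j where j: "j < n" "ws' ! 0 = vs ! j" using in_V E by blast
      then have "readable \<alpha> j" using Cons.IH w by blast
      moreover have "(i, j, a) \<in> E'" using w j \<open>i < n\<close> E' by simp
      ultimately show "readable (a # \<alpha>) i" by auto
    qed
  qed
  show ?thesis
  proof
    assume "contains_string V E \<alpha>"
    then obtain ws where ws: "?walk \<alpha> ws" unfolding contains_string_def by blast
    then have "ws ! 0 \<in> V" by (metis add_gr_0 less_one nth_mem subsetD)
    then obtain i where "i < n" "ws ! 0 = vs ! i" using in_V by blast
    then show "\<exists>i<n. readable \<alpha> i" using main ws by blast
  next
    assume "\<exists>i<n. readable \<alpha> i"
    then show "contains_string V E \<alpha>" using main unfolding contains_string_def by blast
  qed
qed

text \<open>The factor 2 turns the non-strict bound of the word size into a strict one, since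
  \<open>2 ^ w\<close> is positive.\<close>

lemma card_kmers_less:
  assumes "word_size_ok c w \<Sigma> V E k" "2 \<le> c" "1 \<le> k"
  shows "card (kmers \<Sigma> V E k) < 2 ^ w"
proof -
  have "card (kmers \<Sigma> V E k) \<le> max_kmers \<Sigma> V E k"
    unfolding max_kmers_def using assms(3) by (intro Max_ge) auto
  moreover have "2 * max_kmers \<Sigma> V E k \<le> c * max_kmers \<Sigma> V E k" using assms(2) by simp
  ultimately have "2 * card (kmers \<Sigma> V E k) \<le> 2 ^ w"
    using assms(1) unfolding word_size_ok_def by linarith
  moreover have "0 < (2::nat) ^ w" by simp
  ultimately show ?thesis by linarith
qed

theorem main_correct:
  assumes V: "V = {..<n}" and k: "1 \<le> k" and graph: "labeled_graph \<Sigma> V E"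
    and det: "deterministic E" and wheeler: "wheeler_order V E r"
    and order: "lists_in_order V r vs" and es: "distinct es" "set es = E"
    and word: "word_size_ok 10 w \<Sigma> V E k" and n: "n \<noteq> 0"
  shows "\<exists>t. real t \<le> 10000 * (real n ^ 4 * log 2 (real k + 1) + 1) \<and>
    computes_within w (program main xOut) (encode_input k vs es) t (card (kmers \<Sigma> V E k))"
proof -
  let ?xs = "encode_input k vs es"
  define m where "m = length es"
  define E' where "E' = {(i, j, a). i < n \<and> j < n \<and> (vs ! i, vs ! j, a) \<in> E}"
  have E: "u < n \<and> v < n \<and> a \<in> \<Sigma>" if "(u, v, a) \<in> E" for u v a
    using graph that V by (auto simp: labeled_graph_def)
  have fin: "finite \<Sigma>" using graph by (simp add: labeled_graph_def)
  have "trans r" and irrefl: "\<And>x. (x, x) \<notin> r"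
    using wheeler by (auto simp: wheeler_order_def strict_linear_order_on_def irrefl_def)
  have sorted: "sorted_wrt (\<lambda>u v. (u, v) \<in> r) vs" and set_vs: "set vs = {..<n}"
    using order V by (simp_all add: lists_in_order_def)
  have less_r: "(vs ! i, vs ! j) \<in> r" if "i < j" "j < length vs" for i j
    using sorted that by (simp add: sorted_wrt_iff_nth_less)
  have "distinct vs"
  proof -
    have "vs ! i \<noteq> vs ! j" if "i < j" "j < length vs" for i j
      using less_r[OF that] irrefl by metis
    then show ?thesis by (metis distinct_conv_nth linorder_neqE_nat)
  qed
  then have len_vs: "length vs = n" using set_vs distinct_card[of vs] by simp
  have r_iff: "(vs ! i, vs ! j) \<in> r \<longleftrightarrow> i < j" if "i < n" "j < n" for i j
  proof
    assume ij: "(vs ! i, vs ! j) \<in> r"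
    show "i < j"
    proof (rule ccontr)
      assume "\<not> i < j"
      then consider "i = j" | "j < i" by linarith
      then show False
      proof cases
        case 2
        then have "(vs ! j, vs ! i) \<in> r" using less_r that len_vs by simp
        then show False using ij \<open>trans r\<close> irrefl by (meson transD)
      qed (use ij irrefl in simp)
    qed
  qed (use less_r that len_vs in simp)
  have vs_eq: "vs ! i = vs ! j \<longleftrightarrow> i = j" if "i < n" "j < n" for i j
    using that \<open>distinct vs\<close> len_vs by (simp add: nth_eq_iff_index_eq)
  have surj: "\<exists>i<n. u = vs ! i" if "u < n" for u
    using that set_vs len_vs by (metis in_set_conv_nth lessThan_iff)
  have W1: "(v, v') \<in> r" if "(u, v, a) \<in> E" "(u', v', a') \<in> E" "a < a'" for u v a u' v' a'
    using wheeler that unfolding wheeler_order_def by blast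
  have W2: "v = v' \<or> (v, v') \<in> r" if "(u, v, a) \<in> E" "(u', v', a) \<in> E" "(u, u') \<in> r" for u v a u' v'
    using wheeler that unfolding wheeler_order_def by blast
  have W0: "(v, v') \<in> r" if "v < n" "\<nexists>u a. (u, v, a) \<in> E" "(u', v', a') \<in> E" for v u' v' a'
    using wheeler that E unfolding wheeler_order_def V by blast
  have pos: "wheeler_positions n \<Sigma> E'"
  proof
    show "finite \<Sigma>" by (fact fin)
    show "u < n \<and> v < n \<and> a \<in> \<Sigma>" if "(u, v, a) \<in> E'" for u v a
      using that E by (auto simp: E'_def)
    show "v = v'" if "(u, v, a) \<in> E'" "(u, v', a) \<in> E'" for u v v' a
      using that det vs_eq unfolding E'_def deterministic_def by blast
    show "v < v'" if v: "v < n" "\<nexists>u a. (u, v, a) \<in> E'" and e: "(u', v', a') \<in> E'" for v u' v' a'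
    proof -
      have "\<nexists>u a. (u, vs ! v, a) \<in> E" using v surj E by (fastforce simp: E'_def)
      moreover have "vs ! v < n" using v set_vs len_vs nth_mem by blast
      ultimately have "(vs ! v, vs ! v') \<in> r" using W0 e by (auto simp: E'_def)
      then show ?thesis using r_iff v e by (simp add: E'_def)
    qed
    show "v < v'" if "(u, v, a) \<in> E'" "(u', v', a') \<in> E'" "a < a'" for u v a u' v' a'
    proof -
      have "(vs ! v, vs ! v') \<in> r"
        using W1[of "vs ! u" "vs ! v" a "vs ! u'" "vs ! v'" a'] that by (simp add: E'_def)
      then show ?thesis using that r_iff by (simp add: E'_def)
    qed
    show "v \<le> v'" if "(u, v, a) \<in> E'" "(u', v', a) \<in> E'" "u < u'" for u v a u' v'
    proof -
      have "(vs ! u, vs ! u') \<in> r" using that r_iff by (simp add: E'_def)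
      then have "vs ! v = vs ! v' \<or> (vs ! v, vs ! v') \<in> r"
        using W2[of "vs ! u" "vs ! v" a "vs ! u'" "vs ! v'"] that by (simp add: E'_def)
      then show ?thesis using that r_iff vs_eq by (auto simp: E'_def)
    qed
  qed
  \<comment> \<open>Two labels between the same endpoints would put the target before itself by W1,
    so each ordered pair of vertices carries at most one edge.\<close>
  have "inj_on (\<lambda>(u, v, a). (u, v)) E"
    using W1 irrefl by (auto simp: inj_on_def) (metis linorder_neqE_nat)+
  then have "card E \<le> card ({..<n} \<times> {..<n})"
    by (rule card_inj_on_le) (use E in auto)
  then have m_le: "m \<le> n ^ 2"
    using es distinct_card[of es] by (simp add: m_def power2_eq_square)
  have xs_len: "length ?xs = 3 + n + 3 * m"
    using encode_input_nth(1)[OF len_vs m_def[symmetric]] .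
  have "(n + 1) ^ 10 \<le> 2 ^ w" using word V by (simp add: word_size_ok_def)
  then have fits: "length ?xs + 16 * n ^ 3 \<le> 2 ^ w"
    using input_fits[OF _ m_le] n unfolding xs_len by simp
  interpret encoded w n ?xs \<Sigma> E' k m vs es
  proof (intro encoded.intro encoded_axioms.intro pos)
    show "word_ram w n ?xs" using n fits by unfold_locales auto
  qed (use len_vs m_def \<open>distinct vs\<close> set_vs es E m_le in \<open>auto simp: E'_def\<close>)
  have kmers: "kmers \<Sigma> V E k = strings_below k n"
  proof -
    have "contains_string V E \<alpha> \<longleftrightarrow> (\<exists>i<n. readable \<alpha> i)" for \<alpha>
      by (rule contains_string_iff_readable[OF pos _ len_vs]) (use set_vs V E in \<open>auto simp: E'_def\<close>)
    then show ?thesis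
      using readable_alphabet by (auto simp: kmers_def strings_below_def)
  qed
  obtain K where K: "k div 2 ^ K = 0" "\<forall>i<K. k div 2 ^ i \<noteq> 0" "real K \<le> 2 * log 2 (real k + 1)"
    by (rule halvings[OF k])
  have "card (strings_below k n) < 2 ^ w"
    using card_kmers_less[OF word _ k] kmers by simp
  from triple_main[OF K(1) K(2)[rule_format] this] program_correct[OF xs_len]
  obtain t where t: "t \<le> n ^ 4 * 1700 + n ^ 4 * 2503 * K + 9"
      "computes_within w (program main xOut) ?xs t (card (strings_below k n))"
    using xs_nth(2,3) by blast
  have "real t \<le> real n ^ 4 * 1700 + real n ^ 4 * 2503 * real K + 9"
    using of_nat_mono[OF t(1), where 'a = real] by simp
  also have "real n ^ 4 * 2503 * real K \<le> real n ^ 4 * 2503 * (2 * log 2 (real k + 1))"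
    using K(3) by (intro mult_left_mono) auto
  also have "real n ^ 4 * 1700 \<le> real n ^ 4 * 1700 * log 2 (real k + 1)"
  proof -
    have "1 \<le> log 2 (real k + 1)" using k by (simp add: le_log_iff)
    then have "real n ^ 4 * 1700 * 1 \<le> real n ^ 4 * 1700 * log 2 (real k + 1)"
      by (intro mult_left_mono) auto
    then show ?thesis by simp
  qed
  \<comment> \<open>Here 6706 is 1700 + 2 * 2503.\<close>
  finally have "real t \<le> 6706 * (real n ^ 4 * log 2 (real k + 1)) + 9" by simp
  also have "\<dots> \<le> 10000 * (real n ^ 4 * log 2 (real k + 1) + 1)"
  proof -
    have "0 \<le> real n ^ 4 * log 2 (real k + 1)" using k by simp
    then show ?thesis by simp
  qed
  finally show ?thesis using t(2) kmers by auto
qed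

text \<open>A walk has one vertex more than letters, so the empty graph contains no string at all,
  and the program halts with 0 after testing the vertex count.\<close>

lemma main_correct_empty:
  assumes "V = {}" "lists_in_order V r vs"
  shows "computes_within w (program main xOut) (encode_input k vs es) 2 (card (kmers \<Sigma> V E k))"
proof -
  have "vs = []" using assms by (simp add: lists_in_order_def)
  moreover have "kmers \<Sigma> V E k = {}"
    using assms(1) by (auto simp: kmers_def contains_string_def)
  ultimately show ?thesis by (simp add: program_correct_empty encode_input_def)
qed

theorem theorem10:
  shows "\<exists>(P :: instr list) (c :: nat) (C :: real).
    \<forall>(n :: nat) (k :: nat) (w :: nat) (\<Sigma> :: nat set) (V :: nat set)
     (E :: (nat \<times> nat \<times> nat) set) (r :: (nat \<times> nat) set) vs es.
      V = {..<n} \<and> 1 \<le> k \<and>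
      labeled_graph \<Sigma> V E \<and> deterministic E \<and> wheeler_order V E r \<and>
      lists_in_order V r vs \<and> distinct es \<and> set es = E \<and>
      word_size_ok c w \<Sigma> V E k \<longrightarrow>
      (\<exists>t. real t \<le> C * (real n ^ 4 * log 2 (real k + 1) + 1) \<and>
           computes_within w P (encode_input k vs es) t (card (kmers \<Sigma> V E k)))"
proof (rule exI[of _ "program main xOut"], rule exI[of _ 10], rule exI[of _ 10000],
    intro allI impI, elim conjE, goal_cases)
  case (1 n k w \<Sigma> V E r vs es)
  show ?case
  proof (cases "n = 0")
    case True
    \<comment> \<open>For n = 0 the two steps are paid by the additive 1 in the bound.\<close>
    have "real 2 \<le> 10000 * (real n ^ 4 * log 2 (real k + 1) + 1)" using True by simp
    then show ?thesis using main_correct_empty[of V r vs] 1 True by blast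
  next
    case False
    then show ?thesis using main_correct 1 by blast
  qed
qed

end
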